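(* Let $\mathfrak g$ be a dg Lie algebra. There is a one-to-one correspondence between weak Loday-Pirashvili modules over $\mathfrak g$ and morphisms in the category $\mathbf{dgVec}_{B\mathfrak g}$ of dg vector bundles over the dg manifold $B\mathfrak g$ whose target is the shifted tangent bundle $T_{[-1]}B\mathfrak g$.
   Context: Conventions: $\mathbb K$ is $\mathbb R$ or $\mathbb C$; graded means $\mathbb Z$-graded; dg Lie algebras and (underlying spaces of) $\infty$-modules are finite dimensional; $V[p]^i=V^{i+p}$. For a dg Lie algebra $\mathfrak g=(\mathfrak g,d,[-,-])$, $C(\mathfrak g)=\bigoplus_{p\ge0}C^p(\mathfrak g)$, $C^p(\mathfrak g)=S^p(\mathfrak g^\vee[-1])$, with differential $d_{\mathrm{CE}}=d_0+d_1$, $d_0$ induced by the dual of $d$ and $d_1$ the derivation with $d_1(\xi[-1])(x[1],y[1])=(-1)^{|\xi|+1+|x|}\xi([x,y])$. Put $C^k(\mathfrak g,M)=C^k(\mathfrak g)\otimes M$, $C(\mathfrak g,M)=C(\mathfrak g)\otimes M$. A locally finite $\infty$-$\mathfrak g$-module is a cochain complex $(M,d^M)$ with degree $+1$ maps $d_k^M\colon M\to C^k(\mathfrak g,M)$, $k\ge 0$, $d_0^M=d^M$, such that for each $m$, $d_k^M(m)=0$ for large $k$, and $d_{\mathrm{tot}}^M=d_{\mathrm{CE}}\otimes\mathrm{id}_M+\sum_k\mathrm{id}\otimes d_k^M$ squares to zero on $C(\mathfrak g,M)$. An $\infty$-morphism $f\colon M\rightsquigarrow N$ is a family of degree $0$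 maps $f_k\colon M\to C^k(\mathfrak g,N)$, with $f_k(m)=0$ for large $k$ (depending on $m$), whose $C(\mathfrak g)$-linear extension commutes with total differentials. The adjoint module is $\mathfrak g$ with $d_0^{\mathfrak g}=d$, $\iota_{x[1]}d_1^{\mathfrak g}(y)=[x,y]$, $d_k^{\mathfrak g}=0$ for $k\ge2$. A weak Loday-Pirashvili module over $\mathfrak g$ is an $\infty$-morphism $f\colon M\rightsquigarrow\mathfrak g$ from a locally finite $\infty$-$\mathfrak g$-module $M$ to the adjoint module. $B\mathfrak g=(\mathfrak g[1],d_{\mathrm{CE}})$ is the (formal, pointed) dg manifold whose algebra of functions is identified with the dg algebra $C(\mathfrak g)$. $\mathbf{dgVec}_{B\mathfrak g}$ is the category of (finite rank) dg vector bundles over $B\mathfrak g$; a dg vector bundle $\mathcal E$ is a graded vector bundle whose sections $\Gamma(\mathcal E)$ carry a differential making them a dg $C(\mathfrak g)$-module. Taking global sections is an equivalence from $\mathbf{dgVec}_{B\mathfrak g}$ to the category of dg $C(\mathfrak g)$-modules that are finitely generated and free as graded $C(\mathfrak g)$-modules (a known fact due to Mehta, Stiénon and Xu). The shifted tangent bundle $T_{[-1]}B\mathfrak g$ is the tangent bundle of $B\mathfrak g$ with shifted degree, whose dg module of sections is identified with $(C(\mathfrak g,\mathfrak g),d_{\mathrm{tot}}^{\mathfrak g})$. The correspondence is understood modulo these identifications of dg vector bundles with their dg modules of sections. *)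

theory Defs
  imports "HOL-Analysis.Analysis" "HOL-Library.Function_Algebras" "HOL-Library.FuncSet"
begin

text \<open>The complete list of instances up to isomorphism is \<open>\<real>\<close> and \<open>\<complex>\<close>: a finite-dimensional real
  normed field is one of the two.\<close>

class real_or_complex = real_normed_field + euclidean_space

instance real :: real_or_complex ..

instance complex :: real_or_complex ..


section \<open>Graded vector spaces and dg Lie algebras\<close>

definition ksgn :: "int \<Rightarrow> 'k::comm_ring_1"
  where "ksgn n = (if even n then 1 else - 1)"

text \<open>Internal sums of a \<open>\<int>\<close>-indexed family of subgroups of an ambient abelian group.\<close>

definition dsum :: "(int \<Rightarrow> 'v::ab_group_add set) \<Rightarrow> 'v set"
  where "dsum H = {\<Sum>i\<in>I. x i |I x. finite I \<and> (\<forall>i\<in>I. x i \<in> H i)}"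

definition direct :: "(int \<Rightarrow> 'v::ab_group_add set) \<Rightarrow> bool"
  where "direct H \<longleftrightarrow>
    (\<forall>I x. finite I \<and> (\<forall>i\<in>I. x i \<in> H i) \<and> (\<Sum>i\<in>I. x i) = 0 \<longrightarrow> (\<forall>i\<in>I. x i = 0))"

text \<open>A graded vector space lives inside an ambient \<open>'k\<close>-vector space \<open>'v\<close>: its underlying space is
  the internal direct sum \<open>gsp V\<close> of the subspaces \<open>hc V i\<close>, not the whole type.\<close>

record ('k, 'v) gvect =
  scl :: "'k \<Rightarrow> 'v \<Rightarrow> 'v"
  hc :: "int \<Rightarrow> 'v set"

abbreviation gsp :: "('k, 'v::ab_group_add, 'z) gvect_scheme \<Rightarrow> 'v set"
  where "gsp V \<equiv> dsum (hc V)"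

definition fd_graded :: "('k::field, 'v::ab_group_add, 'z) gvect_scheme \<Rightarrow> bool"
  where "fd_graded V \<longleftrightarrow>
    vector_space (scl V) \<and> (\<forall>i. module.subspace (scl V) (hc V i)) \<and> direct (hc V) \<and>
    (\<exists>B. finite B \<and> gsp V \<subseteq> module.span (scl V) B)"

definition lin_on ::
    "('k, 'v::ab_group_add, 'z) gvect_scheme \<Rightarrow> ('k \<Rightarrow> 'w::ab_group_add \<Rightarrow> 'w) \<Rightarrow> ('v \<Rightarrow> 'w) \<Rightarrow> bool"
  where "lin_on V s f \<longleftrightarrow>
    (\<forall>x\<in>gsp V. \<forall>y\<in>gsp V. f (x + y) = f x + f y) \<and> (\<forall>c. \<forall>x\<in>gsp V. f (scl V c x) = s c (f x))"

record ('k, 'g) dgla = "('k, 'g) gvect" +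
  df :: "'g \<Rightarrow> 'g"
  br :: "'g \<Rightarrow> 'g \<Rightarrow> 'g"

definition dg_lie_algebra :: "('k::field_char_0, 'g::ab_group_add) dgla \<Rightarrow> bool"
  where "dg_lie_algebra g \<longleftrightarrow>
    fd_graded g \<and>
    lin_on g (scl g) (df g) \<and>
    (\<forall>x\<in>gsp g. lin_on g (scl g) (br g x)) \<and>
    (\<forall>y\<in>gsp g. lin_on g (scl g) (\<lambda>x. br g x y)) \<and>
    (\<forall>i. \<forall>x\<in>hc g i. df g x \<in> hc g (i + 1) \<and> df g (df g x) = 0) \<and>
    (\<forall>i j. \<forall>x\<in>hc g i. \<forall>y\<in>hc g j.
      br g x y \<in> hc g (i + j) \<and>
      br g x y = - scl g (ksgn (i * j)) (br g y x) \<and>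
      df g (br g x y) = br g (df g x) y + scl g (ksgn i) (br g x (df g y))) \<and>
    (\<forall>i j k. \<forall>x\<in>hc g i. \<forall>y\<in>hc g j. \<forall>z\<in>hc g k.
      br g x (br g y z) = br g (br g x y) z + scl g (ksgn (i * j)) (br g y (br g x z)))"


section \<open>The Chevalley-Eilenberg algebra and cochains with coefficients\<close>

text \<open>
  Since \<open>g\<close> is finite dimensional and the characteristic is 0,
  \<open>C\<^sup>p(g) \<otimes> M = S\<^sup>p(g\<^sup>\<or>[-1]) \<otimes> M\<close> is the space of graded symmetric \<open>p\<close>-linear maps from \<open>g[1]\<close> to \<open>M\<close>;
  \<open>\<omega> \<otimes> m\<close> is the map \<open>w \<mapsto> \<omega>(w) m\<close>.
  Such a map is stored through its values on words of homogeneous elements: the letter \<open>(i, x)\<close> with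
  \<open>x \<in> hc g i\<close> stands for \<open>x[1]\<close>, which has degree \<open>i - 1\<close>. Cochains vanish on all other lists.
  Words are paired with forms by the Koszul rule, so that
  \<open>(\<xi>\<^sub>1[-1] \<odot> \<xi>\<^sub>2[-1])(x[1], y[1]) = (-1)\<^bsup>|\<xi>\<^sub>2[-1]| |x[1]|\<^esup> \<xi>\<^sub>1(x) \<xi>\<^sub>2(y) + \<dots>\<close>.
\<close>

type_synonym 'g word = "(int \<times> 'g) list"

definition hword :: "('k, 'g, 'z) gvect_scheme \<Rightarrow> 'g word \<Rightarrow> bool"
  where "hword g w \<longleftrightarrow> (\<forall>(i, x)\<in>set w. x \<in> hc g i)"

definition sdeg :: "int \<times> 'g \<Rightarrow> int"
  where "sdeg x = fst x - 1"

definition wdeg :: "'g word \<Rightarrow> int"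
  where "wdeg w = sum_list (map sdeg w)"

definition multilinear_form ::
    "('k::field, 'g::ab_group_add, 'z) gvect_scheme \<Rightarrow> ('k, 'm::ab_group_add, 'y) gvect_scheme \<Rightarrow>
      ('g word \<Rightarrow> 'm) \<Rightarrow> bool"
  where "multilinear_form g M \<tau> \<longleftrightarrow>
    (\<forall>w. \<tau> w \<in> gsp M) \<and> (\<forall>w. \<not> hword g w \<longrightarrow> \<tau> w = 0) \<and>
    (\<forall>u v i. \<forall>x\<in>hc g i. \<forall>y\<in>hc g i. \<forall>c. hword g u \<and> hword g v \<longrightarrow>
      \<tau> (u @ (i, x + y) # v) = \<tau> (u @ (i, x) # v) + \<tau> (u @ (i, y) # v) \<and>
      \<tau> (u @ (i, scl g c x) # v) = scl M c (\<tau> (u @ (i, x) # v)))"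

definition graded_symmetric :: "('k::field, 'm::ab_group_add, 'y) gvect_scheme \<Rightarrow> ('g word \<Rightarrow> 'm) \<Rightarrow> bool"
  where "graded_symmetric M \<tau> \<longleftrightarrow>
    (\<forall>u v x y. \<tau> (u @ x # y # v) = scl M (ksgn (sdeg x * sdeg y)) (\<tau> (u @ y # x # v)))"

text \<open>\<open>coch_p g M p\<close> is \<open>C\<^sup>p(g, M)\<close> and \<open>coch g M\<close> is \<open>C(g, M) = \<Oplus>\<^sub>p C\<^sup>p(g, M)\<close>.\<close>

definition coch_p ::
    "('k::field, 'g::ab_group_add, 'z) gvect_scheme \<Rightarrow> ('k, 'm::ab_group_add, 'y) gvect_scheme \<Rightarrow>
      nat \<Rightarrow> ('g word \<Rightarrow> 'm) set"
  where "coch_p g M p =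
    {\<tau>. multilinear_form g M \<tau> \<and> graded_symmetric M \<tau> \<and> (\<forall>w. length w \<noteq> p \<longrightarrow> \<tau> w = 0)}"

definition coch ::
    "('k::field, 'g::ab_group_add, 'z) gvect_scheme \<Rightarrow> ('k, 'm::ab_group_add, 'y) gvect_scheme \<Rightarrow>
      ('g word \<Rightarrow> 'm) set"
  where "coch g M =
    {\<tau>. multilinear_form g M \<tau> \<and> graded_symmetric M \<tau> \<and> (\<exists>N. \<forall>w. length w > N \<longrightarrow> \<tau> w = 0)}"

text \<open>Total degree \<open>n\<close>: a form that is nonzero only on words of degree \<open>-q\<close> has degree \<open>q\<close>, so
  the value on a word \<open>w\<close> must have degree \<open>n + wdeg w\<close>.\<close>

definition coch_deg ::
    "('k::field, 'g::ab_group_add, 'z) gvect_scheme \<Rightarrow> ('k, 'm::ab_group_add, 'y) gvect_scheme \<Rightarrow>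
      int \<Rightarrow> ('g word \<Rightarrow> 'm) set"
  where "coch_deg g M n = {\<tau>\<in>coch g M. \<forall>w. \<tau> w \<in> hc M (n + wdeg w)}"

definition ground :: "('k::field, 'k) gvect"
  where "ground = \<lparr>scl = (*), hc = (\<lambda>i. if i = 0 then UNIV else {0})\<rparr>"

text \<open>\<open>(s, u, v) \<in> unshuffles w\<close>: in the symmetric coalgebra on \<open>g[1]\<close>, the word \<open>w\<close> equals
  \<open>(-1)\<^sup>s u v\<close>, and \<open>u\<close>, \<open>v\<close> are complementary subwords.\<close>

fun unshuffles :: "'g word \<Rightarrow> (int \<times> 'g word \<times> 'g word) list" where
  "unshuffles [] = [(0, [], [])]"
| "unshuffles (x # w) =
    map (\<lambda>(s, u, v). (s, x # u, v)) (unshuffles w) @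
    map (\<lambda>(s, u, v). (s + sdeg x * wdeg u, u, x # v)) (unshuffles w)"

text \<open>The action of \<open>C(g)\<close> on \<open>C(g, M)\<close>; for \<open>M = ground\<close> this is the product of \<open>C(g)\<close>.
  The sign \<open>wdeg u * wdeg v\<close> comes from moving the form evaluated at \<open>v\<close> past \<open>u\<close>.\<close>

definition cprod ::
    "('k::field, 'm::ab_group_add, 'y) gvect_scheme \<Rightarrow> ('g word \<Rightarrow> 'k) \<Rightarrow> ('g word \<Rightarrow> 'm) \<Rightarrow> 'g word \<Rightarrow> 'm"
  where "cprod M \<omega> \<tau> w =
    (\<Sum>(s, u, v)\<leftarrow>unshuffles w. scl M (ksgn (s + wdeg u * wdeg v) * \<omega> u) (\<tau> v))"

definition cunit :: "'g word \<Rightarrow> 'k::field"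
  where "cunit w = (if w = [] then 1 else 0)"

text \<open>The codifferential \<open>Q\<close> of the symmetric coalgebra on \<open>g[1]\<close>, as a list of signed words: it is the
  coderivation with \<open>Q(x[1]) = -(d x)[1]\<close> and \<open>Q(x[1], y[1]) = (-1)\<^bsup>|x|\<^esup> [x, y][1]\<close>.
  \<open>ad_word\<close> lets \<open>x\<close> act on the letters of a word one after the other.\<close>

fun ad_word :: "('k, 'g) dgla \<Rightarrow> int \<times> 'g \<Rightarrow> 'g word \<Rightarrow> (int \<times> 'g word) list" where
  "ad_word g x [] = []"
| "ad_word g x (y # w) =
    (0, (fst x + fst y, br g (snd x) (snd y)) # w) #
    map (\<lambda>(s, v). (s + fst x * sdeg y, y # v)) (ad_word g x w)"

fun codiff :: "('k, 'g) dgla \<Rightarrow> 'g word \<Rightarrow> (int \<times> 'g word) list" where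
  "codiff g [] = []"
| "codiff g (x # w) =
    (1, (fst x + 1, df g (snd x)) # w) #
    map (\<lambda>(s, v). (s + fst x, v)) (ad_word g x w) @
    map (\<lambda>(s, v). (s + sdeg x, x # v)) (codiff g w)"

text \<open>\<open>d\<^sub>C\<^sub>E \<otimes> id\<^sub>M\<close>, where \<open>d\<^sub>C\<^sub>E \<omega> = (-1)\<^bsup>|\<omega>|\<^esup> \<omega> \<circ> Q\<close>; when the value at \<open>w\<close> is nonzero, the form has
  degree \<open>-(wdeg w + 1)\<close>. The lemmas \<open>dCE_form1_df\<close>, \<open>dCE_form1_br\<close> and \<open>dCE_cprod\<close> below show that for
  \<open>M = ground\<close> it is the derivation \<open>d\<^sub>0 + d\<^sub>1\<close> given on generators by
  \<open>d\<^sub>0(\<xi>[-1])(x[1]) = (-1)\<^bsup>|\<xi>|\<^esup> \<xi>(d x)\<close>, the dual of \<open>d\<close> with the usual signs of the dual and of the shift,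
  and \<open>d\<^sub>1(\<xi>[-1])(x[1], y[1]) = (-1)\<^bsup>|\<xi>| + 1 + |x|\<^esup> \<xi>([x, y])\<close>.\<close>

definition dCE ::
    "('k::field, 'g) dgla \<Rightarrow> ('k, 'm::ab_group_add, 'y) gvect_scheme \<Rightarrow> ('g word \<Rightarrow> 'm) \<Rightarrow> 'g word \<Rightarrow> 'm"
  where "dCE g M \<tau> w =
    (if hword g w then \<Sum>(s, v)\<leftarrow>codiff g w. scl M (ksgn (s + wdeg w + 1)) (\<tau> v) else 0)"

text \<open>The extension \<open>\<omega> \<otimes> m \<mapsto> (-1)\<^bsup>e |\<omega>|\<^esup> \<omega> \<cdot> h(m)\<close> of a map \<open>h: M \<rightarrow> C(g, N)\<close> of degree \<open>e\<close>.\<close>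

definition cext ::
    "int \<Rightarrow> ('k::field, 'n::ab_group_add, 'y) gvect_scheme \<Rightarrow> ('m \<Rightarrow> 'g word \<Rightarrow> 'n) \<Rightarrow>
      ('g word \<Rightarrow> 'm) \<Rightarrow> 'g word \<Rightarrow> 'n"
  where "cext e N h \<tau> w =
    (\<Sum>(s, u, v)\<leftarrow>unshuffles w. scl N (ksgn (s + wdeg u * wdeg v + e * wdeg u)) (h (\<tau> u) v))"

text \<open>The left contraction \<open>\<iota>\<^bsub>x[1]\<^esub>\<close>, the derivation of degree \<open>|x[1]|\<close> with
  \<open>\<iota>\<^bsub>x[1]\<^esub>\<omega> = (-1)\<^bsup>|x[1]| |\<omega>|\<^esup> \<omega>(x[1], \<dots>)\<close>: here \<open>x[1]\<close> stands to the left of \<open>\<omega>\<close>, in the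
  evaluation to the right.\<close>

definition contract ::
    "('k::field, 'm::ab_group_add, 'y) gvect_scheme \<Rightarrow> int \<times> 'g \<Rightarrow> ('g word \<Rightarrow> 'm) \<Rightarrow> 'g word \<Rightarrow> 'm"
  where "contract M x \<tau> w = scl M (ksgn (sdeg x * wdeg (x # w))) (\<tau> (x # w))"


subsection \<open>Agreement with the defining properties of \<open>d\<^sub>C\<^sub>E\<close> and of the contraction\<close>

text \<open>Nothing in this subsection enters later definitions.\<close>

definition ksig :: "int \<Rightarrow> 'a::ab_group_add \<Rightarrow> 'a"
  where "ksig n m = (if even n then m else - m)"

lemma ksig_add: "ksig n (a + b) = ksig n a + ksig n b" by (simp add: ksig_def)
lemma ksig_K: "ksig n (ksig m a) = ksig (n + m) a" by (simp add: ksig_def)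
lemma ksig_0: "ksig n 0 = 0" by (simp add: ksig_def)
lemma ksig_parity: "even (n - m) \<Longrightarrow> ksig n a = ksig m a" by (simp add: ksig_def)

definition unsh_sum :: "('g word \<Rightarrow> 'g word \<Rightarrow> 'a::ab_group_add) \<Rightarrow> 'g word \<Rightarrow> 'a"
  where "unsh_sum G w = (\<Sum>(s, u, v)\<leftarrow>unshuffles w. ksig s (G u v))"

definition ad_sum :: "('k, 'g) dgla \<Rightarrow> int \<times> 'g \<Rightarrow> ('g word \<Rightarrow> 'a::ab_group_add) \<Rightarrow> 'g word \<Rightarrow> 'a"
  where "ad_sum g x H w = (\<Sum>(s, v)\<leftarrow>ad_word g x w. ksig s (H v))"

definition codiff_sum :: "('k, 'g) dgla \<Rightarrow> ('g word \<Rightarrow> 'a::ab_group_add) \<Rightarrow> 'g word \<Rightarrow> 'a"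
  where "codiff_sum g H w = (\<Sum>(s, v)\<leftarrow>codiff g w. ksig s (H v))"

lemma sum_list_K: "(\<Sum>x\<leftarrow>xs. ksig n (f x)) = ksig n (\<Sum>x\<leftarrow>xs. f x)"
  by (induction xs) (auto simp: ksig_def)

lemma unsh_sum_Nil: "unsh_sum G [] = G [] []" by (simp add: unsh_sum_def ksig_def)

lemma unsh_sum_Cons: "unsh_sum G (x # w) = unsh_sum (\<lambda>u v. G (x # u) v) w + unsh_sum (\<lambda>u v. ksig (sdeg x * wdeg u) (G u (x # v))) w"
  by (simp add: unsh_sum_def o_def case_prod_unfold ksig_K)

lemma ad_sum_Nil: "ad_sum g x H [] = 0" by (simp add: ad_sum_def)

lemma ad_sum_Cons: "ad_sum g x H (y # w) =
    H ((fst x + fst y, br g (snd x) (snd y)) # w) + ksig (fst x * sdeg y) (ad_sum g x (\<lambda>v. H (y # v)) w)"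
  by (simp add: ad_sum_def o_def case_prod_unfold ksig_K add.commute flip: sum_list_K) (simp add: ksig_def)

lemma codiff_sum_Nil: "codiff_sum g H [] = 0" by (simp add: codiff_sum_def)

lemma codiff_sum_Cons: "codiff_sum g H (x # w) =
    ksig 1 (H ((fst x + 1, df g (snd x)) # w)) + ksig (fst x) (ad_sum g x H w) + ksig (sdeg x) (codiff_sum g (\<lambda>v. H (x # v)) w)"
  by (simp add: codiff_sum_def ad_sum_def o_def case_prod_unfold ksig_K add.commute flip: sum_list_K)

lemma unsh_sum_add: "unsh_sum (\<lambda>u v. G u v + G' u v) w = unsh_sum G w + unsh_sum G' w"
  by (simp add: unsh_sum_def case_prod_unfold ksig_add sum_list_addf)
lemma ad_sum_add: "ad_sum g x (\<lambda>u. G u + G' u) w = ad_sum g x G w + ad_sum g x G' w"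
  by (simp add: ad_sum_def case_prod_unfold ksig_add sum_list_addf)
lemma codiff_sum_add: "codiff_sum g (\<lambda>u. G u + G' u) w = codiff_sum g G w + codiff_sum g G' w"
  by (simp add: codiff_sum_def case_prod_unfold ksig_add sum_list_addf)

lemma unsh_sum_K: "unsh_sum (\<lambda>u v. ksig n (G u v)) w = ksig n (unsh_sum G w)"
  by (simp add: unsh_sum_def case_prod_unfold ksig_K add.commute flip: sum_list_K)
lemma ad_sum_K: "ad_sum g x (\<lambda>u. ksig n (G u)) w = ksig n (ad_sum g x G w)"
  by (simp add: ad_sum_def case_prod_unfold ksig_K add.commute flip: sum_list_K)
lemma codiff_sum_K: "codiff_sum g (\<lambda>u. ksig n (G u)) w = ksig n (codiff_sum g G w)"
  by (simp add: codiff_sum_def case_prod_unfold ksig_K add.commute flip: sum_list_K)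

lemma wdeg_simps: "wdeg [] = 0" "wdeg (x # w) = sdeg x + wdeg w" "sdeg (i, y) = i - 1"
  by (simp_all add: wdeg_def sdeg_def)

lemma unshuffles_hd: "(s, u, v) \<in> set (unshuffles w) \<Longrightarrow>
    wdeg u + wdeg v = wdeg w \<and> set u \<union> set v = set w"
  by (induction w arbitrary: s u v) (fastforce simp: wdeg_simps)+

lemma ad_word_wdeg: "(s, v) \<in> set (ad_word g x w) \<Longrightarrow> wdeg v = wdeg w + fst x"
  by (induction w arbitrary: s v) (fastforce simp: wdeg_simps sdeg_def)+

lemma codiff_wdeg: "(s, v) \<in> set (codiff g w) \<Longrightarrow> wdeg v = wdeg w + 1"
  by (induction w arbitrary: s v) (fastforce simp: wdeg_simps sdeg_def dest: ad_word_wdeg)+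

lemma ad_sum_Kw: "ad_sum g x (\<lambda>u. ksig (f (wdeg u)) (G u)) w = ksig (f (wdeg w + fst x)) (ad_sum g x G w)"
  unfolding ad_sum_def sum_list_K[symmetric]
  by (intro arg_cong[of _ _ sum_list] map_cong refl) (auto dest!: ad_word_wdeg simp: ksig_K add.commute)

lemma codiff_sum_Kw: "codiff_sum g (\<lambda>u. ksig (f (wdeg u)) (G u)) w = ksig (f (wdeg w + 1)) (codiff_sum g G w)"
  unfolding codiff_sum_def sum_list_K[symmetric]
  by (intro arg_cong[of _ _ sum_list] map_cong refl) (auto dest!: codiff_wdeg simp: ksig_K add.commute)

lemma unsh_sum_cong:
  assumes "\<And>u v. wdeg u + wdeg v = wdeg w \<Longrightarrow> set u \<union> set v = set w \<Longrightarrow> G u v = G' u v"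
  shows "unsh_sum G w = unsh_sum G' w"
  unfolding unsh_sum_def
  by (intro arg_cong[of _ _ sum_list] map_cong refl) (use assms unshuffles_hd in fastforce)

lemma ad_sum_US:
  "ad_sum g x (unsh_sum G) w = unsh_sum (\<lambda>a b. ad_sum g x (\<lambda>a'. G a' b) a + ksig (fst x * wdeg a) (ad_sum g x (G a) b)) w"
proof (induction w arbitrary: G)
  case Nil
  show ?case by (simp add: ad_sum_Nil unsh_sum_Nil ksig_0)
next
  case (Cons y w)
  have 1: "ad_sum g x (\<lambda>a'. ksig (sdeg y * wdeg a') (G a' (y # b))) a
      = ksig (sdeg y * (wdeg a + fst x)) (ad_sum g x (\<lambda>a'. G a' (y # b)) a)" for a b
    by (rule ad_sum_Kw)
  show ?case
    unfolding ad_sum_Cons unsh_sum_Cons ad_sum_add Cons.IH unsh_sum_add ksig_add 1 ad_sum_K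
    by (simp add: ksig_K ksig_add unsh_sum_add algebra_simps wdeg_simps flip: unsh_sum_K)
      (auto simp: ksig_def sdeg_def fun_eq_iff intro!: arg_cong2[where f = "(+)"] arg_cong2[where f = unsh_sum])
qed

lemma codiff_sum_US:
  "codiff_sum g (unsh_sum G) w = unsh_sum (\<lambda>a b. codiff_sum g (\<lambda>a'. G a' b) a + ksig (wdeg a) (codiff_sum g (G a) b)) w"
proof (induction w arbitrary: G)
  case Nil
  show ?case by (simp add: codiff_sum_Nil unsh_sum_Nil ksig_0)
next
  case (Cons y w)
  have 1: "codiff_sum g (\<lambda>a'. ksig (sdeg y * wdeg a') (G a' (y # b))) a
      = ksig (sdeg y * (wdeg a + 1)) (codiff_sum g (\<lambda>a'. G a' (y # b)) a)" for a b
    by (rule codiff_sum_Kw)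
  show ?case
    unfolding codiff_sum_Cons unsh_sum_Cons codiff_sum_add Cons.IH unsh_sum_add ksig_add 1 codiff_sum_K ad_sum_US
    by (simp add: ksig_K ksig_add unsh_sum_add algebra_simps wdeg_simps flip: unsh_sum_K)
      (auto simp: ksig_def sdeg_def fun_eq_iff intro!: arg_cong2[where f = "(+)"] arg_cong2[where f = unsh_sum])
qed

lemma scl_ksgn: "vector_space s \<Longrightarrow> s (ksgn n) m = ksig n m"
  by (simp add: ksgn_def ksig_def vector_space.vector_space_assms(4) module.scale_minus_left
      module_iff_vector_space[symmetric])

lemma cprod_US:
  assumes "vector_space (scl M)"
  shows "cprod M \<omega> \<tau> w = unsh_sum (\<lambda>u v. ksig (wdeg u * wdeg v) (scl M (\<omega> u) (\<tau> v))) w"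
proof -
  interpret vector_space "scl M" by fact
  show ?thesis
    by (simp add: cprod_def unsh_sum_def ksig_K scl_ksgn[OF assms] flip: scale_scale)
qed

lemma dCE_CS:
  assumes "vector_space (scl M)"
  shows "dCE g M \<tau> w = (if hword g w then ksig (wdeg w + 1) (codiff_sum g \<tau> w) else 0)"
  by (simp add: dCE_def codiff_sum_def scl_ksgn[OF assms] ksig_K case_prod_unfold add_ac flip: sum_list_K)

lemma vector_space_ground: "vector_space (scl (ground :: ('k::field, 'k) gvect))"
  by unfold_locales (simp_all add: ground_def algebra_simps)

lemma dCE_cprod:
  fixes g :: "('k::field, 'g::ab_group_add) dgla" and M :: "('k, 'm::ab_group_add, 'y) gvect_scheme"
  assumes M: "vector_space (scl M)" and \<omega>: "\<omega> \<in> coch_deg g ground p" and \<tau>: "\<tau> \<in> coch g M"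
  shows "dCE g M (cprod M \<omega> \<tau>) =
    cprod M (dCE g ground \<omega>) \<tau> + cprod M (\<lambda>w. ksgn p * \<omega> w) (dCE g M \<tau>)"
proof
  fix w
  interpret vector_space "scl M" by fact
  have sK: "scl M (ksig n c) x = ksig n (scl M c x)" "scl M c (ksig n x) = ksig n (scl M c x)" for n c x
    by (auto simp: ksig_def)
  have sl: "(\<Sum>x\<leftarrow>xs. scl M (f x) m) = scl M (\<Sum>x\<leftarrow>xs. f x) m"
    "(\<Sum>x\<leftarrow>xs. scl M c (h x)) = scl M c (\<Sum>x\<leftarrow>xs. h x)"
    for xs :: "(int \<times> 'g word) list" and f h m c
    by (induction xs) (simp_all add: scale_left_distrib scale_right_distrib)
  have C1: "codiff_sum g (\<lambda>u. scl M (\<omega> u) m) a = scl M (codiff_sum g \<omega> a) m" for m a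
    by (simp add: codiff_sum_def case_prod_unfold sl flip: sK)
  have C2: "codiff_sum g (\<lambda>v. scl M c (\<tau> v)) b = scl M c (codiff_sum g \<tau> b)" for c b
    by (simp add: codiff_sum_def case_prod_unfold sl flip: sK(2))
  have deg: "ksgn p * \<omega> u = ksig (wdeg u) (\<omega> u)" for u
    using \<omega> by (auto simp: coch_deg_def ground_def ksgn_def ksig_def split: if_splits)
       (metis even_add add.commute dvd_0_right singletonD)+
  have D1: "codiff_sum g (\<lambda>a'. ksig (wdeg a' * wdeg b) (scl M (\<omega> a') (\<tau> b))) a =
      ksig ((wdeg a + 1) * wdeg b) (scl M (codiff_sum g \<omega> a) (\<tau> b))" for a b
    using codiff_sum_Kw[of g "\<lambda>n. n * wdeg b" "\<lambda>a'. scl M (\<omega> a') (\<tau> b)" a] by (simp add: C1)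
  have D2: "codiff_sum g (\<lambda>b'. ksig (wdeg a * wdeg b') (scl M (\<omega> a) (\<tau> b'))) b =
      ksig (wdeg a * (wdeg b + 1)) (scl M (\<omega> a) (codiff_sum g \<tau> b))" for a b
    using codiff_sum_Kw[of g "\<lambda>n. wdeg a * n" "\<lambda>b'. scl M (\<omega> a) (\<tau> b')" b] by (simp add: C2)
  have L: "codiff_sum g (cprod M \<omega> \<tau>) w = unsh_sum (\<lambda>a b. ksig ((wdeg a + 1) * wdeg b) (scl M (codiff_sum g \<omega> a) (\<tau> b)) +
      ksig (wdeg a + wdeg a * (wdeg b + 1)) (scl M (\<omega> a) (codiff_sum g \<tau> b))) w"
    unfolding cprod_US[OF M] codiff_sum_US D1 D2 ksig_K ..
  have Z: "\<not> hword g u \<Longrightarrow> \<omega> u = 0" "\<not> hword g u \<Longrightarrow> \<tau> u = 0" for u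
    using \<omega> \<tau> by (auto simp: coch_deg_def coch_def multilinear_form_def)
  have hw: "hword g w \<longleftrightarrow> hword g u \<and> hword g v" if "set u \<union> set v = set w" for u v
    unfolding hword_def that[symmetric] by blast
  show "dCE g M (cprod M \<omega> \<tau>) w =
    (cprod M (dCE g ground \<omega>) \<tau> + cprod M (\<lambda>w. ksgn p * \<omega> w) (dCE g M \<tau>)) w"
  proof (cases "hword g w")
    case True
    show ?thesis
      unfolding plus_fun_apply cprod_US[OF M] dCE_CS[OF M] dCE_CS[OF vector_space_ground] L deg
        unsh_sum_add[symmetric]
      using True
      by (simp flip: unsh_sum_K, intro unsh_sum_cong)
        (auto simp: hw sK ksig_K ksig_add intro!: arg_cong2[where f = "(+)"] ksig_parity; metis even_add)
  next
    case False
    have "unsh_sum G w = 0" if "\<And>u v. \<not> hword g u \<Longrightarrow> G u v = (0 :: 'm)" "\<And>u v. \<not> hword g v \<Longrightarrow> G u v = 0" for G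
    proof -
      have "unsh_sum G w = unsh_sum (\<lambda>u v. 0) w"
        by (rule unsh_sum_cong) (use that False hw in blast)
      then show ?thesis by (simp add: unsh_sum_def ksig_0 case_prod_unfold)
    qed
    then show ?thesis
      unfolding plus_fun_apply cprod_US[OF M] dCE_CS[OF M] dCE_CS[OF vector_space_ground]
      using False by (auto simp: Z ksig_0)
  qed
qed

text \<open>In \<open>dCE_form1_df\<close> and \<open>dCE_form1_br\<close>, \<open>p\<close> is the degree of \<open>\<xi> \<in> g\<^sup>\<or>\<close> before the shift, which
  is determined by the arguments on which \<open>\<xi>\<close> is nonzero.\<close>

lemma dCE_form1_df:
  assumes "\<xi> \<in> coch_p g ground 1" and "x \<in> hc g i" and "p = - (i + 1)"
  shows "dCE g ground \<xi> [(i, x)] = ksgn p * \<xi> [(i + 1, df g x)]"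
  using assms by (simp add: dCE_def hword_def wdeg_simps ground_def ksgn_def)

lemma dCE_form1_br:
  assumes "\<xi> \<in> coch_p g ground 1" and "x \<in> hc g i" and "y \<in> hc g j" and "p = - (i + j)"
  shows "dCE g ground \<xi> [(i, x), (j, y)] = ksgn (p + 1 + i) * \<xi> [(i + j, br g x y)]"
  using assms by (simp add: dCE_def hword_def wdeg_simps ground_def ksgn_def coch_p_def)

lemma contract_cprod:
  assumes M: "vector_space (scl M)" and \<omega>: "\<omega> \<in> coch_deg g ground p"
  shows "contract M x (cprod M \<omega> \<tau>) =
    cprod M (contract ground x \<omega>) \<tau> + cprod M (\<lambda>w. ksgn (sdeg x * p) * \<omega> w) (contract M x \<tau>)"
proof
  fix w
  interpret vector_space "scl M" by fact
  have sK: "scl M (ksig n c) m = ksig n (scl M c m)" "scl M c (ksig n m) = ksig n (scl M c m)" for n c m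
    by (auto simp: ksig_def)
  have deg: "ksgn (sdeg x * p) * \<omega> u = ksig (sdeg x * wdeg u) (\<omega> u)" for u
    using \<omega> by (auto simp: coch_deg_def ground_def ksgn_def ksig_def split: if_splits)
       (metis even_add add.commute dvd_0_right singletonD)+
  show "contract M x (cprod M \<omega> \<tau>) w =
    (cprod M (contract ground x \<omega>) \<tau> + cprod M (\<lambda>w. ksgn (sdeg x * p) * \<omega> w) (contract M x \<tau>)) w"
    unfolding plus_fun_apply cprod_US[OF M] contract_def scl_ksgn[OF M]
      scl_ksgn[OF vector_space_ground] deg unsh_sum_Cons unsh_sum_add[symmetric] unsh_sum_K[symmetric]
    by (intro unsh_sum_cong, drule sym)
      (auto simp: sK ksig_K ksig_add wdeg_simps algebra_simps intro!: arg_cong2[where f = "(+)"] ksig_parity)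
qed


section \<open>Locally finite \<open>\<infinity>\<close>-modules and weak Loday-Pirashvili modules\<close>

text \<open>Families of maps \<open>f k: M \<rightarrow> C\<^sup>k(g, N)\<close> that are homogeneous of degree \<open>e\<close> and locally finite.\<close>

definition coch_family ::
    "('k::field, 'g::ab_group_add, 'z) gvect_scheme \<Rightarrow> int \<Rightarrow> ('k, 'm::ab_group_add) gvect \<Rightarrow>
      ('k, 'n::ab_group_add) gvect \<Rightarrow> (nat \<Rightarrow> 'm \<Rightarrow> 'g word \<Rightarrow> 'n) \<Rightarrow> bool"
  where "coch_family g e M N f \<longleftrightarrow>
    (\<forall>k. f k \<in> gsp M \<rightarrow>\<^sub>E coch_p g N k) \<and>
    (\<forall>k. lin_on M (\<lambda>c \<tau> w. scl N c (\<tau> w)) (f k)) \<and>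
    (\<forall>k i. \<forall>m\<in>hc M i. f k m \<in> coch_deg g N (i + e)) \<and>
    (\<forall>m\<in>gsp M. \<exists>n. \<forall>k\<ge>n. f k m = 0)"

definition fam_sum :: "(nat \<Rightarrow> 'm \<Rightarrow> 'g word \<Rightarrow> 'n::ab_group_add) \<Rightarrow> 'm \<Rightarrow> 'g word \<Rightarrow> 'n"
  where "fam_sum f m = (\<Sum>k | f k m \<noteq> 0. f k m)"

definition dtot ::
    "('k::field, 'g) dgla \<Rightarrow> ('k, 'm::ab_group_add) gvect \<Rightarrow> (nat \<Rightarrow> 'm \<Rightarrow> 'g word \<Rightarrow> 'm) \<Rightarrow>
      ('g word \<Rightarrow> 'm) \<Rightarrow> 'g word \<Rightarrow> 'm"
  where "dtot g M \<delta> \<tau> = dCE g M \<tau> + cext 1 M (fam_sum \<delta>) \<tau>"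

text \<open>The cochain complex condition on \<open>(M, d\<^sub>0)\<close> uses the identification of \<open>C\<^sup>0(g, M)\<close> with \<open>M\<close> by
  evaluation at the empty word.\<close>

definition inf_module ::
    "('k::field_char_0, 'g::ab_group_add) dgla \<Rightarrow> ('k, 'm::ab_group_add) gvect \<Rightarrow>
      (nat \<Rightarrow> 'm \<Rightarrow> 'g word \<Rightarrow> 'm) \<Rightarrow> bool"
  where "inf_module g M \<delta> \<longleftrightarrow>
    fd_graded M \<and> coch_family g 1 M M \<delta> \<and>
    (\<forall>m\<in>gsp M. \<delta> 0 (\<delta> 0 m []) [] = 0) \<and>
    (\<forall>\<tau>\<in>coch g M. dtot g M \<delta> (dtot g M \<delta> \<tau>) = 0)"

abbreviation inf_ext ::
    "('k::field, 'n::ab_group_add) gvect \<Rightarrow> (nat \<Rightarrow> 'm \<Rightarrow> 'g word \<Rightarrow> 'n) \<Rightarrow> ('g word \<Rightarrow> 'm) \<Rightarrow> 'g word \<Rightarrow> 'n"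
  where "inf_ext N f \<equiv> cext 0 N (fam_sum f)"

definition inf_morphism ::
    "('k::field_char_0, 'g::ab_group_add) dgla \<Rightarrow>
      ('k, 'm::ab_group_add) gvect \<times> (nat \<Rightarrow> 'm \<Rightarrow> 'g word \<Rightarrow> 'm) \<Rightarrow>
      ('k, 'n::ab_group_add) gvect \<times> (nat \<Rightarrow> 'n \<Rightarrow> 'g word \<Rightarrow> 'n) \<Rightarrow>
      (nat \<Rightarrow> 'm \<Rightarrow> 'g word \<Rightarrow> 'n) \<Rightarrow> bool"
  where "inf_morphism g = (\<lambda>(M, \<delta>) (N, \<epsilon>) f.
    inf_module g M \<delta> \<and> inf_module g N \<epsilon> \<and> coch_family g 0 M N f \<and>
    (\<forall>\<tau>\<in>coch g M. inf_ext N f (dtot g M \<delta> \<tau>) = dtot g N \<epsilon> (inf_ext N f \<tau>)))"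

abbreviation under :: "('k, 'g) dgla \<Rightarrow> ('k, 'g) gvect"
  where "under g \<equiv> gvect.truncate g"

definition adj_diff :: "('k::field, 'g::ab_group_add) dgla \<Rightarrow> nat \<Rightarrow> 'g \<Rightarrow> 'g word \<Rightarrow> 'g"
  where "adj_diff g k = restrict (\<lambda>y w.
    if hword g w \<and> length w = k
    then (case w of [] \<Rightarrow> df g y | [x] \<Rightarrow> scl g (ksgn (sdeg x)) (br g (snd x) y) | _ \<Rightarrow> 0)
    else 0) (gsp g)"

text \<open>The sign in \<open>adj_diff\<close> is the one that makes \<open>\<iota>\<^bsub>x[1]\<^esub>d\<^sub>1(y) = [x, y]\<close>.\<close>

lemma contract_adj_diff:
  assumes "vector_space (scl g)" and "x \<in> hc g i" and "y \<in> gsp g"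
  shows "contract g (i, x) (adj_diff g 1 y) [] = br g x y"
proof -
  interpret vector_space "scl g" by fact
  show ?thesis
    using assms(2,3) by (auto simp: contract_def adj_diff_def hword_def wdeg_def ksgn_def)
qed

text \<open>A weak Loday-Pirashvili module \<open>((M, \<delta>), f)\<close>.\<close>

type_synonym ('k, 'g, 'm) wlp =
  "(('k, 'm) gvect \<times> (nat \<Rightarrow> 'm \<Rightarrow> 'g word \<Rightarrow> 'm)) \<times> (nat \<Rightarrow> 'm \<Rightarrow> 'g word \<Rightarrow> 'g)"

definition wlp_modules ::
    "('k::field_char_0, 'g::ab_group_add) dgla \<Rightarrow> ('k, 'g, 'm::ab_group_add) wlp set"
  where "wlp_modules g = {(A, f). inf_morphism g A (under g, adj_diff g) f}"

text \<open>Isomorphisms are invertible \<open>\<infinity>\<close>-morphisms commuting with the structure maps to \<open>g\<close>; composition of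
  \<open>\<infinity>\<close>-morphisms is composition of the \<open>C(g)\<close>-linear extensions.\<close>

definition wlp_iso ::
    "('k::field_char_0, 'g::ab_group_add) dgla \<Rightarrow> ('k, 'g, 'm::ab_group_add) wlp \<Rightarrow>
      ('k, 'g, 'n::ab_group_add) wlp \<Rightarrow> bool"
  where "wlp_iso g = (\<lambda>((M, \<delta>), f) ((N, \<epsilon>), f').
    \<exists>h h'. inf_morphism g (M, \<delta>) (N, \<epsilon>) h \<and> inf_morphism g (N, \<epsilon>) (M, \<delta>) h' \<and>
      (\<forall>\<tau>\<in>coch g M. inf_ext M h' (inf_ext N h \<tau>) = \<tau>) \<and>
      (\<forall>\<tau>\<in>coch g N. inf_ext N h (inf_ext M h' \<tau>) = \<tau>) \<and>
      (\<forall>\<tau>\<in>coch g M. inf_ext (under g) f' (inf_ext N h \<tau>) = inf_ext (under g) f \<tau>))"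


section \<open>dg vector bundles over \<open>Bg\<close>\<close>

text \<open>A dg vector bundle over \<open>Bg\<close> is given by its dg \<open>C(g)\<close>-module of sections, which is finitely
  generated and free as a graded module. The \<open>'k\<close>-linear structure is the action of
  \<open>C\<^sup>0(g)\<close>, the multiples of \<open>cunit\<close>.\<close>

record ('k, 'g, 'e) dgvb =
  hsec :: "int \<Rightarrow> 'e set"
  bact :: "('g word \<Rightarrow> 'k) \<Rightarrow> 'e \<Rightarrow> 'e"
  bdiff :: "'e \<Rightarrow> 'e"

abbreviation sections :: "('k, 'g, 'e::ab_group_add) dgvb \<Rightarrow> 'e set"
  where "sections E \<equiv> dsum (hsec E)"

definition graded_module ::
    "('k::field_char_0, 'g::ab_group_add) dgla \<Rightarrow> ('k, 'g, 'e::ab_group_add) dgvb \<Rightarrow> bool"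
  where "graded_module g E \<longleftrightarrow>
    (\<forall>q. 0 \<in> hsec E q \<and> (\<forall>x\<in>hsec E q. \<forall>y\<in>hsec E q. x + y \<in> hsec E q \<and> - x \<in> hsec E q)) \<and>
    direct (hsec E) \<and>
    (\<forall>p q. \<forall>a\<in>coch_deg g ground p. \<forall>x\<in>hsec E q. bact E a x \<in> hsec E (p + q)) \<and>
    (\<forall>a\<in>coch g ground. \<forall>b\<in>coch g ground. \<forall>x\<in>sections E. \<forall>y\<in>sections E.
      bact E (a + b) x = bact E a x + bact E b x \<and>
      bact E a (x + y) = bact E a x + bact E a y \<and>
      bact E (cprod ground a b) x = bact E a (bact E b x)) \<and>
    (\<forall>x\<in>sections E. bact E cunit x = x)"

definition fg_free ::
    "('k::field_char_0, 'g::ab_group_add) dgla \<Rightarrow> ('k, 'g, 'e::ab_group_add) dgvb \<Rightarrow> bool"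
  where "fg_free g E \<longleftrightarrow>
    (\<exists>(n::nat) e. (\<forall>i<n. \<exists>q. e i \<in> hsec E q) \<and>
      (\<forall>x\<in>sections E. \<exists>!c. c \<in> {..<n} \<rightarrow>\<^sub>E coch g ground \<and> x = (\<Sum>i<n. bact E (c i) (e i))))"

definition dg_bundle ::
    "('k::field_char_0, 'g::ab_group_add) dgla \<Rightarrow> ('k, 'g, 'e::ab_group_add) dgvb \<Rightarrow> bool"
  where "dg_bundle g E \<longleftrightarrow>
    graded_module g E \<and> fg_free g E \<and>
    bdiff E \<in> extensional (sections E) \<and>
    (\<forall>q. \<forall>x\<in>hsec E q. bdiff E x \<in> hsec E (q + 1)) \<and>
    (\<forall>x\<in>sections E. \<forall>y\<in>sections E. bdiff E (x + y) = bdiff E x + bdiff E y) \<and>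
    (\<forall>p. \<forall>a\<in>coch_deg g ground p. \<forall>x\<in>sections E.
      bdiff E (bact E a x) =
        bact E (dCE g ground a) x + bact E (\<lambda>w. ksgn p * a w) (bdiff E x)) \<and>
    (\<forall>x\<in>sections E. bdiff E (bdiff E x) = 0)"

definition bundle_morphism ::
    "('k::field_char_0, 'g::ab_group_add) dgla \<Rightarrow> ('k, 'g, 'e::ab_group_add) dgvb \<Rightarrow>
      ('k, 'g, 'f::ab_group_add) dgvb \<Rightarrow> ('e \<Rightarrow> 'f) \<Rightarrow> bool"
  where "bundle_morphism g E E' F \<longleftrightarrow>
    dg_bundle g E \<and> dg_bundle g E' \<and>
    F \<in> extensional (sections E) \<and>
    (\<forall>q. \<forall>x\<in>hsec E q. F x \<in> hsec E' q) \<and>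
    (\<forall>x\<in>sections E. \<forall>y\<in>sections E. F (x + y) = F x + F y) \<and>
    (\<forall>a\<in>coch g ground. \<forall>x\<in>sections E. F (bact E a x) = bact E' a (F x)) \<and>
    (\<forall>x\<in>sections E. F (bdiff E x) = bdiff E' (F x))"

text \<open>The graded bundle with sections \<open>C(g) \<otimes> M\<close>, with a differential \<open>D\<close>.\<close>

definition cbundle ::
    "('k::field_char_0, 'g::ab_group_add) dgla \<Rightarrow> ('k, 'm::ab_group_add) gvect \<Rightarrow>
      (('g word \<Rightarrow> 'm) \<Rightarrow> 'g word \<Rightarrow> 'm) \<Rightarrow> ('k, 'g, 'g word \<Rightarrow> 'm) dgvb"
  where "cbundle g M D = \<lparr>hsec = coch_deg g M, bact = cprod M, bdiff = D\<rparr>"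

definition tot_bundle ::
    "('k::field_char_0, 'g::ab_group_add) dgla \<Rightarrow>
      ('k, 'm::ab_group_add) gvect \<times> (nat \<Rightarrow> 'm \<Rightarrow> 'g word \<Rightarrow> 'm) \<Rightarrow> ('k, 'g, 'g word \<Rightarrow> 'm) dgvb"
  where "tot_bundle g = (\<lambda>(M, \<delta>). cbundle g M (restrict (dtot g M \<delta>) (coch g M)))"

text \<open>\<open>T\<^bsub>[-1]\<^esub>Bg\<close>, whose sections are \<open>(C(g, g), d\<^sub>t\<^sub>o\<^sub>t)\<close> for the adjoint module.\<close>

definition shifted_tangent ::
    "('k::field_char_0, 'g::ab_group_add) dgla \<Rightarrow> ('k, 'g, 'g word \<Rightarrow> 'g) dgvb"
  where "shifted_tangent g = tot_bundle g (under g, adj_diff g)"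

definition morphisms_to_tangent ::
    "('k::field_char_0, 'g::ab_group_add) dgla \<Rightarrow>
      (('k, 'g, 'e::ab_group_add) dgvb \<times> ('e \<Rightarrow> 'g word \<Rightarrow> 'g)) set"
  where "morphisms_to_tangent g = {(E, F). bundle_morphism g E (shifted_tangent g) F}"

definition bundle_iso_over ::
    "('k::field_char_0, 'g::ab_group_add) dgla \<Rightarrow>
      ('k, 'g, 'e::ab_group_add) dgvb \<times> ('e \<Rightarrow> 'g word \<Rightarrow> 'g) \<Rightarrow>
      ('k, 'g, 'f::ab_group_add) dgvb \<times> ('f \<Rightarrow> 'g word \<Rightarrow> 'g) \<Rightarrow> bool"
  where "bundle_iso_over g = (\<lambda>(E, F) (E', F').
    \<exists>\<Phi> \<Psi>. bundle_morphism g E E' \<Phi> \<and> bundle_morphism g E' E \<Psi> \<and>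
      (\<forall>x\<in>sections E. \<Psi> (\<Phi> x) = x) \<and> (\<forall>y\<in>sections E'. \<Phi> (\<Psi> y) = y) \<and>
      (\<forall>x\<in>sections E. F' (\<Phi> x) = F x))"

definition associated ::
    "('k::field_char_0, 'g::ab_group_add) dgla \<Rightarrow> ('k, 'g, 'm::ab_group_add) wlp \<Rightarrow>
      ('k, 'g, 'g word \<Rightarrow> 'm) dgvb \<times> (('g word \<Rightarrow> 'm) \<Rightarrow> 'g word \<Rightarrow> 'g)"
  where "associated g = (\<lambda>(A, f).
    (tot_bundle g A, restrict (inf_ext (under g) f) (coch g (fst A))))"

end

theory Submission
  imports Defs
begin

text \<open>
  A \<open>C(g)\<close>-linear map out of \<open>C(g, M) = C(g) \<otimes> M\<close> is determined by its restriction to the generators \<open>M\<close>,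
  and that restriction, split by the number of arguments of the forms, is a locally finite family
  \<open>M \<rightarrow> C\<^sup>k(g, N)\<close>; this turns bundle morphisms into \<open>\<infinity>\<close>-morphisms. A differential on the graded module
  \<open>C(g, M)\<close> is not linear, but it satisfies the same Leibniz rule as \<open>d\<^sub>C\<^sub>E \<otimes> id\<close>, so their difference is
  linear of degree 1, and this turns dg structures into \<open>\<infinity>\<close>-module structures. Finally, a homogeneous basis
  of the sections of a dg bundle identifies it with some \<open>C(g, k\<^sup>n)\<close>, to which the differential is transported.
\<close>


text \<open>The laws of \<open>C(g, M)\<close> that carry signs (associativity of the product,
  linearity of \<open>cext\<close>, symmetry of the results) are reduced to identities of sums over
  the unshuffles of a word, proved by induction on the word. Signs act there through
  \<open>ksig\<close>, which makes sense in any abelian group and so commutes with every additive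
  map. Generators suffice because a homogeneous basis of \<open>M\<close> gives finitely many
  coefficient forms, and each form has finitely many degrees: it vanishes on long words and on words
  with a zero letter, and nonzero letters have finitely many degrees. Homogeneous coefficients
  matter since the Leibniz rule refers to their degree. Underlying spaces are subsets of types, so
  maps are made canonical by \<open>restrict\<close>. Structures can then be equal and not merely
  isomorphic, which gives a true bijection once \<open>M\<close> is fixed. An abstract bundle is
  only isomorphic to some \<open>C(g, M)\<close>, so across different \<open>M\<close> the
  correspondence is one of isomorphism classes. That the adjoint module squares to zero is contained
  in \<open>inf_morphism\<close> and, through \<open>dg_bundle\<close>, in
  \<open>bundle_morphism\<close>; it is carried from one to the other.\<close>

section \<open>Sums over shuffles\<close>

definition add_subgroup :: "'a::ab_group_add set \<Rightarrow> bool"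
  where "add_subgroup A \<longleftrightarrow> 0 \<in> A \<and> (\<forall>x\<in>A. \<forall>y\<in>A. x + y \<in> A \<and> - x \<in> A)"

lemma add_subgroup_UNIV: "add_subgroup UNIV"
  by (simp add: add_subgroup_def)

lemma ksig_in: "add_subgroup A \<Longrightarrow> x \<in> A \<Longrightarrow> ksig n x \<in> A"
  by (simp add: add_subgroup_def ksig_def)

lemma sum_in: "add_subgroup A \<Longrightarrow> (\<And>i. i \<in> I \<Longrightarrow> f i \<in> A) \<Longrightarrow> sum f I \<in> A"
  by (induction I rule: infinite_finite_induct) (simp_all add: add_subgroup_def)

lemma sum_list_in: "add_subgroup A \<Longrightarrow> (\<And>i. i \<in> set xs \<Longrightarrow> f i \<in> A) \<Longrightarrow> (\<Sum>i\<leftarrow>xs. f i) \<in> A"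
  by (induction xs) (simp_all add: add_subgroup_def)

text \<open>Linear maps are controlled only on the underlying space of their source; elsewhere they
  are arbitrary, or \<open>undefined\<close> when restricted, so additivity has to be relative to a
  subgroup.\<close>

definition additive_on :: "'a::ab_group_add set \<Rightarrow> ('a \<Rightarrow> 'b::ab_group_add) \<Rightarrow> bool"
  where "additive_on A f \<longleftrightarrow> (\<forall>x\<in>A. \<forall>y\<in>A. f (x + y) = f x + f y)"

lemma additive_on_zero: "add_subgroup A \<Longrightarrow> additive_on A f \<Longrightarrow> f 0 = 0"
  unfolding additive_on_def add_subgroup_def by (metis add_cancel_right_right)

lemma additive_on_minus: "add_subgroup A \<Longrightarrow> additive_on A f \<Longrightarrow> x \<in> A \<Longrightarrow> f (- x) = - f x"
  using additive_on_zero[of A f] unfolding additive_on_def add_subgroup_def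
  by (metis add_eq_0_iff add.right_inverse)

lemma additive_on_ksig: "add_subgroup A \<Longrightarrow> additive_on A f \<Longrightarrow> x \<in> A \<Longrightarrow> f (ksig n x) = ksig n (f x)"
  by (simp add: ksig_def additive_on_minus)

lemma additive_on_sum:
  "add_subgroup A \<Longrightarrow> additive_on A f \<Longrightarrow> (\<And>i. i \<in> I \<Longrightarrow> h i \<in> A) \<Longrightarrow> f (sum h I) = (\<Sum>i\<in>I. f (h i))"
proof (induction I rule: infinite_finite_induct)
  case (insert i I)
  then show ?case using sum_in[of A I h] by (simp add: additive_on_def)
qed (simp_all add: additive_on_zero)

lemma additive_on_sum_list:
  "add_subgroup A \<Longrightarrow> additive_on A f \<Longrightarrow> (\<And>i. i \<in> set xs \<Longrightarrow> h i \<in> A) \<Longrightarrow>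
    f (\<Sum>i\<leftarrow>xs. h i) = (\<Sum>i\<leftarrow>xs. f (h i))"
proof (induction xs)
  case (Cons x xs)
  then show ?case using sum_list_in[of A xs h] by (simp add: additive_on_def)
qed (simp add: additive_on_zero)

text \<open>The premise records the degree and the letters of a split because these decide in which
  homogeneous component a summand lies and whether its parts are homogeneous words.\<close>

lemma unsh_sum_in:
  assumes "add_subgroup A"
    and "\<And>u v. wdeg u + wdeg v = wdeg w \<Longrightarrow> set u \<union> set v = set w \<Longrightarrow> G u v \<in> A"
  shows "unsh_sum G w \<in> A"
  unfolding unsh_sum_def
  by (intro sum_list_in assms(1)) (auto intro!: ksig_in assms dest: unshuffles_hd)

lemma unsh_sum_hom_on:
  assumes "add_subgroup A" "additive_on A f"
    and "\<And>u v. wdeg u + wdeg v = wdeg w \<Longrightarrow> set u \<union> set v = set w \<Longrightarrow> G u v \<in> A"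
  shows "f (unsh_sum G w) = unsh_sum (\<lambda>u v. f (G u v)) w"
proof -
  have *: "(\<lambda>(s, u, v). ksig s (G u v)) i \<in> A" and
    "f ((\<lambda>(s, u, v). ksig s (G u v)) i) = (\<lambda>(s, u, v). ksig s (f (G u v))) i"
    if "i \<in> set (unshuffles w)" for i
    using that assms
    by (auto intro!: ksig_in assms(3) additive_on_ksig[OF assms(1,2)] dest: unshuffles_hd split: prod.splits)
  then show ?thesis
    unfolding unsh_sum_def
    by (subst additive_on_sum_list[OF assms(1,2)])
      (auto intro!: arg_cong[of _ _ sum_list] map_cong)
qed

lemma unsh_sum_hom:
  assumes "\<And>a b. f (a + b) = f a + f b"
  shows "unsh_sum (\<lambda>u v. f (G u v)) w = f (unsh_sum G w)"
  by (rule unsh_sum_hom_on[OF add_subgroup_UNIV, symmetric]) (simp_all add: additive_on_def assms)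

lemma ad_sum_hom:
  assumes "\<And>a b. f (a + b) = f a + f b"
  shows "ad_sum g x (\<lambda>u. f (G u)) w = f (ad_sum g x G w)"
proof -
  have f: "additive_on UNIV f" by (simp add: additive_on_def assms)
  show ?thesis
    unfolding ad_sum_def additive_on_sum_list[OF add_subgroup_UNIV f UNIV_I]
    by (simp add: case_prod_unfold additive_on_ksig[OF add_subgroup_UNIV f UNIV_I])
qed

lemma codiff_sum_hom:
  assumes "\<And>a b. f (a + b) = f a + f b"
  shows "codiff_sum g (\<lambda>u. f (G u)) w = f (codiff_sum g G w)"
proof -
  have f: "additive_on UNIV f" by (simp add: additive_on_def assms)
  show ?thesis
    unfolding codiff_sum_def additive_on_sum_list[OF add_subgroup_UNIV f UNIV_I]
    by (simp add: case_prod_unfold additive_on_ksig[OF add_subgroup_UNIV f UNIV_I])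
qed

lemma unsh_sum_zero:
  assumes "\<And>u v. wdeg u + wdeg v = wdeg w \<Longrightarrow> set u \<union> set v = set w \<Longrightarrow> G u v = 0"
  shows "unsh_sum G w = 0"
  using unsh_sum_in[of "{0}" w G] assms by (simp add: add_subgroup_def)

text \<open>Evaluates extensions and products at cochains supported on the empty word. The surviving
  split has sign 0, since a letter sent to the right only passes the empty left part.\<close>

lemma unsh_sum_left_Nil:
  "(\<And>u v. u \<noteq> [] \<Longrightarrow> G u v = 0) \<Longrightarrow> unsh_sum G w = G [] w"
proof (induction w arbitrary: G)
  case (Cons x w)
  have "unsh_sum (\<lambda>u v. G (x # u) v) w = 0"
    by (rule unsh_sum_zero) (simp add: Cons.prems)
  moreover have "unsh_sum (\<lambda>u v. ksig (sdeg x * wdeg u) (G u (x # v))) w = G [] (x # w)"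
    by (subst Cons.IH) (simp_all add: Cons.prems ksig_def wdeg_def)
  ultimately show ?case by (simp add: unsh_sum_Cons)
qed (simp add: unsh_sum_Nil)

lemma unsh_sum_right_Nil:
  "(\<And>u v. v \<noteq> [] \<Longrightarrow> G u v = 0) \<Longrightarrow> unsh_sum G w = G w []"
proof (induction w arbitrary: G)
  case (Cons x w)
  have "unsh_sum (\<lambda>u v. ksig (sdeg x * wdeg u) (G u (x # v))) w = 0"
    by (rule unsh_sum_zero) (simp add: Cons.prems ksig_0)
  then show ?case using Cons.IH[of "\<lambda>u. G (x # u)"] Cons.prems by (simp add: unsh_sum_Cons)
qed (simp add: unsh_sum_Nil)

text \<open>Both sides run over the ordered divisions of \<open>w\<close> into three complementary
  subwords. This is coassociativity of the symmetric coalgebra on \<open>g[1]\<close>;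
  \<open>cprod_assoc\<close> and \<open>cext_cprod\<close> are reduced to it.\<close>

lemma unsh_sum_coassoc:
  "unsh_sum (\<lambda>u v. unsh_sum (\<lambda>p q. K p q v) u) w = unsh_sum (\<lambda>p r. unsh_sum (\<lambda>q v. K p q v) r) w"
proof (induction w arbitrary: K)
  case (Cons x w)
  \<comment> \<open>A letter that goes to the last part passes all of \<open>u\<close>; by
    additivity of the degree its sign is the product of the signs for passing the two parts of
    \<open>u\<close> separately.\<close>
  have sgn: "unsh_sum (\<lambda>u v. ksig (sdeg x * wdeg u) (unsh_sum (\<lambda>p q. K p q (x # v)) u)) w =
    unsh_sum (\<lambda>u v. unsh_sum (\<lambda>p q. ksig (sdeg x * wdeg p + sdeg x * wdeg q) (K p q (x # v))) u) w"
    unfolding unsh_sum_K[symmetric]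
    by (intro unsh_sum_cong) (simp flip: distrib_left)
  show ?case
    unfolding unsh_sum_Cons unsh_sum_add sgn Cons.IH
    by (simp add: ksig_add unsh_sum_add ksig_K flip: unsh_sum_K)
qed (simp add: unsh_sum_Nil)

section \<open>Homogeneity and length of words under unshuffling and the codifferential\<close>

lemma hword_Nil: "hword g []" and hword_Cons: "hword g (x # w) \<longleftrightarrow> snd x \<in> hc g (fst x) \<and> hword g w"
  and hword_append: "hword g (u @ v) \<longleftrightarrow> hword g u \<and> hword g v"
  by (auto simp: hword_def)

lemmas hword_simps = hword_Nil hword_Cons hword_append

lemma hword_Un: "set u \<union> set v = set w \<Longrightarrow> hword g w \<longleftrightarrow> hword g u \<and> hword g v"
  unfolding hword_def by blast

lemma wdeg_append: "wdeg (u @ v) = wdeg u + wdeg v"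
  by (simp add: wdeg_def)

lemma length_unshuffles: "(s, u, v) \<in> set (unshuffles w) \<Longrightarrow> length u + length v = length w"
  by (induction w arbitrary: s u v) fastforce+

lemma length_ad_word: "(s, v) \<in> set (ad_word g x w) \<Longrightarrow> length v = length w \<and> v \<noteq> []"
  by (induction w arbitrary: s v) fastforce+

lemma length_codiff: "(s, v) \<in> set (codiff g w) \<Longrightarrow> length w \<le> Suc (length v) \<and> v \<noteq> []"
  by (induction w arbitrary: s v) (fastforce dest: length_ad_word)+


section \<open>Slotwise linear and graded symmetric functions on words\<close>

text \<open>One equation for a linear combination, so that each induction has a single statement to
  push through; only homogeneous words occur, because the structure maps of \<open>g\<close> are
  controlled only there.\<close>

definition slot_linear ::
    "('k::field, 'g::ab_group_add, 'z) gvect_scheme \<Rightarrow> ('k \<Rightarrow> 'a::ab_group_add \<Rightarrow> 'a) \<Rightarrow> ('g word \<Rightarrow> 'a) \<Rightarrow> bool"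
  where "slot_linear g s H \<longleftrightarrow>
    (\<forall>u v i c. \<forall>x\<in>hc g i. \<forall>y\<in>hc g i. hword g u \<longrightarrow> hword g v \<longrightarrow>
      H (u @ (i, scl g c x + y) # v) = s c (H (u @ (i, x) # v)) + H (u @ (i, y) # v))"

text \<open>Unlike \<open>graded_symmetric\<close>, this speaks only of homogeneous words, and the
  sign does not involve the scalars.\<close>

definition swap_symmetric ::
    "('k::field, 'g::ab_group_add, 'z) gvect_scheme \<Rightarrow> ('g word \<Rightarrow> 'a::ab_group_add) \<Rightarrow> bool"
  where "swap_symmetric g H \<longleftrightarrow>
    (\<forall>u v x y. hword g (u @ x # y # v) \<longrightarrow> H (u @ x # y # v) = ksig (sdeg x * sdeg y) (H (u @ y # x # v)))"

lemma slot_linearD: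
  assumes "slot_linear g s H" "x \<in> hc g i" "y \<in> hc g i" "hword g u" "hword g v"
  shows "H (u @ (i, scl g c x + y) # v) = s c (H (u @ (i, x) # v)) + H (u @ (i, y) # v)"
  using assms unfolding slot_linear_def by blast

lemma slot_linear_hd:
  assumes "slot_linear g s H" "x \<in> hc g i" "y \<in> hc g i" "hword g v"
  shows "H ((i, scl g c x + y) # v) = s c (H ((i, x) # v)) + H ((i, y) # v)"
  using slot_linearD[OF assms(1-3) hword_Nil assms(4)] by simp

lemma slot_linear_Cons:
  "slot_linear g s H \<Longrightarrow> snd x \<in> hc g (fst x) \<Longrightarrow> slot_linear g s (\<lambda>v. H (x # v))"
  unfolding slot_linear_def by (metis append_Cons hword_Cons)

lemma swap_symmetricD:
  "swap_symmetric g H \<Longrightarrow> hword g (u @ x # y # v) \<Longrightarrow>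
    H (u @ x # y # v) = ksig (sdeg x * sdeg y) (H (u @ y # x # v))"
  unfolding swap_symmetric_def by blast

lemma swap_symmetric_hd:
  "swap_symmetric g H \<Longrightarrow> hword g (x # y # v) \<Longrightarrow> H (x # y # v) = ksig (sdeg x * sdeg y) (H (y # x # v))"
  using swap_symmetricD[of g H "[]" x y v] by simp

lemma swap_symmetric_Cons:
  "swap_symmetric g H \<Longrightarrow> snd x \<in> hc g (fst x) \<Longrightarrow> swap_symmetric g (\<lambda>v. H (x # v))"
  unfolding swap_symmetric_def by (metis append_Cons hword_Cons)

section \<open>Closure properties of homogeneous components\<close>

lemma fd_graded_dest:
  assumes "fd_graded V"
  shows fd_graded_vs: "vector_space (scl V)"
    and fd_graded_subspace: "module.subspace (scl V) (hc V i)"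
    and fd_graded_direct: "direct (hc V)"
  using assms by (auto simp: fd_graded_def)

lemma fd_graded_closed:
  assumes "fd_graded V"
  shows hc_zero: "0 \<in> hc V i"
    and hc_add: "x \<in> hc V i \<Longrightarrow> y \<in> hc V i \<Longrightarrow> x + y \<in> hc V i"
    and hc_scl: "x \<in> hc V i \<Longrightarrow> scl V c x \<in> hc V i"
    and hc_minus: "x \<in> hc V i \<Longrightarrow> - x \<in> hc V i"
proof -
  interpret vector_space "scl V" using assms by (rule fd_graded_vs)
  show "0 \<in> hc V i" "x \<in> hc V i \<Longrightarrow> y \<in> hc V i \<Longrightarrow> x + y \<in> hc V i"
    "x \<in> hc V i \<Longrightarrow> scl V c x \<in> hc V i" "x \<in> hc V i \<Longrightarrow> - x \<in> hc V i"
    using fd_graded_subspace[OF assms, of i] by (auto simp: subspace_0 subspace_add subspace_scale subspace_neg)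
qed

lemma scl_ksig:
  assumes "vector_space s"
  shows "s (ksig n c) x = ksig n (s c x)" "s c (ksig n x) = ksig n (s c x)"
proof -
  interpret vector_space s by fact
  show "s (ksig n c) x = ksig n (s c x)" "s c (ksig n x) = ksig n (s c x)"
    by (simp_all add: ksig_def)
qed

lemma slot_linear_iff:
  fixes g :: "('k::field, 'g::ab_group_add, 'z) gvect_scheme"
  assumes g: "fd_graded g" and s: "vector_space s"
  shows "slot_linear g s H \<longleftrightarrow> (\<forall>u v i. \<forall>x\<in>hc g i. \<forall>y\<in>hc g i. \<forall>c. hword g u \<and> hword g v \<longrightarrow>
      H (u @ (i, x + y) # v) = H (u @ (i, x) # v) + H (u @ (i, y) # v) \<and>
      H (u @ (i, scl g c x) # v) = s c (H (u @ (i, x) # v)))" (is "_ \<longleftrightarrow> ?R")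
proof
  interpret G: vector_space "scl g" using g by (rule fd_graded_vs)
  interpret S: vector_space s by fact
  assume H: "slot_linear g s H"
  show ?R
  proof (intro allI ballI impI)
    fix u v i x y c
    assume x: "x \<in> hc g i" and y: "y \<in> hc g i" and uv: "hword g u \<and> hword g v"
    have add: "H (u @ (i, x + y) # v) = H (u @ (i, x) # v) + H (u @ (i, y) # v)"
      if "x \<in> hc g i" "y \<in> hc g i" for x y
      using slot_linearD[OF H, of x i y u v 1] that uv by simp
    \<comment> \<open>Additivity at \<open>0 + 0\<close>. This removes the second summand when the
      combined law is applied to \<open>scl g c x + 0\<close>.\<close>
    have "H (u @ (i, 0) # v) = 0"
      using add[of 0 0] hc_zero[OF g] by simp
    then show "H (u @ (i, x + y) # v) = H (u @ (i, x) # v) + H (u @ (i, y) # v) \<and>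
      H (u @ (i, scl g c x) # v) = s c (H (u @ (i, x) # v))"
      using slot_linearD[OF H x hc_zero[OF g], of u v c] uv add x y by simp
  qed
next
  assume ?R
  then show "slot_linear g s H"
    unfolding slot_linear_def using hc_scl[OF g] by metis
qed

context
  fixes g :: "('k::field, 'g::ab_group_add, 'z) gvect_scheme" and s :: "'k \<Rightarrow> 'a::ab_group_add \<Rightarrow> 'a"
  assumes g: "fd_graded g" and s: "vector_space s"
begin

lemma slot_linear_props:
  assumes H: "slot_linear g s H" and uv: "hword g u" "hword g v" and x: "x \<in> hc g i"
  shows "H (u @ (i, 0) # v) = 0" "H (u @ (i, scl g c x) # v) = s c (H (u @ (i, x) # v))"
    "H (u @ (i, - x) # v) = - H (u @ (i, x) # v)"
proof -
  interpret G: vector_space "scl g" using g by (rule fd_graded_vs)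
  interpret S: vector_space s by (rule s)
  have *: "H (u @ (i, scl g c x) # v) = s c (H (u @ (i, x) # v))" for c
    using H x uv unfolding slot_linear_iff[OF g s] by blast
  show "H (u @ (i, scl g c x) # v) = s c (H (u @ (i, x) # v))" by (rule *)
  show "H (u @ (i, 0) # v) = 0" using *[of 0] by simp
  show "H (u @ (i, - x) # v) = - H (u @ (i, x) # v)" using *[of "- 1"] by simp
qed

lemma slot_linear_ksig_hd:
  assumes "slot_linear g s H" "x \<in> hc g i" "hword g v"
  shows "H ((i, ksig n x) # v) = ksig n (H ((i, x) # v))"
  using slot_linear_props(3)[OF assms(1) hword_Nil assms(3,2)] by (simp add: ksig_def)

text \<open>The three words of a linearity equation differ in letters of equal degree only, so a
  sign depending on the total degree is the same in all three terms.\<close>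

lemma slot_linear_ksig:
  assumes "slot_linear g s H"
  shows "slot_linear g s (\<lambda>u. ksig (f (wdeg u)) (H u))"
proof -
  interpret S: vector_space s by (rule s)
  show ?thesis
    using assms by (auto simp: slot_linear_def wdeg_append wdeg_simps ksig_add scl_ksig[OF s])
qed

text \<open>The slot lands in the left or in the right part, and linearity of \<open>G\<close> in
  that part applies. \<open>G\<close> is generalised in the induction because peeling a letter off
  the prefix fixes that letter in one argument of \<open>G\<close>.\<close>

lemma slot_linear_unsh_sum:
  assumes "\<And>v. hword g v \<Longrightarrow> slot_linear g s (\<lambda>u. G u v)" and "\<And>u. hword g u \<Longrightarrow> slot_linear g s (G u)"
  shows "slot_linear g s (unsh_sum G)"
proof -
  interpret S: vector_space s by (rule s)
  have "unsh_sum G (u @ (i, scl g c x + y) # v) = s c (unsh_sum G (u @ (i, x) # v)) + unsh_sum G (u @ (i, y) # v)"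
    if "hword g u" "hword g v" "x \<in> hc g i" "y \<in> hc g i" for u v i x y c
    using that(1) assms
  proof (induction u arbitrary: G)
    case Nil
    have 1: "unsh_sum (\<lambda>a b. G ((i, scl g c x + y) # a) b) v =
        unsh_sum (\<lambda>a b. s c (G ((i, x) # a) b) + G ((i, y) # a) b) v"
      by (intro unsh_sum_cong slot_linear_hd[OF Nil(2)]) (use that hword_Un in blast)+
    have 2: "unsh_sum (\<lambda>a b. ksig ((i - 1) * wdeg a) (G a ((i, scl g c x + y) # b))) v =
        unsh_sum (\<lambda>a b. s c (ksig ((i - 1) * wdeg a) (G a ((i, x) # b))) + ksig ((i - 1) * wdeg a) (G a ((i, y) # b))) v"
      by (intro unsh_sum_cong) (use that hword_Un in \<open>metis slot_linear_hd[OF Nil(3)] ksig_add scl_ksig(2)[OF s]\<close>)+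
    show ?case
      by (simp add: unsh_sum_Cons wdeg_simps 1 2 unsh_sum_add unsh_sum_hom[where f = "s c", OF S.scale_right_distrib]
          S.scale_right_distrib)
  next
    case (Cons z u)
    have z: "snd z \<in> hc g (fst z)" "hword g u" using Cons.prems(1) by (auto simp: hword_Cons)
    have 1: "unsh_sum (\<lambda>a b. G (z # a) b) (u @ (i, scl g c x + y) # v) =
      s c (unsh_sum (\<lambda>a b. G (z # a) b) (u @ (i, x) # v)) + unsh_sum (\<lambda>a b. G (z # a) b) (u @ (i, y) # v)"
      by (rule Cons.IH) (auto intro: slot_linear_Cons[OF Cons.prems(2)] Cons.prems(3) simp: z hword_Cons)
    have 2: "unsh_sum (\<lambda>a b. ksig (sdeg z * wdeg a) (G a (z # b))) (u @ (i, scl g c x + y) # v) =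
      s c (unsh_sum (\<lambda>a b. ksig (sdeg z * wdeg a) (G a (z # b))) (u @ (i, x) # v)) +
      unsh_sum (\<lambda>a b. ksig (sdeg z * wdeg a) (G a (z # b))) (u @ (i, y) # v)"
    proof (rule Cons.IH[OF z(2)])
      show "slot_linear g s (\<lambda>u. ksig (sdeg z * wdeg u) (G u (z # v)))" if "hword g v" for v
        by (rule slot_linear_ksig[of "\<lambda>u. G u (z # v)" "\<lambda>n. sdeg z * n"]) (simp add: Cons.prems(2) z that hword_Cons)
      show "slot_linear g s (\<lambda>v. ksig (sdeg z * wdeg u) (G u (z # v)))" if "hword g u" for u
        by (rule slot_linear_ksig[of "\<lambda>v. G u (z # v)" "\<lambda>_. sdeg z * wdeg u"]) (simp add: Cons.prems(3) z that slot_linear_Cons)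
    qed
    show ?case by (simp add: unsh_sum_Cons 1 2 S.scale_right_distrib)
  qed
  then show ?thesis by (simp add: slot_linear_def)
qed

end

lemma swap_symmetric_ksig:
  assumes "swap_symmetric g H"
  shows "swap_symmetric g (\<lambda>u. ksig (f (wdeg u)) (H u))"
  using assms unfolding swap_symmetric_def
  by (simp add: wdeg_append wdeg_simps ksig_K add_ac)

text \<open>If both letters go to the same part, the symmetry of \<open>G\<close> in that part
  applies; if they are separated, the sign is produced by the unshuffle itself.\<close>

lemma swap_symmetric_unsh_sum:
  assumes "\<And>v. hword g v \<Longrightarrow> swap_symmetric g (\<lambda>u. G u v)" and "\<And>u. hword g u \<Longrightarrow> swap_symmetric g (G u)"
  shows "swap_symmetric g (unsh_sum G)"
proof -
  have "unsh_sum G (u @ x # y # v) = ksig (sdeg x * sdeg y) (unsh_sum G (u @ y # x # v))"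
    if "hword g (u @ x # y # v)" for u v x y
    using that assms
  proof (induction u arbitrary: G)
    case Nil
    have xy: "snd x \<in> hc g (fst x)" "snd y \<in> hc g (fst y)" "hword g v" using Nil by (auto simp: hword_simps)
    have 1: "unsh_sum (\<lambda>a b. G (x # y # a) b) v = unsh_sum (\<lambda>a b. ksig (sdeg x * sdeg y) (G (y # x # a) b)) v"
      by (intro unsh_sum_cong) (use xy hword_Un in \<open>metis swap_symmetric_hd[OF Nil(2)] hword_Cons\<close>)
    have 2: "unsh_sum (\<lambda>a b. ksig (sdeg y * wdeg a) (ksig (sdeg x * wdeg a) (G a (x # y # b)))) v =
      unsh_sum (\<lambda>a b. ksig (sdeg x * sdeg y) (ksig (sdeg x * wdeg a) (ksig (sdeg y * wdeg a) (G a (y # x # b))))) v"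
    proof (intro unsh_sum_cong)
      fix a b assume "set a \<union> set b = set v"
      then have "hword g a" "hword g b" using xy hword_Un by blast+
      then have "G a (x # y # b) = ksig (sdeg x * sdeg y) (G a (y # x # b))"
        using xy by (intro swap_symmetric_hd[OF Nil(3)]) (simp_all add: hword_Cons)
      then show "ksig (sdeg y * wdeg a) (ksig (sdeg x * wdeg a) (G a (x # y # b))) =
        ksig (sdeg x * sdeg y) (ksig (sdeg x * wdeg a) (ksig (sdeg y * wdeg a) (G a (y # x # b))))"
        by (simp add: ksig_K add_ac)
    qed
    \<comment> \<open>The letters are separated: the summand is unchanged by the swap, and only one
      of the two orders makes \<open>x\<close> pass \<open>y\<close>.\<close>
    have 3: "unsh_sum (\<lambda>a b. ksig (sdeg x * wdeg (y # a)) (G (y # a) (x # b))) v =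
      unsh_sum (\<lambda>a b. ksig (sdeg x * sdeg y) (ksig (sdeg x * wdeg a) (G (y # a) (x # b)))) v"
      by (simp add: ksig_K wdeg_simps distrib_left)
    have 4: "unsh_sum (\<lambda>a b. ksig (sdeg y * wdeg a) (G (x # a) (y # b))) v =
      unsh_sum (\<lambda>a b. ksig (sdeg x * sdeg y) (ksig (sdeg y * wdeg (x # a)) (G (x # a) (y # b)))) v"
      by (intro unsh_sum_cong) (auto simp: ksig_K wdeg_simps algebra_simps intro: ksig_parity)
    show ?case
      by (simp add: unsh_sum_Cons 1 2 3 4 unsh_sum_K ksig_add add_ac)
  next
    case (Cons z u)
    have z: "snd z \<in> hc g (fst z)" "hword g (u @ x # y # v)" using Cons.prems(1) by (auto simp: hword_Cons)
    have 1: "unsh_sum (\<lambda>a b. G (z # a) b) (u @ x # y # v) = ksig (sdeg x * sdeg y) (unsh_sum (\<lambda>a b. G (z # a) b) (u @ y # x # v))"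
      by (rule Cons.IH) (auto intro: swap_symmetric_Cons[OF Cons.prems(2)] Cons.prems(3) simp: z hword_Cons)
    have 2: "unsh_sum (\<lambda>a b. ksig (sdeg z * wdeg a) (G a (z # b))) (u @ x # y # v) =
      ksig (sdeg x * sdeg y) (unsh_sum (\<lambda>a b. ksig (sdeg z * wdeg a) (G a (z # b))) (u @ y # x # v))"
    proof (rule Cons.IH[OF z(2)])
      show "swap_symmetric g (\<lambda>u. ksig (sdeg z * wdeg u) (G u (z # v)))" if "hword g v" for v
        by (rule swap_symmetric_ksig[of g "\<lambda>u. G u (z # v)" "\<lambda>n. sdeg z * n"]) (simp add: Cons.prems(2) z that hword_Cons)
      show "swap_symmetric g (\<lambda>v. ksig (sdeg z * wdeg u) (G u (z # v)))" if "hword g u" for u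
        by (rule swap_symmetric_ksig[of g "\<lambda>v. G u (z # v)" "\<lambda>_. sdeg z * wdeg u"]) (simp add: Cons.prems(3) z that swap_symmetric_Cons)
    qed
    show ?case by (simp add: unsh_sum_Cons 1 2 ksig_add)
  qed
  then show ?thesis by (simp add: swap_symmetric_def)
qed

section \<open>Cochains\<close>

lemma dsum_in: "add_subgroup A \<Longrightarrow> (\<And>i. H i \<subseteq> A) \<Longrightarrow> x \<in> dsum H \<Longrightarrow> x \<in> A"
  unfolding dsum_def by (auto intro!: sum_in)

lemma add_subgroupD:
  assumes "add_subgroup A"
  shows add_subgroup_zero: "0 \<in> A" and add_subgroup_add: "x \<in> A \<Longrightarrow> y \<in> A \<Longrightarrow> x + y \<in> A"
    and add_subgroup_minus: "x \<in> A \<Longrightarrow> - x \<in> A"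
  using assms unfolding add_subgroup_def by blast+

lemma sum_fun_apply: "(\<Sum>i\<in>I. f i) x = (\<Sum>i\<in>I. f i x)"
  by (induction I rule: infinite_finite_induct) simp_all

lemma in_dsum: "x \<in> H i \<Longrightarrow> x \<in> dsum H"
  unfolding dsum_def by (auto intro!: exI[of _ "{i}"] exI[of _ "\<lambda>_. x"])

lemma add_subgroup_dsum:
  assumes "\<And>i. add_subgroup (H i)"
  shows "add_subgroup (dsum H)"
proof -
  have add: "x + y \<in> dsum H" if x: "x \<in> dsum H" and y: "y \<in> dsum H" for x y
  proof -
    obtain I a where I: "finite I" "\<forall>i\<in>I. a i \<in> H i" "x = (\<Sum>i\<in>I. a i)" using x by (auto simp: dsum_def)
    obtain J b where J: "finite J" "\<forall>i\<in>J. b i \<in> H i" "y = (\<Sum>i\<in>J. b i)" using y by (auto simp: dsum_def)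
    let ?c = "\<lambda>i. (if i \<in> I then a i else 0) + (if i \<in> J then b i else 0)"
    have "x + y = (\<Sum>i\<in>I \<union> J. ?c i)"
      using I J by (simp add: sum.distrib sum.If_cases Int_absorb1 Int_absorb2 Int_commute)
    moreover have "?c i \<in> H i" for i
      using I J assms[of i] by (auto simp: add_subgroup_def)
    ultimately show ?thesis
      unfolding dsum_def using I(1) J(1) by (blast intro: finite_UnI)
  qed
  have "- x \<in> dsum H" if x: "x \<in> dsum H" for x
  proof -
    obtain I a where I: "finite I" "\<forall>i\<in>I. a i \<in> H i" "x = (\<Sum>i\<in>I. a i)"
      using x by (auto simp: dsum_def)
    then have "- x = (\<Sum>i\<in>I. - a i)" "\<forall>i\<in>I. - a i \<in> H i"
      using assms by (auto simp: sum_negf add_subgroup_def)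
    then show ?thesis
      unfolding dsum_def using I(1) by blast
  qed
  moreover have "0 \<in> dsum H"
    using assms in_dsum[of 0 H 0] by (simp add: add_subgroup_def)
  ultimately show ?thesis using add by (simp add: add_subgroup_def)
qed

lemma add_subgroup_hc: "fd_graded V \<Longrightarrow> add_subgroup (hc V i)"
  unfolding add_subgroup_def by (auto intro: fd_graded_closed)

lemma add_subgroup_gsp: "fd_graded V \<Longrightarrow> add_subgroup (gsp V)"
  by (intro add_subgroup_dsum add_subgroup_hc)

lemma gsp_scl:
  assumes V: "fd_graded V" and x: "x \<in> gsp V"
  shows "scl V c x \<in> gsp V"
proof -
  interpret vector_space "scl V" using V by (rule fd_graded_vs)
  obtain I a where I: "finite I" "\<forall>i\<in>I. a i \<in> hc V i" "x = (\<Sum>i\<in>I. a i)" using x by (auto simp: dsum_def)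
  then have "scl V c x = (\<Sum>i\<in>I. scl V c (a i))" "\<forall>i\<in>I. scl V c (a i) \<in> hc V i"
    using hc_scl[OF V] by (auto simp: scale_sum_right)
  then show ?thesis unfolding dsum_def using I(1) by blast
qed

text \<open>\<open>e i\<close> is a basis of homogeneous elements of degrees \<open>q i\<close>, with dual basis \<open>r i\<close>.\<close>

definition homogeneous_basis ::
    "('k::field, 'v::ab_group_add, 'z) gvect_scheme \<Rightarrow> nat \<Rightarrow> (nat \<Rightarrow> 'v) \<Rightarrow> (nat \<Rightarrow> int) \<Rightarrow> (nat \<Rightarrow> 'v \<Rightarrow> 'k) \<Rightarrow> bool"
  where "homogeneous_basis V n e q r \<longleftrightarrow>
    (\<forall>i<n. e i \<in> hc V (q i)) \<and>
    (\<forall>i. additive_on (gsp V) (r i) \<and> (\<forall>c. \<forall>x\<in>gsp V. r i (scl V c x) = c * r i x)) \<and>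
    (\<forall>i<n. \<forall>j<n. r i (e j) = (if i = j then 1 else 0)) \<and>
    (\<forall>x\<in>gsp V. x = (\<Sum>i<n. scl V (r i x) (e i))) \<and>
    (\<forall>i<n. \<forall>p. p \<noteq> q i \<longrightarrow> (\<forall>x\<in>hc V p. r i x = 0))"

text \<open>A maximal independent subset of the union of the homogeneous components consists of
  homogeneous elements and spans everything; it is finite because the space lies in a finite span.
  Coordinates respect degrees by directness of the sum.\<close>

lemma homogeneous_basis_exists:
  assumes V: "fd_graded V"
  obtains n e q r where "homogeneous_basis V n e q r"
proof -
  interpret vector_space "scl V" using V by (rule fd_graded_vs)
  obtain B where B: "B \<subseteq> (\<Union>i. hc V i)" "independent B" "(\<Union>i. hc V i) \<subseteq> span B"
    by (rule maximal_independent_subset)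
  have span: "add_subgroup (span B)"
    by (auto simp: add_subgroup_def span_zero span_add span_neg)
  have gsp: "x \<in> span B" if "x \<in> gsp V" for x
    by (rule dsum_in[OF span _ that]) (use B in blast)
  have hg: "x \<in> gsp V" if "x \<in> hc V i" for x i
    using that by (rule in_dsum)
  obtain F where "finite F" "gsp V \<subseteq> span F" using V by (auto simp: fd_graded_def)
  then have fin: "finite B"
    using independent_span_bound[OF _ B(2)] B(1) hg by blast
  obtain e where e: "bij_betw e {..<card B} B"
    using ex_bij_betw_nat_finite[OF fin] by (auto simp: atLeast0LessThan)
  define n where "n = card B"
  have eB: "e i \<in> B" if "i < n" for i using e that by (auto simp: bij_betw_def n_def)
  define q where "q i = (SOME p. e i \<in> hc V p)" for i
  have q: "e i \<in> hc V (q i)" if "i < n" for i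
    unfolding q_def by (rule someI_ex) (use eB[OF that] B(1) in auto)
  define r where "r i x = representation B x (e i)" for i x
  have add: "r i (x + y) = r i x + r i y" if "x \<in> gsp V" "y \<in> gsp V" for i x y
    unfolding r_def using representation_add[OF B(2) gsp gsp, OF that(2,1)] by simp
  have scl: "r i (scl V c x) = c * r i x" if "x \<in> gsp V" for i c x
    unfolding r_def using representation_scale[OF B(2) gsp, OF that] by simp
  have dual: "r i (e j) = (if i = j then 1 else 0)" if "i < n" "j < n" for i j
  proof -
    have "e i = e j \<longleftrightarrow> i = j"
      using inj_onD[OF bij_betw_imp_inj_on[OF e], of i j] that unfolding n_def by auto
    then show ?thesis by (simp add: r_def representation_basis[OF B(2) eB[OF that(2)]])
  qed
  have repr: "x = (\<Sum>i<n. scl V (r i x) (e i))" if "x \<in> gsp V" for x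
  proof -
    have "x = (\<Sum>b\<in>B. scl V (representation B x b) b)"
      by (rule sum_representation_eq[OF B(2) gsp[OF that] fin order_refl, symmetric])
    also have "\<dots> = (\<Sum>i<n. scl V (r i x) (e i))"
      unfolding r_def n_def
      by (rule sum.reindex_bij_betw[OF e, of "\<lambda>b. scl V (representation B x b) b", symmetric])
    finally show ?thesis .
  qed
  have addon: "additive_on (gsp V) (r i)" for i by (simp add: additive_on_def add)
  have "r i x = 0" if x: "x \<in> hc V p" and i: "i < n" "p \<noteq> q i" for i p x
  proof -
    \<comment> \<open>\<open>y k\<close> is the part of degree \<open>k\<close> in the expansion of
      \<open>x\<close>. Since \<open>x\<close> has degree \<open>p\<close>, the homogeneous family
      \<open>z\<close> sums to zero, so directness makes it vanish; at \<open>q i\<close>, which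
      differs from \<open>p\<close>, this reads \<open>y (q i) = 0\<close>.\<close>
    define y where "y k = (\<Sum>j\<in>{j \<in> {..<n}. q j = k}. scl V (r j x) (e j))" for k
    define z where "z k = y k - (if k = p then x else 0)" for k
    let ?I = "insert p (q ` {..<n})"
    have yk: "y k \<in> hc V k" for k
      unfolding y_def by (intro sum_in[OF add_subgroup_hc[OF V]] hc_scl[OF V]) (auto dest: q)
    have zk: "z k \<in> hc V k" for k
      unfolding z_def using yk[of k] x hc_add[OF V, of "y k" k "- x"] hc_minus[OF V] by auto
    have "(\<Sum>k\<in>?I. y k) = x"
      unfolding y_def by (subst sum.group) (simp_all add: subset_insertI repr[OF hg[OF x], symmetric])
    then have "(\<Sum>k\<in>?I. z k) = 0"
      by (simp add: z_def sum_subtractf del: sum.insert)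
    then have "z (q i) = 0"
      using fd_graded_direct[OF V, unfolded direct_def, rule_format, of ?I z "q i"] zk i by simp
    then have "r i (y (q i)) = 0"
      using i additive_on_zero[OF add_subgroup_gsp[OF V] addon] by (auto simp: z_def)
    \<comment> \<open>The part of degree \<open>q i\<close> contains the summand with index
      \<open>i\<close>, and that is all the dual functional \<open>r i\<close> detects.\<close>
    moreover have "r i (y (q i)) = r i x"
    proof -
      have "r i (y (q i)) = (\<Sum>j\<in>{j \<in> {..<n}. q j = q i}. r i (scl V (r j x) (e j)))"
        unfolding y_def by (intro additive_on_sum[OF add_subgroup_gsp[OF V] addon] gsp_scl[OF V]) (auto dest: q hg)
      also have "\<dots> = (\<Sum>j\<in>{j \<in> {..<n}. q j = q i}. if j = i then r i x else 0)"
        using i by (intro sum.cong refl) (auto simp: scl[OF hg[OF q]] dual)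
      also have "\<dots> = r i x" using i by (simp add: sum.delta')
      finally show ?thesis .
    qed
    ultimately show ?thesis by simp
  qed
  then have "homogeneous_basis V n e q r"
    unfolding homogeneous_basis_def
    by (intro conjI allI impI ballI) (rule q addon scl dual repr; assumption)+
  then show ?thesis by (rule that)
qed

section \<open>Cochains through slotwise linearity and symmetry\<close>

lemma multilinear_form_iff:
  assumes "fd_graded g" "fd_graded M"
  shows "multilinear_form g M \<tau> \<longleftrightarrow>
    (\<forall>w. \<tau> w \<in> gsp M) \<and> (\<forall>w. \<not> hword g w \<longrightarrow> \<tau> w = 0) \<and> slot_linear g (scl M) \<tau>"
  unfolding multilinear_form_def slot_linear_iff[OF assms(1) fd_graded_vs[OF assms(2)]] ..

lemma graded_symmetric_iff:
  assumes "fd_graded M" "\<And>w. \<not> hword g w \<Longrightarrow> \<tau> w = 0"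
  shows "graded_symmetric M \<tau> \<longleftrightarrow> swap_symmetric g \<tau>"
proof -
  have "\<tau> (u @ x # y # v) = ksig (sdeg x * sdeg y) (\<tau> (u @ y # x # v))" if "\<not> hword g (u @ x # y # v)" for u v x y
  proof -
    have "\<not> hword g (u @ y # x # v)" using that by (auto simp: hword_simps)
    then show ?thesis using that assms(2) by (simp add: ksig_0)
  qed
  then show ?thesis
    unfolding graded_symmetric_def swap_symmetric_def scl_ksgn[OF fd_graded_vs[OF assms(1)]] by metis
qed

lemma coch_iff:
  assumes "fd_graded g" "fd_graded M"
  shows "\<tau> \<in> coch g M \<longleftrightarrow>
    (\<forall>w. \<tau> w \<in> gsp M) \<and> (\<forall>w. \<not> hword g w \<longrightarrow> \<tau> w = 0) \<and> slot_linear g (scl M) \<tau> \<and> swap_symmetric g \<tau> \<and>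
    (\<exists>N. \<forall>w. length w > N \<longrightarrow> \<tau> w = 0)"
proof (cases "\<forall>w. \<not> hword g w \<longrightarrow> \<tau> w = 0")
  case True
  then have "graded_symmetric M \<tau> \<longleftrightarrow> swap_symmetric g \<tau>"
    by (intro graded_symmetric_iff[OF assms(2)]) simp
  then show ?thesis
    by (simp only: coch_def mem_Collect_eq multilinear_form_iff[OF assms] conj_assoc)
next
  case False
  then show ?thesis
    by (simp only: coch_def mem_Collect_eq multilinear_form_def False simp_thms)
qed

lemma coch_p_iff: "\<tau> \<in> coch_p g M k \<longleftrightarrow> \<tau> \<in> coch g M \<and> (\<forall>w. length w \<noteq> k \<longrightarrow> \<tau> w = 0)"
proof -
  have "\<exists>N. \<forall>w. length w > N \<longrightarrow> \<tau> w = 0" if "\<forall>w. length w \<noteq> k \<longrightarrow> \<tau> w = 0"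
    using that by (intro exI[of _ k]) simp
  then show ?thesis by (auto simp only: coch_p_def coch_def mem_Collect_eq)
qed

lemma coch_degD: "\<tau> \<in> coch_deg g M n \<Longrightarrow> \<tau> \<in> coch g M"
  by (simp add: coch_deg_def)

context
  fixes g :: "('k::field, 'g::ab_group_add, 'z) gvect_scheme" and M :: "('k, 'm::ab_group_add, 'y) gvect_scheme"
  assumes g: "fd_graded g" and M: "fd_graded M"
begin

lemma cochD:
  assumes "\<tau> \<in> coch g M"
  shows coch_gsp: "\<tau> w \<in> gsp M" and coch_hword: "\<not> hword g w \<Longrightarrow> \<tau> w = 0"
    and coch_linear: "slot_linear g (scl M) \<tau>" and coch_swap: "swap_symmetric g \<tau>"
    and coch_bound: "\<exists>N. \<forall>w. length w > N \<longrightarrow> \<tau> w = 0"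
  using assms unfolding coch_iff[OF g M] by blast+

lemma add_subgroup_coch: "add_subgroup (coch g M)"
proof -
  interpret vector_space "scl M" using M by (rule fd_graded_vs)
  have "\<sigma> + \<tau> \<in> coch g M" if s: "\<sigma> \<in> coch g M" and t: "\<tau> \<in> coch g M" for \<sigma> \<tau>
    unfolding coch_iff[OF g M]
  proof (intro conjI allI impI)
    show "(\<sigma> + \<tau>) w \<in> gsp M" for w
      using add_subgroup_gsp[OF M] coch_gsp[OF s] coch_gsp[OF t] by (simp add: add_subgroup_def)
    show "(\<sigma> + \<tau>) w = 0" if "\<not> hword g w" for w
      using that coch_hword[OF s] coch_hword[OF t] by simp
    show "slot_linear g (scl M) (\<sigma> + \<tau>)"
      using coch_linear[OF s] coch_linear[OF t] by (simp add: slot_linear_def scale_right_distrib algebra_simps)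
    show "swap_symmetric g (\<sigma> + \<tau>)"
      using coch_swap[OF s] coch_swap[OF t] by (simp add: swap_symmetric_def ksig_add)
    obtain N N' where "\<forall>w. length w > N \<longrightarrow> \<sigma> w = 0" "\<forall>w. length w > N' \<longrightarrow> \<tau> w = 0"
      using coch_bound[OF s] coch_bound[OF t] by blast
    then show "\<exists>N. \<forall>w. length w > N \<longrightarrow> (\<sigma> + \<tau>) w = 0"
      by (intro exI[of _ "max N N'"]) simp
  qed
  moreover have "- \<tau> \<in> coch g M" if t: "\<tau> \<in> coch g M" for \<tau>
    unfolding coch_iff[OF g M]
    using add_subgroup_gsp[OF M] coch_gsp[OF t] coch_hword[OF t] coch_linear[OF t] coch_swap[OF t] coch_bound[OF t]
    by (auto simp: add_subgroup_def slot_linear_def swap_symmetric_def ksig_def)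
  moreover have "0 \<in> coch g M"
    using add_subgroup_gsp[OF M]
    by (simp add: coch_iff[OF g M] slot_linear_def swap_symmetric_def ksig_0 add_subgroup_def)
  ultimately show ?thesis by (simp add: add_subgroup_def)
qed

lemma add_subgroup_coch_deg: "add_subgroup (coch_deg g M n)"
  unfolding add_subgroup_def
proof (intro conjI ballI)
  show "0 \<in> coch_deg g M n"
    using add_subgroup_coch hc_zero[OF M] by (simp add: coch_deg_def add_subgroup_def)
  show "\<sigma> + \<tau> \<in> coch_deg g M n" "- \<sigma> \<in> coch_deg g M n"
    if "\<sigma> \<in> coch_deg g M n" "\<tau> \<in> coch_deg g M n" for \<sigma> \<tau>
    using that hc_add[OF M] hc_minus[OF M]
    by (simp_all add: coch_deg_def add_subgroup_add[OF add_subgroup_coch] add_subgroup_minus[OF add_subgroup_coch])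
qed

text \<open>Common to \<open>cprod\<close> and \<open>cext\<close>, whose summands differ only in
  \<open>G\<close> and in a sign depending on the degrees of the two parts. Such a sign is constant
  along each equation of linearity and symmetry.\<close>

lemma unsh_sum_coch:
  assumes gsp: "\<And>u v. G u v \<in> gsp M"
    and hw: "\<And>u v. \<not> hword g u \<Longrightarrow> G u v = 0" "\<And>u v. \<not> hword g v \<Longrightarrow> G u v = 0"
    and lin: "\<And>v. slot_linear g (scl M) (\<lambda>u. G u v)" "\<And>u. slot_linear g (scl M) (G u)"
    and swap: "\<And>v. swap_symmetric g (\<lambda>u. G u v)" "\<And>u. swap_symmetric g (G u)"
    and len: "\<And>u v. length u > N \<Longrightarrow> G u v = 0" "\<And>u v. length v > N' \<Longrightarrow> G u v = 0"
  shows "unsh_sum (\<lambda>u v. ksig (f (wdeg u) (wdeg v)) (G u v)) \<in> coch g M"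
proof -
  note s = fd_graded_vs[OF M]
  show ?thesis
    unfolding coch_iff[OF g M]
  proof (intro conjI allI impI)
    show "unsh_sum (\<lambda>u v. ksig (f (wdeg u) (wdeg v)) (G u v)) w \<in> gsp M" for w
      by (intro unsh_sum_in add_subgroup_gsp M ksig_in gsp)
    show "unsh_sum (\<lambda>u v. ksig (f (wdeg u) (wdeg v)) (G u v)) w = 0" if "\<not> hword g w" for w
      by (rule unsh_sum_zero) (use that hw hword_Un in \<open>metis ksig_0\<close>)
    show "slot_linear g (scl M) (unsh_sum (\<lambda>u v. ksig (f (wdeg u) (wdeg v)) (G u v)))"
      by (intro slot_linear_unsh_sum[OF g s] slot_linear_ksig[OF g s, of _ "\<lambda>k. f k (wdeg v)" for v]
          slot_linear_ksig[OF g s, of _ "\<lambda>k. f (wdeg u) k" for u] lin)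
    show "swap_symmetric g (unsh_sum (\<lambda>u v. ksig (f (wdeg u) (wdeg v)) (G u v)))"
      by (intro swap_symmetric_unsh_sum swap_symmetric_ksig[of g _ "\<lambda>k. f k (wdeg v)" for v]
          swap_symmetric_ksig[of g _ "\<lambda>k. f (wdeg u) k" for u] swap)
    \<comment> \<open>The lengths of the two parts add up to that of \<open>w\<close>, so at least
      one part exceeds its bound.\<close>
    have "unsh_sum (\<lambda>u v. ksig (f (wdeg u) (wdeg v)) (G u v)) w = 0" if w: "length w > N + N'" for w
    proof -
      have "G u v = 0" if "(s, u, v) \<in> set (unshuffles w)" for s u v
        using length_unshuffles[OF that] w len by (cases "length u > N") auto
      then have "map (\<lambda>(s, u, v). ksig s (ksig (f (wdeg u) (wdeg v)) (G u v))) (unshuffles w) = map (\<lambda>_. 0) (unshuffles w)"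
        by (intro map_cong) (auto simp: ksig_0)
      then show ?thesis unfolding unsh_sum_def by (simp only: sum_list_0)
    qed
    then show "\<exists>N. \<forall>w. length w > N \<longrightarrow> unsh_sum (\<lambda>u v. ksig (f (wdeg u) (wdeg v)) (G u v)) w = 0" by blast
  qed
qed

end

section \<open>Forms with values in the ground field\<close>

lemma scl_ground: "scl ground = (*)"
  by (simp add: ground_def)

lemma hc_ground: "hc ground i = (if i = 0 then UNIV else {0})"
  by (simp add: ground_def)

lemma fd_graded_ground: "fd_graded (ground :: ('k::field, 'k) gvect)"
proof -
  interpret vector_space "scl (ground :: ('k, 'k) gvect)" by (rule vector_space_ground)
  have "subspace (hc (ground :: ('k, 'k) gvect) i)" for i
    by (simp add: subspace_def hc_ground)
  moreover have "direct (hc (ground :: ('k, 'k) gvect))"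
    unfolding direct_def
  proof (intro allI impI ballI)
    fix I :: "int set" and x :: "int \<Rightarrow> 'k" and i
    assume *: "finite I \<and> (\<forall>i\<in>I. x i \<in> hc ground i) \<and> (\<Sum>i\<in>I. x i) = 0" and i: "i \<in> I"
    have z: "x j = 0" if "j \<in> I" "j \<noteq> 0" for j
      using * that by (auto simp: hc_ground)
    show "x i = 0"
    proof (cases "i = 0")
      case True
      have "(\<Sum>i\<in>I. x i) = (\<Sum>i\<in>{0}. x i)"
        using * i True z by (intro sum.mono_neutral_right) auto
      then show ?thesis using * True by simp
    qed (rule z[OF i])
  qed
  moreover have "x \<in> span {1}" for x :: 'k
  proof -
    have "scl ground x 1 \<in> span {1 :: 'k}"
      by (intro span_scale span_base) simp
    then show ?thesis by (simp only: scl_ground mult_1_right)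
  qed
  ultimately show ?thesis
    unfolding fd_graded_def
    by (intro conjI vector_space_ground allI exI[of _ "{1}"] finite.intros subsetI)
qed

lemma gsp_ground: "gsp (ground :: ('k::field, 'k) gvect) = UNIV"
proof -
  have "x \<in> gsp (ground :: ('k, 'k) gvect)" for x :: 'k
    by (rule in_dsum[of _ _ 0]) (simp add: hc_ground)
  then show ?thesis by blast
qed

lemma coch_deg_ground_iff:
  "a \<in> coch_deg g (ground :: ('k::field, 'k) gvect) p \<longleftrightarrow> a \<in> coch g ground \<and> (\<forall>w. a w \<noteq> 0 \<longrightarrow> wdeg w = - p)"
proof -
  have "a w \<in> hc ground (p + wdeg w) \<longleftrightarrow> (a w \<noteq> 0 \<longrightarrow> wdeg w = - p)" for w
    by (auto simp: hc_ground)
  then show ?thesis by (simp add: coch_deg_def)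
qed

text \<open>A form of degree \<open>p\<close> lives on words of degree \<open>- p\<close>, and signs
  do not distinguish \<open>p\<close> from \<open>- p\<close>. Thus the degree sign of a Leibniz
  rule becomes a pointwise sign, which makes sense for inhomogeneous forms too.\<close>

lemma ksgn_degree:
  assumes "a \<in> coch_deg g (ground :: ('k::field, 'k) gvect) p"
  shows "ksgn (e * p) * a w = ksig (e * wdeg w) (a w)"
proof (cases "a w = 0")
  case False
  then have "wdeg w = - p" using assms by (simp add: coch_deg_ground_iff)
  then show ?thesis by (simp add: ksig_def ksgn_def)
qed (simp add: ksig_0)

text \<open>The embedding of the generators: \<open>m\<close> as the element
  \<open>1 \<otimes> m\<close> of \<open>C\<^sup>0(g, M)\<close>.\<close>

definition cst :: "'m::zero \<Rightarrow> 'g word \<Rightarrow> 'm"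
  where "cst m w = (if w = [] then m else 0)"

lemma cst_coch:
  assumes "fd_graded g" "fd_graded M"
  shows "m \<in> gsp M \<Longrightarrow> cst m \<in> coch g M" "m \<in> hc M i \<Longrightarrow> cst m \<in> coch_deg g M i"
proof -
  interpret vector_space "scl M" using assms(2) by (rule fd_graded_vs)
  show *: "cst m \<in> coch g M" if "m \<in> gsp M" for m
    using that add_subgroup_gsp[OF assms(2)]
    by (auto simp: coch_iff[OF assms] cst_def slot_linear_def swap_symmetric_def add_subgroup_def ksig_0 hword_Nil
        intro!: exI[of _ 0])
  show "cst m \<in> coch_deg g M i" if "m \<in> hc M i"
    using *[OF in_dsum[of m "hc M" i]] that hc_zero[OF assms(2)] by (auto simp: coch_deg_def cst_def wdeg_simps)
qed

lemma cunit_cst: "cunit = cst 1"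
  by (simp add: cunit_def cst_def fun_eq_iff)

text \<open>Stated for linear maps of any degree, so that it covers coordinate functionals, which
  send vectors of every degree to the ground field.\<close>

lemma coch_compose:
  assumes g: "fd_graded g" and M: "fd_graded M" and N: "fd_graded N"
    and f: "additive_on (gsp M) f" "\<And>c x. x \<in> gsp M \<Longrightarrow> f (scl M c x) = scl N c (f x)"
      "\<And>x. x \<in> gsp M \<Longrightarrow> f x \<in> gsp N" and t: "\<tau> \<in> coch g M"
  shows "(\<lambda>w. f (\<tau> w)) \<in> coch g N"
  unfolding coch_iff[OF g N]
proof (intro conjI allI impI)
  note A = add_subgroup_gsp[OF M] and T = cochD[OF g M t]
  show "f (\<tau> w) \<in> gsp N" for w by (intro f T)
  show "f (\<tau> w) = 0" if "\<not> hword g w" for w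
    using T(2)[OF that] additive_on_zero[OF A f(1)] by simp
  show "slot_linear g (scl N) (\<lambda>w. f (\<tau> w))"
    unfolding slot_linear_def using T(1) f(1)
    by (simp add: slot_linearD[OF T(3)] additive_on_def gsp_scl[OF M] f(2))
  show "swap_symmetric g (\<lambda>w. f (\<tau> w))"
    unfolding swap_symmetric_def
    by (metis swap_symmetricD[OF T(4)] additive_on_ksig[OF A f(1) T(1)])
  show "\<exists>N. \<forall>w. length w > N \<longrightarrow> f (\<tau> w) = 0"
  proof -
    obtain N where "\<forall>w. length w > N \<longrightarrow> \<tau> w = 0" using T(5) by blast
    then show ?thesis using additive_on_zero[OF A f(1)] by (intro exI[of _ N]) simp
  qed
qed

text \<open>The zero vector belongs to every component, so homogeneous words with zero letters have
  arbitrarily large degrees; this keeps them out of the degree bound that follows.\<close>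

lemma coch_slot_zero:
  assumes "fd_graded g" "fd_graded M" "\<tau> \<in> coch g M" "(i, 0) \<in> set w"
  shows "\<tau> w = 0"
proof (cases "hword g w")
  case True
  obtain u v where "w = u @ (i, 0) # v" using assms(4) by (auto simp: in_set_conv_decomp)
  then show ?thesis
    using True slot_linear_props(1)[OF assms(1) fd_graded_vs[OF assms(2)] coch_linear[OF assms(1-3)]]
    by (auto simp: hword_simps)
qed (rule coch_hword[OF assms(1-3)])

text \<open>Where a cochain is nonzero the word is short and its letters are nonzero, and a nonzero
  homogeneous letter has the degree of some basis element.\<close>

lemma coch_wdeg_bound:
  assumes g: "fd_graded g" and M: "fd_graded M" and t: "\<tau> \<in> coch g M"
  obtains K where "K \<ge> 0" "\<And>w. \<tau> w \<noteq> 0 \<Longrightarrow> \<bar>wdeg w\<bar> \<le> K"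
proof -
  interpret vector_space "scl g" using g by (rule fd_graded_vs)
  obtain n e q r where B: "homogeneous_basis g n e q r" using g by (rule homogeneous_basis_exists)
  obtain N where N: "\<And>w. length w > N \<Longrightarrow> \<tau> w = 0" using coch_bound[OF g M t] by blast
  \<comment> \<open>A crude bound for the shifted degrees of the basis elements; a sum, unlike a
    maximum, needs no separate treatment when the basis is empty.\<close>
  define L where "L = (\<Sum>i<n. \<bar>q i - 1\<bar>)"
  have L0: "L \<ge> 0" by (simp add: L_def sum_nonneg)
  have deg: "\<bar>i - 1\<bar> \<le> L" if x: "x \<in> hc g i" "x \<noteq> 0" for x i
  proof -
    have sum: "(\<Sum>j<n. scl g (r j x) (e j)) = x"
      using B in_dsum[of x "hc g", OF x(1)] unfolding homogeneous_basis_def by simp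
    \<comment> \<open>A nonzero coordinate forces the degree of its basis element to be that of
      \<open>x\<close>.\<close>
    have "\<exists>j<n. r j x \<noteq> 0"
    proof (rule ccontr)
      assume "\<not> (\<exists>j<n. r j x \<noteq> 0)"
      then have "(\<Sum>j<n. scl g (r j x) (e j)) = 0" by (intro sum.neutral) auto
      then show False using sum x(2) by simp
    qed
    then obtain j where "j < n" "r j x \<noteq> 0" by blast
    then have "j < n" "q j = i" using B x(1) unfolding homogeneous_basis_def by metis+
    then show ?thesis
      unfolding L_def using member_le_sum[of j "{..<n}" "\<lambda>i. \<bar>q i - 1\<bar>"] by auto
  qed
  have letters: "\<bar>wdeg w\<bar> \<le> int (length w) * L" if "hword g w" "\<forall>i. (i, 0) \<notin> set w" for w
    using that
  proof (induction w)
    case (Cons x w)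
    then have "\<bar>sdeg x\<bar> \<le> L" using deg[of "snd x" "fst x"] by (cases x) (auto simp: hword_Cons sdeg_def)
    moreover have "\<bar>wdeg w\<bar> \<le> int (length w) * L" using Cons by (auto simp: hword_Cons)
    ultimately show ?case by (simp add: wdeg_simps algebra_simps)
  qed (simp add: wdeg_simps)
  show ?thesis
  proof
    show "0 \<le> int N * L" using L0 by simp
    fix w assume w: "\<tau> w \<noteq> 0"
    then have "\<bar>wdeg w\<bar> \<le> int (length w) * L"
      using coch_hword[OF g M t] coch_slot_zero[OF g M t] by (intro letters) blast+
    also have "\<dots> \<le> int N * L"
      using N[of w] w L0 by (intro mult_right_mono) (auto simp: not_less[symmetric])
    finally show "\<bar>wdeg w\<bar> \<le> int N * L" .
  qed
qed

text \<open>The component of degree \<open>p\<close>. The minus sign is there because a form of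
  degree \<open>p\<close> pairs with words of degree \<open>- p\<close>.\<close>

definition form_part :: "int \<Rightarrow> ('g word \<Rightarrow> 'a::zero) \<Rightarrow> 'g word \<Rightarrow> 'a"
  where "form_part p a w = (if wdeg w = - p then a w else 0)"

lemma form_part_coch_deg:
  assumes "fd_graded g" "a \<in> coch g ground"
  shows "form_part p a \<in> coch_deg g ground p"
proof -
  note A = cochD[OF assms(1) fd_graded_ground assms(2)]
  have "form_part p a \<in> coch g ground"
    unfolding coch_iff[OF assms(1) fd_graded_ground]
    using A by (auto simp: form_part_def gsp_ground slot_linear_def swap_symmetric_def scl_ground wdeg_append wdeg_simps ksig_0 add_ac)
  then show ?thesis by (auto simp: coch_deg_ground_iff form_part_def)
qed

lemma coch_ground_decompose:
  assumes "fd_graded g" "a \<in> coch g ground"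
  obtains K where "a = (\<Sum>p\<in>{- K..K}. form_part p a)"
proof -
  obtain K where K: "K \<ge> 0" "\<And>w. a w \<noteq> 0 \<Longrightarrow> \<bar>wdeg w\<bar> \<le> K"
    using coch_wdeg_bound[OF assms(1) fd_graded_ground assms(2)] by blast
  have "a w = (\<Sum>p\<in>{- K..K}. form_part p a) w" for w
  proof -
    have "(\<Sum>p\<in>{- K..K}. form_part p a) w = (\<Sum>p\<in>{- K..K}. if p = - wdeg w then a w else 0)"
      unfolding sum_fun_apply form_part_def by (intro sum.cong) auto
    also have "\<dots> = a w" using K(2)[of w] by (cases "a w = 0") auto
    finally show ?thesis ..
  qed
  then show ?thesis using that by blast
qed

section \<open>The Chevalley-Eilenberg differential on cochains\<close>

context
  fixes g :: "('k::field_char_0, 'g::ab_group_add) dgla"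
  assumes L: "dg_lie_algebra g"
begin

lemma dgla_fd: "fd_graded g"
  using L unfolding dg_lie_algebra_def by (rule conjunct1)

lemma df_hc: "x \<in> hc g i \<Longrightarrow> df g x \<in> hc g (i + 1)"
  and br_hc: "x \<in> hc g i \<Longrightarrow> y \<in> hc g j \<Longrightarrow> br g x y \<in> hc g (i + j)"
  using L unfolding dg_lie_algebra_def by blast+

lemma lin_on_comb:
  "lin_on g s f \<Longrightarrow> x \<in> gsp g \<Longrightarrow> y \<in> gsp g \<Longrightarrow> f (scl g c x + y) = s c (f x) + f y"
  using gsp_scl[OF dgla_fd] by (simp add: lin_on_def)

lemma df_linear:
  assumes "x \<in> gsp g" "y \<in> gsp g"
  shows "df g (scl g c x + y) = scl g c (df g x) + df g y"
proof -
  have "lin_on g (scl g) (df g)" using L unfolding dg_lie_algebra_def by blast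
  then show ?thesis using assms by (rule lin_on_comb)
qed

lemma br_linear_right:
  assumes "z \<in> gsp g" "x \<in> gsp g" "y \<in> gsp g"
  shows "br g z (scl g c x + y) = scl g c (br g z x) + br g z y"
proof -
  have "lin_on g (scl g) (br g z)" using L assms(1) unfolding dg_lie_algebra_def by blast
  then show ?thesis using assms(2,3) by (rule lin_on_comb)
qed

lemma br_linear_left:
  assumes "z \<in> gsp g" "x \<in> gsp g" "y \<in> gsp g"
  shows "br g (scl g c x + y) z = scl g c (br g x z) + br g y z"
proof -
  have "lin_on g (scl g) (\<lambda>x. br g x z)" using L assms(1) unfolding dg_lie_algebra_def by blast
  then show ?thesis using assms(2,3) by (rule lin_on_comb)
qed

lemma br_swap:
  assumes "x \<in> hc g i" "y \<in> hc g j"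
  shows "br g x y = ksig (i * j + 1) (br g y x)"
proof -
  have "br g x y = - scl g (ksgn (i * j)) (br g y x)"
    using L assms unfolding dg_lie_algebra_def by blast
  also have "\<dots> = ksig (i * j + 1) (br g y x)"
    by (simp add: scl_ksgn[OF fd_graded_vs[OF dgla_fd]] ksig_def)
  finally show ?thesis .
qed

lemmas hc_gsp = in_dsum[of _ "hc g"]

section \<open>The codifferential respects linearity and symmetry of functions on words\<close>

lemma hword_ad_word:
  "(s, v) \<in> set (ad_word g x w) \<Longrightarrow> snd x \<in> hc g (fst x) \<Longrightarrow> hword g w \<Longrightarrow> hword g v"
  by (induction w arbitrary: s v) (auto simp: hword_Cons br_hc)

lemma ad_sum_cong:
  assumes "\<And>v. hword g v \<Longrightarrow> H v = H' v" "snd x \<in> hc g (fst x)" "hword g w"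
  shows "ad_sum g x H w = ad_sum g x H' w"
  unfolding ad_sum_def
  by (intro arg_cong[of _ _ sum_list] map_cong) (auto simp: assms hword_ad_word[OF _ assms(2,3)])

lemma hword_codiff: "(s, v) \<in> set (codiff g w) \<Longrightarrow> hword g w \<Longrightarrow> hword g v"
proof (induction w arbitrary: s v)
  case (Cons x w)
  then have x: "snd x \<in> hc g (fst x)" "hword g w" by (simp_all add: hword_Cons)
  from Cons.prems(1) consider "v = (fst x + 1, df g (snd x)) # w" | t where "(t, v) \<in> set (ad_word g x w)"
    | t u where "(t, u) \<in> set (codiff g w)" "v = x # u"
    by auto
  then show ?case
  proof cases
    case 2
    then show ?thesis using x by (rule hword_ad_word)
  qed (use x Cons.IH in \<open>simp_all add: hword_Cons df_hc\<close>)
qed simp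

lemma codiff_sum_cong:
  assumes "\<And>v. hword g v \<Longrightarrow> H v = H' v" "hword g w"
  shows "codiff_sum g H w = codiff_sum g H' w"
  unfolding codiff_sum_def
  by (intro arg_cong[of _ _ sum_list] map_cong) (auto simp: assms hword_codiff)

lemma ad_sum_slot_linear:
  assumes s: "vector_space s" and z: "snd z \<in> hc g (fst z)" and H: "slot_linear g s H"
  shows "slot_linear g s (ad_sum g z H)"
proof -
  interpret S: vector_space s by fact
  have lin: "ad_sum g z (\<lambda>v. s c (H v) + H' v) w = s c (ad_sum g z H w) + ad_sum g z H' w" for c H H' w
    by (simp add: ad_sum_add ad_sum_hom[where f = "s c", OF S.scale_right_distrib])
  have "ad_sum g z H (u @ (i, scl g c x + y) # v) = s c (ad_sum g z H (u @ (i, x) # v)) + ad_sum g z H (u @ (i, y) # v)"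
    if "hword g u" "hword g v" "x \<in> hc g i" "y \<in> hc g i" for u v i x y c
    using that(1) H
  proof (induction u arbitrary: H)
    case Nil
    have 1: "ad_sum g z (\<lambda>v'. H ((i, scl g c x + y) # v')) v =
        s c (ad_sum g z (\<lambda>v'. H ((i, x) # v')) v) + ad_sum g z (\<lambda>v'. H ((i, y) # v')) v"
      unfolding lin[symmetric] by (intro ad_sum_cong slot_linear_hd[OF Nil(2)] that z)
    have 2: "H ((fst z + i, br g (snd z) (scl g c x + y)) # v) =
        s c (H ((fst z + i, br g (snd z) x) # v)) + H ((fst z + i, br g (snd z) y) # v)"
      unfolding br_linear_right[OF hc_gsp[OF z] hc_gsp[OF that(3)] hc_gsp[OF that(4)]]
      by (intro slot_linear_hd[OF Nil(2)] br_hc that z)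
    show ?case
      by (simp add: ad_sum_Cons 1 2 ksig_add sdeg_def scl_ksig[OF s] S.scale_right_distrib)
  next
    case (Cons t u)
    have t: "snd t \<in> hc g (fst t)" "hword g u" using Cons.prems(1) by (auto simp: hword_Cons)
    have 1: "ad_sum g z (\<lambda>v. H (t # v)) (u @ (i, scl g c x + y) # v) =
      s c (ad_sum g z (\<lambda>v. H (t # v)) (u @ (i, x) # v)) + ad_sum g z (\<lambda>v. H (t # v)) (u @ (i, y) # v)"
      by (intro Cons.IH t slot_linear_Cons[OF Cons.prems(2)])
    have 2: "H ((fst z + fst t, br g (snd z) (snd t)) # u @ (i, scl g c x + y) # v) =
        s c (H ((fst z + fst t, br g (snd z) (snd t)) # u @ (i, x) # v)) +
        H ((fst z + fst t, br g (snd z) (snd t)) # u @ (i, y) # v)"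
      using slot_linearD[OF Cons.prems(2) that(3,4), of "(fst z + fst t, br g (snd z) (snd t)) # u" v] t that br_hc[OF z t(1)]
      by (simp add: hword_Cons)
    show ?case
      by (simp add: ad_sum_Cons 1 2 ksig_add scl_ksig[OF s] S.scale_right_distrib)
  qed
  then show ?thesis by (simp add: slot_linear_def)
qed

text \<open>In \<open>codiff\<close> the first letter of a word acts on the others, so linearity in
  the first slot involves linearity in the acting letter.\<close>

lemma ad_sum_linear_left:
  assumes s: "vector_space s" and H: "slot_linear g s H" and w: "hword g w" and x: "x \<in> hc g i" "y \<in> hc g i"
  shows "ad_sum g (i, scl g c x + y) H w = s c (ad_sum g (i, x) H w) + ad_sum g (i, y) H w"
  using w H
proof (induction w arbitrary: H)
  case Nil
  interpret S: vector_space s by fact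
  show ?case by (simp add: ad_sum_Nil)
next
  case (Cons t w)
  interpret S: vector_space s by fact
  have t: "snd t \<in> hc g (fst t)" "hword g w" using Cons.prems(1) by (auto simp: hword_Cons)
  have 1: "ad_sum g (i, scl g c x + y) (\<lambda>v. H (t # v)) w =
      s c (ad_sum g (i, x) (\<lambda>v. H (t # v)) w) + ad_sum g (i, y) (\<lambda>v. H (t # v)) w"
    by (intro Cons.IH t slot_linear_Cons[OF Cons.prems(2)])
  have 2: "H ((i + fst t, br g (scl g c x + y) (snd t)) # w) =
      s c (H ((i + fst t, br g x (snd t)) # w)) + H ((i + fst t, br g y (snd t)) # w)"
    unfolding br_linear_left[OF hc_gsp[OF t(1)] hc_gsp[OF x(1)] hc_gsp[OF x(2)]]
    by (intro slot_linear_hd[OF Cons.prems(2)] br_hc x t)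
  show ?case
    by (simp add: ad_sum_Cons 1 2 ksig_add scl_ksig[OF s] S.scale_right_distrib)
qed

lemma codiff_sum_slot_linear:
  assumes s: "vector_space s" and H: "slot_linear g s H"
  shows "slot_linear g s (codiff_sum g H)"
proof -
  interpret S: vector_space s by fact
  have lin: "codiff_sum g (\<lambda>v. s c (H v) + H' v) w = s c (codiff_sum g H w) + codiff_sum g H' w" for c H H' w
    by (simp add: codiff_sum_add codiff_sum_hom[where f = "s c", OF S.scale_right_distrib])
  have "codiff_sum g H (u @ (i, scl g c x + y) # v) = s c (codiff_sum g H (u @ (i, x) # v)) + codiff_sum g H (u @ (i, y) # v)"
    if "hword g u" "hword g v" "x \<in> hc g i" "y \<in> hc g i" for u v i x y c
    using that(1) H
  proof (induction u arbitrary: H)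
    case Nil
    have 1: "codiff_sum g (\<lambda>v'. H ((i, scl g c x + y) # v')) v =
        s c (codiff_sum g (\<lambda>v'. H ((i, x) # v')) v) + codiff_sum g (\<lambda>v'. H ((i, y) # v')) v"
      unfolding lin[symmetric] by (intro codiff_sum_cong slot_linear_hd[OF Nil(2)] that)
    have 2: "H ((i + 1, df g (scl g c x + y)) # v) = s c (H ((i + 1, df g x) # v)) + H ((i + 1, df g y) # v)"
      unfolding df_linear[OF hc_gsp[OF that(3)] hc_gsp[OF that(4)]]
      by (intro slot_linear_hd[OF Nil(2)] df_hc that)
    show ?case
      by (simp add: codiff_sum_Cons 1 2 ad_sum_linear_left[OF s Nil(2) that(2-4)] ksig_add sdeg_def scl_ksig[OF s] S.scale_right_distrib)
  next
    case (Cons t u)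
    have t: "snd t \<in> hc g (fst t)" "hword g u" using Cons.prems(1) by (auto simp: hword_Cons)
    have 1: "codiff_sum g (\<lambda>v. H (t # v)) (u @ (i, scl g c x + y) # v) =
      s c (codiff_sum g (\<lambda>v. H (t # v)) (u @ (i, x) # v)) + codiff_sum g (\<lambda>v. H (t # v)) (u @ (i, y) # v)"
      by (intro Cons.IH t slot_linear_Cons[OF Cons.prems(2)])
    have 2: "H ((fst t + 1, df g (snd t)) # u @ (i, scl g c x + y) # v) =
        s c (H ((fst t + 1, df g (snd t)) # u @ (i, x) # v)) +
        H ((fst t + 1, df g (snd t)) # u @ (i, y) # v)"
      using slot_linearD[OF Cons.prems(2) that(3,4), of "(fst t + 1, df g (snd t)) # u" v] t that df_hc[OF t(1)]
      by (simp add: hword_Cons)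
    have 3: "ad_sum g t H (u @ (i, scl g c x + y) # v) = s c (ad_sum g t H (u @ (i, x) # v)) + ad_sum g t H (u @ (i, y) # v)"
      by (intro slot_linearD[OF ad_sum_slot_linear[OF s t(1) Cons.prems(2)]] that t)
    show ?case
      by (simp add: codiff_sum_Cons 1 2 3 ksig_add scl_ksig[OF s] S.scale_right_distrib)
  qed
  then show ?thesis by (simp add: slot_linear_def)
qed

text \<open>\<open>z\<close> acts as a derivation of degree \<open>fst z\<close>. When it hits one
  of the two letters, the degree of that letter grows by \<open>fst z\<close>, and the resulting
  change of the swap sign is the sign for moving \<open>z\<close> past the other letter.\<close>

lemma ad_sum_swap:
  assumes z: "snd z \<in> hc g (fst z)" and H: "swap_symmetric g H"
  shows "swap_symmetric g (ad_sum g z H)"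
proof -
  have "ad_sum g z H (u @ x # y # v) = ksig (sdeg x * sdeg y) (ad_sum g z H (u @ y # x # v))"
    if "hword g (u @ x # y # v)" for u v x y
    using that H
  proof (induction u arbitrary: H)
    case Nil
    have xy: "snd x \<in> hc g (fst x)" "snd y \<in> hc g (fst y)" "hword g v" using Nil by (auto simp: hword_simps)
    let ?b = "\<lambda>x. (fst z + fst x, br g (snd z) (snd x))"
    have 1: "ad_sum g z (\<lambda>v. H (x # y # v)) v = ksig (sdeg x * sdeg y) (ad_sum g z (\<lambda>v. H (y # x # v)) v)"
      unfolding ad_sum_K[symmetric]
      by (intro ad_sum_cong z xy swap_symmetric_hd[OF Nil(2)]) (simp add: hword_Cons xy)
    have 2: "H (?b x # y # v) = ksig (sdeg (?b x) * sdeg y) (H (y # ?b x # v))"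
      "H (x # ?b y # v) = ksig (sdeg (?b y) * sdeg x) (H (?b y # x # v))"
      by (subst swap_symmetric_hd[OF Nil(2)]; simp add: hword_Cons xy z br_hc mult.commute)+
    show ?case
      unfolding append_Nil ad_sum_Cons 1 2 ksig_K ksig_add
      by (cases "even (fst x)"; cases "even (fst y)"; cases "even (fst z)") (simp_all add: ksig_def sdeg_def)
  next
    case (Cons t u)
    have t: "snd t \<in> hc g (fst t)" "hword g (u @ x # y # v)" using Cons.prems(1) by (auto simp: hword_Cons)
    have 1: "ad_sum g z (\<lambda>v. H (t # v)) (u @ x # y # v) = ksig (sdeg x * sdeg y) (ad_sum g z (\<lambda>v. H (t # v)) (u @ y # x # v))"
      by (intro Cons.IH t swap_symmetric_Cons[OF Cons.prems(2)])
    have 2: "H ((fst z + fst t, br g (snd z) (snd t)) # u @ x # y # v) =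
        ksig (sdeg x * sdeg y) (H ((fst z + fst t, br g (snd z) (snd t)) # u @ y # x # v))"
      using swap_symmetricD[OF Cons.prems(2), of "(fst z + fst t, br g (snd z) (snd t)) # u" x y v] t br_hc[OF z t(1)]
      by (simp add: hword_Cons)
    show ?case unfolding append_Cons ad_sum_Cons 1 2 ksig_add ksig_K by (simp add: add.commute)
  qed
  then show ?thesis by (simp add: swap_symmetric_def)
qed

text \<open>The codifferential descends from words to the symmetric coalgebra. The symmetry of
  \<open>H\<close> settles the terms in which both letters survive; the bracket of the two swapped
  letters is settled by graded antisymmetry, and slot linearity moves the resulting sign out of the
  letter.\<close>

lemma codiff_sum_swap:
  assumes s: "vector_space s" and H: "slot_linear g s H" "swap_symmetric g H"
  shows "swap_symmetric g (codiff_sum g H)"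
proof -
  have "codiff_sum g H (u @ x # y # v) = ksig (sdeg x * sdeg y) (codiff_sum g H (u @ y # x # v))"
    if "hword g (u @ x # y # v)" for u v x y
    using that H
  proof (induction u arbitrary: H)
    case Nil
    have xy: "snd x \<in> hc g (fst x)" "snd y \<in> hc g (fst y)" "hword g v" using Nil by (auto simp: hword_simps)
    let ?d = "\<lambda>x. (fst x + 1, df g (snd x))"
    have 1: "codiff_sum g (\<lambda>v. H (x # y # v)) v = ksig (sdeg x * sdeg y) (codiff_sum g (\<lambda>v. H (y # x # v)) v)"
      unfolding codiff_sum_K[symmetric]
      by (intro codiff_sum_cong xy swap_symmetric_hd[OF Nil(3)]) (simp add: hword_Cons xy)
    have 2: "H (?d x # y # v) = ksig (sdeg (?d x) * sdeg y) (H (y # ?d x # v))"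
      "H (x # ?d y # v) = ksig (sdeg (?d y) * sdeg x) (H (?d y # x # v))"
      by (subst swap_symmetric_hd[OF Nil(3)]; simp add: hword_Cons xy df_hc mult.commute)+
    \<comment> \<open>With \<open>i\<close>, \<open>j\<close> the degrees of \<open>x\<close>,
      \<open>y\<close>, the bracket enters with sign \<open>i\<close> in one order and
      \<open>j\<close> in the other. Together with \<open>i * j + 1\<close> from antisymmetry this
      matches the swap sign \<open>(i - 1) * (j - 1)\<close>.\<close>
    have 3: "H ((fst x + fst y, br g (snd x) (snd y)) # v) =
        ksig (fst x * fst y + 1) (H ((fst y + fst x, br g (snd y) (snd x)) # v))"
      unfolding br_swap[OF xy(1,2)] add.commute[of "fst x" "fst y"]
      by (intro slot_linear_ksig_hd[OF dgla_fd s Nil(2)] br_hc xy)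
    show ?case
      unfolding append_Nil codiff_sum_Cons ad_sum_Cons 1 2 3 ksig_K ksig_add
      by (cases "even (fst x)"; cases "even (fst y)") (simp_all add: ksig_def sdeg_def)
  next
    case (Cons t u)
    have t: "snd t \<in> hc g (fst t)" "hword g (u @ x # y # v)" using Cons.prems(1) by (auto simp: hword_Cons)
    have 1: "codiff_sum g (\<lambda>v. H (t # v)) (u @ x # y # v) = ksig (sdeg x * sdeg y) (codiff_sum g (\<lambda>v. H (t # v)) (u @ y # x # v))"
      by (intro Cons.IH t swap_symmetric_Cons[OF Cons.prems(3)] slot_linear_Cons[OF Cons.prems(2)])
    have 2: "H ((fst t + 1, df g (snd t)) # u @ x # y # v) =
        ksig (sdeg x * sdeg y) (H ((fst t + 1, df g (snd t)) # u @ y # x # v))"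
      using swap_symmetricD[OF Cons.prems(3), of "(fst t + 1, df g (snd t)) # u" x y v] t df_hc[OF t(1)]
      by (simp add: hword_Cons)
    have 3: "ad_sum g t H (u @ x # y # v) = ksig (sdeg x * sdeg y) (ad_sum g t H (u @ y # x # v))"
      by (intro swap_symmetricD[OF ad_sum_swap[OF t(1) Cons.prems(3)]] t)
    show ?case unfolding append_Cons codiff_sum_Cons 1 2 3 ksig_add ksig_K by (simp add: add.commute)
  qed
  then show ?thesis by (simp add: swap_symmetric_def)
qed

section \<open>The Chevalley-Eilenberg differential as an operator on cochains\<close>

context
  fixes M :: "('k, 'm::ab_group_add, 'y) gvect_scheme"
  assumes M: "fd_graded M"
begin

lemma codiff_sum_in:
  assumes "add_subgroup A" "\<And>v. wdeg v = wdeg w + 1 \<Longrightarrow> H v \<in> A"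
  shows "codiff_sum g H w \<in> A"
  unfolding codiff_sum_def using assms
  by (intro sum_list_in) (auto intro!: ksig_in dest: codiff_wdeg)

lemma dCE_coch:
  assumes "\<tau> \<in> coch g M"
  shows "dCE g M \<tau> \<in> coch g M"
  unfolding coch_iff[OF dgla_fd M]
proof (intro conjI allI impI)
  note T = cochD[OF dgla_fd M assms] and s = fd_graded_vs[OF M]
  interpret S: vector_space "scl M" by (rule s)
  note D = dCE_CS[OF s, of g \<tau>]
  show "dCE g M \<tau> w \<in> gsp M" for w
    using add_subgroup_zero[OF add_subgroup_gsp[OF M]] codiff_sum_in[OF add_subgroup_gsp[OF M]] T(1)
    by (simp add: D ksig_in[OF add_subgroup_gsp[OF M]])
  show "dCE g M \<tau> w = 0" if "\<not> hword g w" for w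
    using that by (simp add: D)
  show "slot_linear g (scl M) (dCE g M \<tau>)"
    unfolding slot_linear_def
  proof (intro allI ballI impI)
    fix u v i c x y assume *: "x \<in> hc g i" "y \<in> hc g i" "hword g u" "hword g v"
    have "ksig (wdeg (u @ (i, t) # v) + 1) (codiff_sum g \<tau> (u @ (i, t) # v)) = dCE g M \<tau> (u @ (i, t) # v)"
      if "t \<in> hc g i" for t
      using * that by (simp add: D hword_simps)
    then show "dCE g M \<tau> (u @ (i, scl g c x + y) # v) =
      scl M c (dCE g M \<tau> (u @ (i, x) # v)) + dCE g M \<tau> (u @ (i, y) # v)"
      using slot_linearD[OF slot_linear_ksig[OF dgla_fd s codiff_sum_slot_linear[OF s T(3)], of "\<lambda>n. n + 1"] *]
        hc_add[OF dgla_fd hc_scl[OF dgla_fd *(1)] *(2)] * by simp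
  qed
  show "swap_symmetric g (dCE g M \<tau>)"
    unfolding swap_symmetric_def
  proof (intro allI impI)
    fix u v x y assume w: "hword g (u @ x # y # v)"
    then have w': "hword g (u @ y # x # v)" by (simp add: hword_simps)
    show "dCE g M \<tau> (u @ x # y # v) = ksig (sdeg x * sdeg y) (dCE g M \<tau> (u @ y # x # v))"
      using swap_symmetricD[OF swap_symmetric_ksig[OF codiff_sum_swap[OF s T(3,4)], of "\<lambda>n. n + 1"] w] w w'
      by (simp only: D if_True)
  qed
  obtain N where N: "\<And>w. length w > N \<Longrightarrow> \<tau> w = 0" using T(5) by blast
  \<comment> \<open>A bracket merges two letters, so the codifferential shortens a word by at most
    one and the bound grows by one.\<close>
  have "dCE g M \<tau> w = 0" if "length w > Suc N" for w
  proof -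
    have "\<tau> v = 0" if "(s, v) \<in> set (codiff g w)" for s v
      using length_codiff[OF that] \<open>length w > Suc N\<close> by (intro N) simp
    then have "map (\<lambda>(s, v). ksig s (\<tau> v)) (codiff g w) = map (\<lambda>_. 0) (codiff g w)"
      by (intro map_cong) (auto simp: ksig_0)
    then have "codiff_sum g \<tau> w = 0" unfolding codiff_sum_def by (simp only: sum_list_0)
    then show ?thesis by (simp add: D ksig_0)
  qed
  then show "\<exists>N. \<forall>w. length w > N \<longrightarrow> dCE g M \<tau> w = 0" by blast
qed

lemma dCE_coch_deg:
  assumes "\<tau> \<in> coch_deg g M n"
  shows "dCE g M \<tau> \<in> coch_deg g M (n + 1)"
proof -
  have "codiff_sum g \<tau> w \<in> hc M (n + 1 + wdeg w)" for w
  proof (rule codiff_sum_in[OF add_subgroup_hc[OF M]])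
    fix v :: "'g word" assume "wdeg v = wdeg w + 1"
    then have eq: "n + 1 + wdeg w = n + wdeg v" by simp
    show "\<tau> v \<in> hc M (n + 1 + wdeg w)" using assms unfolding eq coch_deg_def by blast
  qed
  then show ?thesis
    using dCE_coch[OF coch_degD[OF assms]] hc_zero[OF M]
    by (simp add: coch_deg_def dCE_CS[OF fd_graded_vs[OF M]] ksig_in[OF add_subgroup_hc[OF M]])
qed

lemma dCE_add: "dCE g M (\<sigma> + \<tau>) = dCE g M \<sigma> + dCE g M \<tau>"
  using codiff_sum_add[of g \<sigma> \<tau>]
  by (simp add: fun_eq_iff dCE_CS[OF fd_graded_vs[OF M]] ksig_add plus_fun_def)

text \<open>The codifferential never produces the empty word, the only place where a constant is
  nonzero. Hence on generators the total differential consists of the family alone.\<close>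

lemma dCE_cst: "dCE g M (cst m) = 0"
proof
  fix w
  have "map (\<lambda>(s, v). ksig s (cst m v)) (codiff g w) = map (\<lambda>_. 0) (codiff g w)"
    by (intro map_cong) (auto simp: ksig_0 cst_def dest: length_codiff)
  then have "codiff_sum g (cst m) w = 0" unfolding codiff_sum_def by (simp only: sum_list_0)
  then show "dCE g M (cst m) w = 0 w" by (simp add: dCE_CS[OF fd_graded_vs[OF M]] ksig_0)
qed

end

end

section \<open>The module structure of cochains\<close>

lemma cprod_eq:
  "vector_space (scl M) \<Longrightarrow> cprod M \<omega> \<tau> = unsh_sum (\<lambda>u v. ksig (wdeg u * wdeg v) (scl M (\<omega> u) (\<tau> v)))"
  by (rule ext) (rule cprod_US)

lemma cext_eq:
  assumes "vector_space (scl N)"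
  shows "cext e N h \<tau> = unsh_sum (\<lambda>u v. ksig (wdeg u * wdeg v + e * wdeg u) (h (\<tau> u) v))"
  by (rule ext) (simp add: cext_def unsh_sum_def scl_ksgn[OF assms] ksig_K add.assoc)

text \<open>A map \<open>h: M \<rightarrow> C(g, N)\<close> of degree \<open>e\<close>, that is, a locally finite family without the splitting
  into its components in \<open>C\<^sup>k(g, N)\<close>.\<close>

definition cochain_map ::
    "('k::field, 'g::ab_group_add, 'z) gvect_scheme \<Rightarrow> int \<Rightarrow> ('k, 'm::ab_group_add, 'y) gvect_scheme \<Rightarrow>
      ('k, 'n::ab_group_add, 'x) gvect_scheme \<Rightarrow> ('m \<Rightarrow> 'g word \<Rightarrow> 'n) \<Rightarrow> bool"
  where "cochain_map g e M N h \<longleftrightarrow>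
    (\<forall>m\<in>gsp M. h m \<in> coch g N) \<and> additive_on (gsp M) h \<and>
    (\<forall>c. \<forall>m\<in>gsp M. \<forall>w. h (scl M c m) w = scl N c (h m w)) \<and>
    (\<forall>i. \<forall>m\<in>hc M i. h m \<in> coch_deg g N (i + e))"

lemma cochain_mapD:
  assumes "cochain_map g e M N h"
  shows cochain_map_coch: "m \<in> gsp M \<Longrightarrow> h m \<in> coch g N"
    and cochain_map_additive: "additive_on (gsp M) h"
    and cochain_map_apply: "additive_on (gsp M) (\<lambda>m. h m w)"
    and cochain_map_scl: "m \<in> gsp M \<Longrightarrow> h (scl M c m) w = scl N c (h m w)"
    and cochain_map_deg: "m \<in> hc M i \<Longrightarrow> h m \<in> coch_deg g N (i + e)"
  using assms by (simp_all add: cochain_map_def additive_on_def)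

context
  fixes g :: "('k::field, 'g::ab_group_add, 'z) gvect_scheme" and M :: "('k, 'm::ab_group_add, 'y) gvect_scheme"
  assumes g: "fd_graded g" and M: "fd_graded M"
begin

interpretation vector_space "scl M" using M by (rule fd_graded_vs)

section \<open>\<open>C(g, M)\<close> as a graded free module over \<open>C(g)\<close>\<close>

lemma cprod_coch:
  assumes "a \<in> coch g ground" "\<tau> \<in> coch g M"
  shows "cprod M a \<tau> \<in> coch g M"
proof -
  note A = cochD[OF g fd_graded_ground assms(1)] and T = cochD[OF g M assms(2)]
  obtain N N' where N: "\<And>w. length w > N \<Longrightarrow> a w = 0" "\<And>w. length w > N' \<Longrightarrow> \<tau> w = 0" using A(5) T(5) by blast
  show ?thesis
    unfolding cprod_eq[OF fd_graded_vs[OF M]]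
  proof (rule unsh_sum_coch[OF g M, of _ N N' "(*)"])
    show "slot_linear g (scl M) (\<lambda>u. scl M (a u) (\<tau> v))" for v
      using A(3) unfolding slot_linear_def by (simp add: scale_left_distrib scl_ground)
    show "slot_linear g (scl M) (\<lambda>v. scl M (a u) (\<tau> v))" for u
      using T(3) unfolding slot_linear_def by (simp add: scale_right_distrib scale_left_commute)
    show "swap_symmetric g (\<lambda>u. scl M (a u) (\<tau> v))" for v
      unfolding swap_symmetric_def by (metis swap_symmetricD[OF A(4)] scl_ksig(1)[OF fd_graded_vs[OF M]])
    show "swap_symmetric g (\<lambda>v. scl M (a u) (\<tau> v))" for u
      unfolding swap_symmetric_def by (metis swap_symmetricD[OF T(4)] scl_ksig(2)[OF fd_graded_vs[OF M]])
  qed (simp_all add: gsp_scl[OF M] A T N)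
qed

lemma cprod_coch_deg:
  assumes "a \<in> coch_deg g ground p" "\<tau> \<in> coch_deg g M q"
  shows "cprod M a \<tau> \<in> coch_deg g M (p + q)"
proof -
  have "unsh_sum (\<lambda>u v. ksig (wdeg u * wdeg v) (scl M (a u) (\<tau> v))) w \<in> hc M (p + q + wdeg w)" for w
  proof (intro unsh_sum_in add_subgroup_hc M ksig_in)
    fix u v :: "'g word" assume *: "wdeg u + wdeg v = wdeg w"
    show "scl M (a u) (\<tau> v) \<in> hc M (p + q + wdeg w)"
    proof (cases "a u = 0")
      case False
      then have "wdeg u = - p" using assms(1) by (simp add: coch_deg_ground_iff)
      then have eq: "p + q + wdeg w = q + wdeg v" using * by simp
      show ?thesis using assms(2) unfolding eq coch_deg_def by (blast intro: hc_scl[OF M])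
    qed (simp add: hc_zero[OF M])
  qed
  then show ?thesis
    using cprod_coch[OF coch_degD coch_degD, OF assms] by (simp add: coch_deg_def cprod_eq[OF fd_graded_vs[OF M]])
qed

lemma cprod_add_left: "cprod M (a + b) \<tau> = cprod M a \<tau> + cprod M b \<tau>"
  by (simp add: fun_eq_iff cprod_US[OF fd_graded_vs[OF M]] scale_left_distrib ksig_add unsh_sum_add)

lemma cprod_add_right: "cprod M a (\<sigma> + \<tau>) = cprod M a \<sigma> + cprod M a \<tau>"
  by (simp add: fun_eq_iff cprod_US[OF fd_graded_vs[OF M]] scale_right_distrib ksig_add unsh_sum_add)

lemma cprod_assoc: "cprod M (cprod ground a b) \<tau> = cprod M a (cprod M b \<tau>)"
proof
  fix w
  \<comment> \<open>The summand of the threefold product. Its sign consists of all pairwise products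
    of degrees, which is what either bracketing yields.\<close>
  define K where "K p q v = ksig ((wdeg p + wdeg q) * wdeg v + wdeg p * wdeg q) (scl M (a p) (scl M (b q) (\<tau> v)))" for p q v
  note sK = scl_ksig[OF fd_graded_vs[OF M]]
  have 1: "ksig (wdeg u * wdeg v) (scl M (unsh_sum (\<lambda>p q. ksig (wdeg p * wdeg q) (a p * b q)) u) (\<tau> v)) =
      unsh_sum (\<lambda>p q. K p q v) u" for u v
    unfolding unsh_sum_hom[where f = "\<lambda>c. scl M c (\<tau> v)", OF scale_left_distrib, symmetric] unsh_sum_K[symmetric]
    by (intro unsh_sum_cong) (simp add: K_def sK ksig_K)
  have 2: "ksig (wdeg p * wdeg r) (scl M (a p) (unsh_sum (\<lambda>q v. ksig (wdeg q * wdeg v) (scl M (b q) (\<tau> v))) r)) =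
      unsh_sum (\<lambda>q v. K p q v) r" for p r
    unfolding unsh_sum_hom[where f = "scl M (a p)", OF scale_right_distrib, symmetric] unsh_sum_K[symmetric]
    by (intro unsh_sum_cong, drule sym) (simp add: K_def sK ksig_K algebra_simps)
  show "cprod M (cprod ground a b) \<tau> w = cprod M a (cprod M b \<tau>) w"
    unfolding cprod_eq[OF fd_graded_vs[OF M]] cprod_eq[OF vector_space_ground] scl_ground 1 2
    by (rule unsh_sum_coassoc)
qed

text \<open>A form times a generator is the elementary tensor \<open>a \<otimes> m\<close> in its
  description as a function on words.\<close>

lemma cprod_cst: "cprod M a (cst m) = (\<lambda>w. scl M (a w) m)"
proof
  fix w
  have "unsh_sum (\<lambda>u v. ksig (wdeg u * wdeg v) (scl M (a u) (cst m v))) w = scl M (a w) m"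
    by (subst unsh_sum_right_Nil) (simp_all add: cst_def ksig_def wdeg_simps)
  then show "cprod M a (cst m) w = scl M (a w) m" by (simp only: cprod_US[OF fd_graded_vs[OF M]])
qed

lemma cprod_cst_left: "cprod M (cst c) \<tau> = (\<lambda>w. scl M c (\<tau> w))"
proof
  fix w
  have "unsh_sum (\<lambda>u v. ksig (wdeg u * wdeg v) (scl M (cst c u) (\<tau> v))) w = scl M c (\<tau> w)"
    by (subst unsh_sum_left_Nil) (simp_all add: cst_def ksig_def wdeg_simps)
  then show "cprod M (cst c) \<tau> w = scl M c (\<tau> w)" by (simp only: cprod_US[OF fd_graded_vs[OF M]])
qed

text \<open>Generation by the constants \<open>cst (e i)\<close>: the coefficient forms are the
  coordinates of the values of the cochain.\<close>

lemma coch_basis_expansion: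
  assumes B: "homogeneous_basis M n e q r" and t: "\<tau> \<in> coch g M"
  shows "(\<lambda>w. r i (\<tau> w)) \<in> coch g ground" "\<tau> = (\<Sum>i<n. cprod M (\<lambda>w. r i (\<tau> w)) (cst (e i)))"
proof -
  show "(\<lambda>w. r i (\<tau> w)) \<in> coch g ground"
    using B unfolding homogeneous_basis_def
    by (intro coch_compose[OF g M fd_graded_ground _ _ _ t]) (simp_all add: gsp_ground scl_ground)
  have "\<tau> w = (\<Sum>i<n. cprod M (\<lambda>w. r i (\<tau> w)) (cst (e i))) w" for w
    unfolding sum_fun_apply cprod_cst
    using B coch_gsp[OF g M t, of w] unfolding homogeneous_basis_def by blast
  then show "\<tau> = (\<Sum>i<n. cprod M (\<lambda>w. r i (\<tau> w)) (cst (e i)))" by (rule ext)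
qed

text \<open>Induction over generators. Both factors may be taken homogeneous, which is the only case
  covered by hypotheses that mention degrees: expand in a homogeneous basis, then split each
  coefficient form by degree.\<close>

lemma coch_generated:
  assumes t: "\<tau> \<in> coch g M" and zero: "P 0"
    and add: "\<And>\<sigma> \<tau>. \<sigma> \<in> coch g M \<Longrightarrow> \<tau> \<in> coch g M \<Longrightarrow> P \<sigma> \<Longrightarrow> P \<tau> \<Longrightarrow> P (\<sigma> + \<tau>)"
    and gen: "\<And>a p m q. a \<in> coch_deg g ground p \<Longrightarrow> m \<in> hc M q \<Longrightarrow> P (cprod M a (cst m))"
  shows "P \<tau>"
proof -
  \<comment> \<open>Membership is carried along with \<open>P\<close> because the additivity premise
    asks for it.\<close>
  have sum: "sum f I \<in> coch g M \<and> P (sum f I)" if "\<And>i. i \<in> I \<Longrightarrow> f i \<in> coch g M \<and> P (f i)" for f and I :: "'i set"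
    using that
    by (induction I rule: infinite_finite_induct)
      (auto simp: zero add_subgroup_zero[OF add_subgroup_coch[OF g M]] add add_subgroup_add[OF add_subgroup_coch[OF g M]])
  obtain n e q r where B: "homogeneous_basis M n e q r" using M by (rule homogeneous_basis_exists)
  note E = coch_basis_expansion[OF B t]
  have "cprod M (\<lambda>w. r i (\<tau> w)) (cst (e i)) \<in> coch g M \<and> P (cprod M (\<lambda>w. r i (\<tau> w)) (cst (e i)))" if "i < n" for i
  proof -
    have e: "e i \<in> hc M (q i)" using B that by (simp add: homogeneous_basis_def)
    obtain K where K: "(\<lambda>w. r i (\<tau> w)) = (\<Sum>p\<in>{- K..K}. form_part p (\<lambda>w. r i (\<tau> w)))"
      using coch_ground_decompose[OF g E(1)] .
    have "cprod M (\<lambda>w. r i (\<tau> w)) (cst (e i)) = (\<Sum>p\<in>{- K..K}. cprod M (form_part p (\<lambda>w. r i (\<tau> w))) (cst (e i)))"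
      by (subst K, rule additive_on_sum[OF add_subgroup_UNIV, where f = "\<lambda>a. cprod M a (cst (e i))"])
        (simp_all add: additive_on_def cprod_add_left)
    moreover have "cprod M (form_part p (\<lambda>w. r i (\<tau> w))) (cst (e i)) \<in> coch g M \<and>
        P (cprod M (form_part p (\<lambda>w. r i (\<tau> w))) (cst (e i)))" for p
      using form_part_coch_deg[OF g E(1)] cst_coch(1)[OF g M in_dsum[of _ "hc M", OF e]] e
      by (blast intro: gen cprod_coch coch_degD)
    ultimately show ?thesis using sum by (metis (no_types, lifting))
  qed
  then show ?thesis using sum[of "{..<n}"] E(2) by (metis (no_types, lifting) lessThan_iff)
qed

text \<open>Sections of \<open>cbundle\<close> are finite sums of homogeneous ones; the content is
  that an arbitrary cochain has only finitely many homogeneous components.\<close>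

lemma dsum_coch_deg: "dsum (coch_deg g M) = coch g M"
proof
  show "dsum (coch_deg g M) \<subseteq> coch g M"
    using dsum_in[OF add_subgroup_coch[OF g M], of "coch_deg g M"] coch_degD by blast
  have S: "add_subgroup (dsum (coch_deg g M))"
    by (intro add_subgroup_dsum add_subgroup_coch_deg[OF g M])
  show "coch g M \<subseteq> dsum (coch_deg g M)"
  proof
    fix \<tau> assume "\<tau> \<in> coch g M"
    then show "\<tau> \<in> dsum (coch_deg g M)"
    proof (rule coch_generated)
      show "cprod M a (cst m) \<in> dsum (coch_deg g M)" if "a \<in> coch_deg g ground p" "m \<in> hc M q" for a p m q
        using cprod_coch_deg[OF that(1) cst_coch(2)[OF g M that(2)]] by (rule in_dsum)
    qed (rule add_subgroup_zero[OF S] add_subgroup_add[OF S]; assumption)+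
  qed
qed

lemma direct_coch_deg: "direct (coch_deg g M)"
  unfolding direct_def
proof (intro allI impI ballI)
  fix I :: "int set" and x :: "int \<Rightarrow> 'g word \<Rightarrow> 'm" and i
  assume *: "finite I \<and> (\<forall>i\<in>I. x i \<in> coch_deg g M i) \<and> (\<Sum>i\<in>I. x i) = 0" and i: "i \<in> I"
  show "x i = 0"
  proof
    fix w
    \<comment> \<open>At a fixed word \<open>w\<close> the cochain of degree \<open>i\<close> takes
      a value of degree \<open>i + wdeg w\<close>. After this reindexing the values lie in distinct
      components of \<open>M\<close>, where directness is known.\<close>
    let ?y = "\<lambda>j. x (j - wdeg w) w"
    have inj: "inj_on (\<lambda>i. i + wdeg w) I" by (simp add: inj_on_def)
    have "(\<Sum>j\<in>(\<lambda>i. i + wdeg w) ` I. ?y j) = (\<Sum>i\<in>I. x i) w"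
      unfolding sum.reindex[OF inj] sum_fun_apply by simp
    then have "(\<Sum>j\<in>(\<lambda>i. i + wdeg w) ` I. ?y j) = 0" using * by simp
    moreover have "?y j \<in> hc M j" if "j \<in> (\<lambda>i. i + wdeg w) ` I" for j
      using * that by (auto simp: coch_deg_def)
    ultimately have "?y (i + wdeg w) = 0"
      using fd_graded_direct[OF M, unfolded direct_def, rule_format, of "(\<lambda>i. i + wdeg w) ` I" ?y "i + wdeg w"] * i
      by blast
    then show "x i w = 0 w" by simp
  qed
qed

section \<open>Linear extension of a cochain map\<close>

context
  fixes N :: "('k, 'n::ab_group_add, 'x) gvect_scheme" and e h
  assumes N: "fd_graded N" and h: "cochain_map g e M N h"
begin

interpretation N: vector_space "scl N" using N by (rule fd_graded_vs)

text \<open>\<open>cext\<close> applies \<open>h\<close> to all values of a cochain at once, so the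
  bounds for single elements must be made uniform; finitely many basis elements of \<open>M\<close>
  allow this.\<close>

lemma cochain_map_bound: "\<exists>K. \<forall>m\<in>gsp M. \<forall>w. length w > K \<longrightarrow> h m w = 0"
proof -
  obtain n b q r where B: "homogeneous_basis M n b q r" using M by (rule homogeneous_basis_exists)
  have b: "b i \<in> gsp M" if "i < n" for i
    using B that by (auto simp: homogeneous_basis_def intro: in_dsum)
  have "\<exists>K. \<forall>w. length w > K \<longrightarrow> h (b i) w = 0" if "i < n" for i
    by (rule coch_bound[OF g N cochain_map_coch[OF h b[OF that]]])
  then obtain K where K: "\<And>i w. i < n \<Longrightarrow> length w > K i \<Longrightarrow> h (b i) w = 0" by metis
  \<comment> \<open>For \<open>n = 0\<close> the maximum of the empty set is unspecified, but then
    the expansion of \<open>m\<close> is empty as well.\<close>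
  have "h m w = 0" if m: "m \<in> gsp M" and w: "length w > Max (K ` {..<n})" for m w
  proof -
    have "h m w = h (\<Sum>i<n. scl M (r i m) (b i)) w"
      using B m unfolding homogeneous_basis_def by metis
    also have "\<dots> = (\<Sum>i<n. h (scl M (r i m) (b i)) w)"
      by (intro additive_on_sum[OF add_subgroup_gsp[OF M] cochain_map_apply[OF h]] gsp_scl[OF M] b) simp
    also have "\<dots> = 0"
    proof (intro sum.neutral ballI)
      fix i assume i: "i \<in> {..<n}"
      then have "K i \<le> Max (K ` {..<n})" by simp
      then show "h (scl M (r i m) (b i)) w = 0"
        using i w K[of i w] by (simp add: cochain_map_scl[OF h b])
    qed
    finally show ?thesis .
  qed
  then show ?thesis by blast
qed

lemma cext_coch:
  assumes "\<tau> \<in> coch g M"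
  shows "cext e N h \<tau> \<in> coch g N"
proof -
  note T = cochD[OF g M assms]
  note H = cochD[OF g N cochain_map_coch[OF h T(1)]]
  have h0: "h 0 = 0" by (rule additive_on_zero[OF add_subgroup_gsp[OF M] cochain_map_additive[OF h]])
  obtain L where L: "\<And>w. length w > L \<Longrightarrow> \<tau> w = 0" using T(5) by blast
  obtain K where K: "\<And>m w. m \<in> gsp M \<Longrightarrow> length w > K \<Longrightarrow> h m w = 0" using cochain_map_bound by blast
  show ?thesis
    unfolding cext_eq[OF fd_graded_vs[OF N]]
  proof (rule unsh_sum_coch[OF g N, of _ L K "\<lambda>m n. m * n + e * m"])
    show "slot_linear g (scl N) (\<lambda>u. h (\<tau> u) v)" for v
      unfolding slot_linear_def
    proof (intro allI ballI impI)
      fix u u' i c x y assume *: "x \<in> hc g i" "y \<in> hc g i" "hword g u" "hword g u'"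
      show "h (\<tau> (u @ (i, scl g c x + y) # u')) v =
        scl N c (h (\<tau> (u @ (i, x) # u')) v) + h (\<tau> (u @ (i, y) # u')) v"
        using cochain_map_additive[OF h] gsp_scl[OF M T(1)] T(1)
        by (simp add: slot_linearD[OF T(3) *] additive_on_def cochain_map_scl[OF h])
    qed
    show "swap_symmetric g (\<lambda>u. h (\<tau> u) v)" for v
      unfolding swap_symmetric_def
      by (metis swap_symmetricD[OF T(4)] additive_on_ksig[OF add_subgroup_gsp[OF M] cochain_map_apply[OF h] T(1)])
  qed (simp_all add: H T(2) L K T(1) h0)
qed

lemma cext_coch_deg:
  assumes "\<tau> \<in> coch_deg g M n"
  shows "cext e N h \<tau> \<in> coch_deg g N (n + e)"
proof -
  have "unsh_sum (\<lambda>u v. ksig (wdeg u * wdeg v + e * wdeg u) (h (\<tau> u) v)) w \<in> hc N (n + e + wdeg w)" for w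
  proof (intro unsh_sum_in add_subgroup_hc N ksig_in)
    fix u v :: "'g word" assume *: "wdeg u + wdeg v = wdeg w"
    have eq: "n + e + wdeg w = n + wdeg u + e + wdeg v" using * by simp
    have "\<tau> u \<in> hc M (n + wdeg u)" using assms by (simp add: coch_deg_def)
    then show "h (\<tau> u) v \<in> hc N (n + e + wdeg w)"
      unfolding eq using cochain_map_deg[OF h] by (simp add: coch_deg_def)
  qed
  then show ?thesis
    using cext_coch[OF coch_degD[OF assms]] by (simp add: coch_deg_def cext_eq[OF fd_graded_vs[OF N]])
qed

lemma cext_add:
  assumes "\<sigma> \<in> coch g M" "\<tau> \<in> coch g M"
  shows "cext e N h (\<sigma> + \<tau>) = cext e N h \<sigma> + cext e N h \<tau>"
  using cochain_map_apply[OF h] coch_gsp[OF g M assms(1)] coch_gsp[OF g M assms(2)]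
  by (simp add: fun_eq_iff cext_eq[OF fd_graded_vs[OF N]] additive_on_def ksig_add unsh_sum_add)

lemma cext_cst:
  assumes "m \<in> gsp M"
  shows "cext e N h (cst m) = h m"
proof
  fix w
  have "h 0 = 0" by (rule additive_on_zero[OF add_subgroup_gsp[OF M] cochain_map_additive[OF h]])
  then have "unsh_sum (\<lambda>u v. ksig (wdeg u * wdeg v + e * wdeg u) (h (cst m u) v)) w = h m w"
    by (subst unsh_sum_left_Nil) (simp_all add: cst_def ksig_def wdeg_simps)
  then show "cext e N h (cst m) w = h m w" by (simp only: cext_eq[OF fd_graded_vs[OF N]])
qed

text \<open>A map of degree \<open>e\<close> passes a form \<open>a\<close> at the cost of the sign
  of \<open>e * |a|\<close>, written pointwise so that \<open>a\<close> may be inhomogeneous. The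
  equation is coassociativity applied to the two ways of splitting off \<open>a\<close>.\<close>

lemma cext_cprod:
  assumes t: "\<tau> \<in> coch g M"
  shows "cext e N h (cprod M a \<tau>) = cprod N (\<lambda>w. ksig (e * wdeg w) (a w)) (cext e N h \<tau>)"
proof
  fix w
  \<comment> \<open>The pairwise degree products, as for associativity, together with the sign for
    moving \<open>h\<close> past the forms evaluated at \<open>p\<close> and
    \<open>q\<close>.\<close>
  define K where "K p q v =
    ksig ((wdeg p + wdeg q) * wdeg v + e * (wdeg p + wdeg q) + wdeg p * wdeg q) (scl N (a p) (h (\<tau> q) v))" for p q v
  note sK = scl_ksig[OF fd_graded_vs[OF N]] and A = add_subgroup_gsp[OF M] and T = coch_gsp[OF g M t]
  have in': "scl M c (\<tau> q) \<in> gsp M" for c q by (intro gsp_scl M T)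
  have 1: "ksig (wdeg u * wdeg v + e * wdeg u) (h (unsh_sum (\<lambda>p q. ksig (wdeg p * wdeg q) (scl M (a p) (\<tau> q))) u) v) =
      unsh_sum (\<lambda>p q. K p q v) u" for u v
    unfolding unsh_sum_hom_on[OF A cochain_map_apply[OF h] ksig_in[OF A in']]
      additive_on_ksig[OF A cochain_map_apply[OF h] in'] cochain_map_scl[OF h T] unsh_sum_K[symmetric]
    by (intro unsh_sum_cong) (simp add: K_def ksig_K)
  have 2: "ksig (wdeg p * wdeg r) (scl N (ksig (e * wdeg p) (a p))
        (unsh_sum (\<lambda>q v. ksig (wdeg q * wdeg v + e * wdeg q) (h (\<tau> q) v)) r)) =
      unsh_sum (\<lambda>q v. K p q v) r" for p r
    unfolding unsh_sum_hom[where f = "scl N (ksig (e * wdeg p) (a p))", OF N.scale_right_distrib, symmetric] unsh_sum_K[symmetric]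
    by (intro unsh_sum_cong, drule sym) (simp add: K_def sK ksig_K algebra_simps)
  show "cext e N h (cprod M a \<tau>) w = cprod N (\<lambda>w. ksig (e * wdeg w) (a w)) (cext e N h \<tau>) w"
    unfolding cext_eq[OF fd_graded_vs[OF N]] cprod_eq[OF fd_graded_vs[OF M]] cprod_eq[OF fd_graded_vs[OF N]] 1 2
    by (rule unsh_sum_coassoc)
qed

end

end

section \<open>Families of cochain maps and their extensions\<close>

lemma cst_add: "cst (m + m') = cst m + (cst m' :: 'g word \<Rightarrow> 'm::monoid_add)"
  by (simp add: cst_def fun_eq_iff)

lemma cst_scl_ground: "cst c \<in> coch_deg g (ground :: ('k::field, 'k) gvect) 0" if "fd_graded g"
  by (intro cst_coch(2)[OF that fd_graded_ground]) (simp add: hc_ground)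

context
  fixes g :: "('k::field, 'g::ab_group_add, 'z) gvect_scheme"
  assumes g: "fd_graded g"
begin

lemma graded_pieces_coch_p:
  assumes M: "fd_graded M" and t: "\<tau> \<in> coch g M"
  shows "(\<lambda>w. if length w = k then \<tau> w else 0) \<in> coch_p g M k"
proof -
  note T = cochD[OF g M t]
  interpret vector_space "scl M" using M by (rule fd_graded_vs)
  have "(\<lambda>w. if length w = k then \<tau> w else 0) \<in> coch g M"
    unfolding coch_iff[OF g M]
  proof (intro conjI allI impI)
    show "swap_symmetric g (\<lambda>w. if length w = k then \<tau> w else 0)"
      unfolding swap_symmetric_def
    proof (intro allI impI)
      fix u v x y assume "hword g (u @ x # y # v)"
      then show "(if length (u @ x # y # v) = k then \<tau> (u @ x # y # v) else 0) =
        ksig (sdeg x * sdeg y) (if length (u @ y # x # v) = k then \<tau> (u @ y # x # v) else 0)"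
        using swap_symmetricD[OF T(4), of u x y v] by (simp add: ksig_0)
    qed
  qed (use T in \<open>auto simp: slot_linear_def add_subgroup_zero[OF add_subgroup_gsp[OF M]]\<close>)
  then show ?thesis by (simp add: coch_p_iff)
qed

context
  fixes M :: "('k, 'm::ab_group_add) gvect" and N :: "('k, 'n::ab_group_add) gvect"
  assumes M: "fd_graded M" and N: "fd_graded N"
begin

interpretation N: vector_space "scl N" using N by (rule fd_graded_vs)

text \<open>The component of index \<open>k\<close> lives on words of length \<open>k\<close>, so
  one summand contributes. Local finiteness makes the index set finite, whereas a \<open>sum\<close>
  over an infinite set would be 0.\<close>

lemma fam_sum_apply:
  assumes f: "coch_family g e M N f" and m: "m \<in> gsp M"
  shows "fam_sum f m w = f (length w) m w"
proof -
  obtain n where n: "\<forall>k\<ge>n. f k m = 0" using f m unfolding coch_family_def by blast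
  then have "{k. f k m \<noteq> 0} \<subseteq> {..<n}" by (auto simp: not_less[symmetric])
  then have fin: "finite {k. f k m \<noteq> 0}" by (rule finite_subset) simp
  have "f k m \<in> coch_p g N k" for k using f m unfolding coch_family_def by blast
  then have z: "f k m w = 0" if "k \<noteq> length w" for k using that by (simp add: coch_p_iff)
  have "fam_sum f m w = (\<Sum>k\<in>{k. f k m \<noteq> 0}. if k = length w then f (length w) m w else 0)"
    unfolding fam_sum_def sum_fun_apply by (intro sum.cong) (auto simp: z)
  also have "\<dots> = f (length w) m w" using fin by (simp add: sum.delta)
  finally show ?thesis .
qed

lemma cochain_map_fam_sum:
  assumes f: "coch_family g e M N f"
  shows "cochain_map g e M N (fam_sum f)"
proof -
  have fp: "f k m \<in> coch g N" if "m \<in> gsp M" for k m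
    using f that unfolding coch_family_def by (meson PiE_mem coch_p_iff)
  have lin: "f k (x + y) = f k x + f k y" "f k (scl M c x) = (\<lambda>w. scl N c (f k x w))"
    if "x \<in> gsp M" "y \<in> gsp M" for k x y c
    using f that unfolding coch_family_def lin_on_def by blast+
  have deg: "f k m \<in> coch_deg g N (i + e)" if "m \<in> hc M i" for k m i
    using f that unfolding coch_family_def by blast
  show ?thesis
    unfolding cochain_map_def
  proof (intro conjI ballI allI)
    show "fam_sum f m \<in> coch g N" if "m \<in> gsp M" for m
      unfolding fam_sum_def by (intro sum_in add_subgroup_coch[OF g N] fp that)
    show "additive_on (gsp M) (fam_sum f)"
      unfolding additive_on_def
      by (intro ballI ext) (simp add: fam_sum_apply[OF f] add_subgroup_add[OF add_subgroup_gsp[OF M]] lin)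
    show "fam_sum f (scl M c m) w = scl N c (fam_sum f m w)" if "m \<in> gsp M" for c m w
      using that by (simp add: fam_sum_apply[OF f] gsp_scl[OF M] lin)
    show "fam_sum f m \<in> coch_deg g N (i + e)" if "m \<in> hc M i" for i m
      unfolding fam_sum_def by (intro sum_in add_subgroup_coch_deg[OF g N] deg that)
  qed
qed

text \<open>Restricted to the underlying space because \<open>coch_family\<close> asks for
  extensional maps, which lets a family be equal to another rather than just agree with it on
  \<open>M\<close>.\<close>

definition components :: "('m \<Rightarrow> 'g word \<Rightarrow> 'n) \<Rightarrow> nat \<Rightarrow> 'm \<Rightarrow> 'g word \<Rightarrow> 'n"
  where "components h k = restrict (\<lambda>m w. if length w = k then h m w else 0) (gsp M)"

text \<open>Local finiteness comes from the length bound of the single cochain \<open>h m\<close>: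
  components beyond that length vanish.\<close>

lemma coch_family_components:
  assumes h: "cochain_map g e M N h"
  shows "coch_family g e M N (components h)"
  unfolding coch_family_def
proof (intro conjI allI ballI)
  have c: "components h k m \<in> coch_p g N k" if "m \<in> gsp M" for k m
    using graded_pieces_coch_p[OF N cochain_map_coch[OF h that]] that by (simp add: components_def)
  show "components h k \<in> gsp M \<rightarrow>\<^sub>E coch_p g N k" for k
    by (rule PiE_I) (simp add: c, simp add: components_def)
  show "lin_on M (\<lambda>c \<tau> w. scl N c (\<tau> w)) (components h k)" for k
    using cochain_map_additive[OF h] cochain_map_scl[OF h]
    by (auto simp: lin_on_def components_def additive_on_def fun_eq_iff gsp_scl[OF M]
        add_subgroup_add[OF add_subgroup_gsp[OF M]])
  show "components h k m \<in> coch_deg g N (i + e)" if "m \<in> hc M i" for k i m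
  proof -
    have m: "m \<in> gsp M" using that by (rule in_dsum)
    have "components h k m \<in> coch g N" using c[OF m] by (simp add: coch_p_iff)
    then show ?thesis
      using cochain_map_deg[OF h that] hc_zero[OF N] m by (simp add: coch_deg_def components_def)
  qed
  show "\<exists>n. \<forall>k\<ge>n. components h k m = 0" if m: "m \<in> gsp M" for m
  proof -
    obtain n where "\<forall>w. length w > n \<longrightarrow> h m w = 0" using coch_bound[OF g N cochain_map_coch[OF h m]] by blast
    then show ?thesis
      using m by (intro exI[of _ "Suc n"]) (auto simp: components_def fun_eq_iff)
  qed
qed

lemma fam_sum_components:
  assumes h: "cochain_map g e M N h" and m: "m \<in> gsp M"
  shows "fam_sum (components h) m = h m"
  using m by (simp add: fun_eq_iff fam_sum_apply[OF coch_family_components[OF h] m]) (simp add: components_def)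

text \<open>The sum determines the family, since its value at \<open>w\<close> is that of the
  component of index \<open>length w\<close>; off the underlying space both families are
  extensional.\<close>

lemma coch_family_eqI:
  assumes f: "coch_family g e M N f" "coch_family g e M N f'"
    and eq: "\<And>m. m \<in> gsp M \<Longrightarrow> fam_sum f m = fam_sum f' m"
  shows "f = f'"
proof (intro ext)
  fix k m w
  show "f k m w = f' k m w"
  proof (cases "m \<in> gsp M")
    case True
    have "f k m \<in> coch_p g N k" "f' k m \<in> coch_p g N k" using f True unfolding coch_family_def by blast+
    then show ?thesis
      using eq[OF True] fam_sum_apply[OF f(1) True, of w] fam_sum_apply[OF f(2) True, of w]
      by (cases "length w = k") (auto simp: coch_p_iff)
  next
    case False
    have "f k \<in> extensional (gsp M)" "f' k \<in> extensional (gsp M)"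
      using f unfolding coch_family_def PiE_def by blast+
    then show ?thesis using False by (simp add: extensional_def)
  qed
qed

lemma cext_cong:
  assumes "\<tau> \<in> coch g M" "\<And>m. m \<in> gsp M \<Longrightarrow> h m = h' m"
  shows "cext e N h \<tau> = cext e N h' \<tau>"
proof -
  have "h (\<tau> u) = h' (\<tau> u)" for u by (rule assms(2)[OF coch_gsp[OF g M assms(1)]])
  then show ?thesis by (simp add: cext_def fun_eq_iff)
qed

text \<open>\<open>T\<close> and the extension of its restriction to \<open>M\<close> are additive,
  obey the same signed linearity and agree on constants, so they agree on generated elements. It is
  applied with \<open>e = 0\<close> to bundle morphisms and with \<open>e = 1\<close> to differences
  of differentials.\<close>

lemma operator_is_cext:
  assumes add: "additive_on (coch g M) T"
    and deg: "\<And>n \<tau>. \<tau> \<in> coch_deg g M n \<Longrightarrow> T \<tau> \<in> coch_deg g N (n + e)"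
    and lin: "\<And>p a \<tau>. a \<in> coch_deg g ground p \<Longrightarrow> \<tau> \<in> coch g M \<Longrightarrow>
      T (cprod M a \<tau>) = cprod N (\<lambda>w. ksgn (e * p) * a w) (T \<tau>)"
  shows "cochain_map g e M N (\<lambda>m. T (cst m))"
    and "\<tau> \<in> coch g M \<Longrightarrow> cext e N (\<lambda>m. T (cst m)) \<tau> = T \<tau>"
proof -
  note S = add_subgroup_coch[OF g M] and SN = add_subgroup_coch[OF g N]
  have T0: "T 0 = 0" by (rule additive_on_zero[OF S add])
  \<comment> \<open>The degree premise places images of homogeneous cochains; generation extends
    this to arbitrary ones.\<close>
  have coch: "T \<tau> \<in> coch g N" if "\<tau> \<in> coch g M" for \<tau>
    using that
  proof (rule coch_generated[OF g M])
    show "T 0 \<in> coch g N" unfolding T0 by (rule add_subgroup_zero[OF SN])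
    show "T (\<sigma> + \<tau>) \<in> coch g N" if "\<sigma> \<in> coch g M" "\<tau> \<in> coch g M" "T \<sigma> \<in> coch g N" "T \<tau> \<in> coch g N" for \<sigma> \<tau>
      using add that add_subgroup_add[OF SN] unfolding additive_on_def by metis
    show "T (cprod M a (cst m)) \<in> coch g N" if "a \<in> coch_deg g ground p" "m \<in> hc M q" for a p m q
      by (rule coch_degD[OF deg[OF cprod_coch_deg[OF g M that(1) cst_coch(2)[OF g M that(2)]]]])
  qed
  show h: "cochain_map g e M N (\<lambda>m. T (cst m))"
    unfolding cochain_map_def
  proof (intro conjI ballI allI)
    show "T (cst m) \<in> coch g N" if "m \<in> gsp M" for m by (intro coch cst_coch g M that)
    show "additive_on (gsp M) (\<lambda>m. T (cst m))"
      using add cst_coch(1)[OF g M] by (simp add: additive_on_def cst_add)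
    show "T (cst m) \<in> coch_deg g N (i + e)" if "m \<in> hc M i" for m i by (intro deg cst_coch g M that)
    show "T (cst (scl M c m)) w = scl N c (T (cst m) w)" if "m \<in> gsp M" for c m w
    proof -
      interpret M: vector_space "scl M" using M by (rule fd_graded_vs)
      \<comment> \<open>Scalars are forms of degree 0, so linearity over the field is the case
        \<open>p = 0\<close> of linearity over \<open>C(g)\<close>, with trivial sign.\<close>
      have "(cst (scl M c m) :: 'g word \<Rightarrow> 'm) = cprod M (cst c) (cst m)"
        by (simp add: cprod_cst_left[OF g M] fun_eq_iff cst_def)
      then have "T (cst (scl M c m)) = cprod N (\<lambda>w. ksgn (e * 0) * cst c w) (T (cst m))"
        using lin[OF cst_scl_ground[OF g] cst_coch(1)[OF g M that]] by simp
      then show ?thesis by (simp add: ksgn_def cprod_cst_left[OF g N])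
    qed
  qed
  show "cext e N (\<lambda>m. T (cst m)) \<tau> = T \<tau>" if "\<tau> \<in> coch g M"
    using that
  proof (rule coch_generated[OF g M])
    show "cext e N (\<lambda>m. T (cst m)) 0 = T 0"
      unfolding T0 using cext_add[OF g M N h] by (intro additive_on_zero[OF S]) (simp add: additive_on_def)
    show "cext e N (\<lambda>m. T (cst m)) (\<sigma> + \<tau>) = T (\<sigma> + \<tau>)"
      if "\<sigma> \<in> coch g M" "\<tau> \<in> coch g M" "cext e N (\<lambda>m. T (cst m)) \<sigma> = T \<sigma>" "cext e N (\<lambda>m. T (cst m)) \<tau> = T \<tau>" for \<sigma> \<tau>
      using cext_add[OF g M N h that(1,2)] add that unfolding additive_on_def by metis
    show "cext e N (\<lambda>m. T (cst m)) (cprod M a (cst m)) = T (cprod M a (cst m))"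
      if "a \<in> coch_deg g ground p" "m \<in> hc M q" for a p m q
    proof -
      have m: "m \<in> gsp M" using that(2) by (rule in_dsum)
      have "cext e N (\<lambda>m. T (cst m)) (cprod M a (cst m)) = cprod N (\<lambda>w. ksig (e * wdeg w) (a w)) (T (cst m))"
        by (simp add: cext_cprod[OF g M N h cst_coch(1)[OF g M m]] cext_cst[OF g M N h m])
      also have "\<dots> = T (cprod M a (cst m))"
        unfolding lin[OF that(1) cst_coch(1)[OF g M m]] ksgn_degree[OF that(1)] ..
      finally show ?thesis .
    qed
  qed
qed

end

end


section \<open>Modules over the Chevalley-Eilenberg algebra and dg bundles\<close>

lemma cbundle_simps:
  "hsec (cbundle g M D) = coch_deg g M" "bact (cbundle g M D) = cprod M" "bdiff (cbundle g M D) = D"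
  by (simp_all add: cbundle_def)

context
  fixes g :: "('k::field_char_0, 'g::ab_group_add) dgla" and M :: "('k, 'm::ab_group_add) gvect"
  assumes g: "fd_graded g" and M: "fd_graded M"
begin

interpretation vector_space "scl M" using M by (rule fd_graded_vs)

lemma graded_module_cbundle: "graded_module g (cbundle g M D)"
  unfolding graded_module_def cbundle_simps dsum_coch_deg[OF g M]
proof (intro conjI allI ballI)
  note S = add_subgroup_coch_deg[OF g M]
  show "0 \<in> coch_deg g M q" for q by (rule add_subgroup_zero[OF S])
  show "x + y \<in> coch_deg g M q" "- x \<in> coch_deg g M q" if "x \<in> coch_deg g M q" "y \<in> coch_deg g M q" for x y q
    using that by (rule add_subgroup_add[OF S], intro add_subgroup_minus[OF S])
  show "direct (coch_deg g M)" by (rule direct_coch_deg[OF g M])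
  show "cprod M a x \<in> coch_deg g M (p + q)" if "a \<in> coch_deg g ground p" "x \<in> coch_deg g M q" for a x p q
    by (rule cprod_coch_deg[OF g M that])
  show "cprod M (a + b) x = cprod M a x + cprod M b x" for a b x by (rule cprod_add_left[OF g M])
  show "cprod M a (x + y) = cprod M a x + cprod M a y" for a x y by (rule cprod_add_right[OF g M])
  show "cprod M (cprod ground a b) x = cprod M a (cprod M b x)" for a b x by (rule cprod_assoc[OF g M])
  show "cprod M cunit x = x" for x by (simp add: cunit_cst cprod_cst_left[OF g M])
qed

lemma fg_free_cbundle: "fg_free g (cbundle g M D)"
proof -
  obtain n e q r where B: "homogeneous_basis M n e q r" using M by (rule homogeneous_basis_exists)
  have e: "e i \<in> hc M (q i)" if "i < n" for i using B that by (simp add: homogeneous_basis_def)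
  have "\<exists>!c. c \<in> {..<n} \<rightarrow>\<^sub>E coch g ground \<and> x = (\<Sum>i<n. cprod M (c i) (cst (e i)))" if x: "x \<in> coch g M" for x
  proof (rule ex1I)
    let ?c = "restrict (\<lambda>i w. r i (x w)) {..<n}"
    show "?c \<in> {..<n} \<rightarrow>\<^sub>E coch g ground \<and> x = (\<Sum>i<n. cprod M (?c i) (cst (e i)))"
    proof
      show "?c \<in> {..<n} \<rightarrow>\<^sub>E coch g ground"
        by (rule PiE_I) (simp_all add: coch_basis_expansion(1)[OF g M B x])
      have "(\<Sum>i<n. cprod M (?c i) (cst (e i))) = (\<Sum>i<n. cprod M (\<lambda>w. r i (x w)) (cst (e i)))"
        by (intro sum.cong) simp_all
      then show "x = (\<Sum>i<n. cprod M (?c i) (cst (e i)))"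
        using coch_basis_expansion(2)[OF g M B x] by (rule trans[OF _ sym, rotated])
    qed
    fix c assume c: "c \<in> {..<n} \<rightarrow>\<^sub>E coch g ground \<and> x = (\<Sum>i<n. cprod M (c i) (cst (e i)))"
    \<comment> \<open>Uniqueness of coefficients: the dual functional \<open>r i\<close>, applied to
      the value of the expansion at \<open>w\<close>, isolates \<open>c i w\<close>.\<close>
    have "c i w = r i (x w)" if i: "i < n" for i w
    proof -
      have r: "additive_on (gsp M) (r i)" "\<And>c x. x \<in> gsp M \<Longrightarrow> r i (scl M c x) = c * r i x"
        "\<And>j. j < n \<Longrightarrow> r i (e j) = (if i = j then 1 else 0)"
        using B i unfolding homogeneous_basis_def by blast+
      have eg: "e j \<in> gsp M" if "j < n" for j using e[OF that] by (rule in_dsum)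
      have "r i (x w) = r i (\<Sum>j<n. scl M (c j w) (e j))"
        using c by (simp add: sum_fun_apply cprod_cst[OF g M])
      also have "\<dots> = (\<Sum>j<n. r i (scl M (c j w) (e j)))"
        by (intro additive_on_sum[OF add_subgroup_gsp[OF M] r(1)] gsp_scl[OF M] eg) simp
      also have "\<dots> = (\<Sum>j<n. if j = i then c i w else 0)"
        by (intro sum.cong refl) (auto simp: r eg)
      also have "\<dots> = c i w" using i by simp
      finally show ?thesis ..
    qed
    then show "c = ?c"
      using c by (intro extensionalityI[of _ "{..<n}"]) (auto simp: PiE_def)
  qed
  then show ?thesis
    unfolding fg_free_def cbundle_simps dsum_coch_deg[OF g M]
    using cst_coch(2)[OF g M e] by (intro exI[of _ n] exI[of _ "\<lambda>i. cst (e i)"]) blast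
qed

end

section \<open>Infinity-modules as dg bundles\<close>

lemma tot_bundle_eq: "tot_bundle g (M, \<delta>) = cbundle g M (restrict (dtot g M \<delta>) (coch g M))"
  by (simp add: tot_bundle_def)

context
  fixes g :: "('k::field_char_0, 'g::ab_group_add) dgla"
  assumes L: "dg_lie_algebra g"
begin

lemmas fd = dgla_fd[OF L]

context
  fixes M :: "('k, 'm::ab_group_add) gvect"
  assumes M: "fd_graded M"
begin

section \<open>The total differential satisfies the Leibniz rule\<close>

lemma dtot_props:
  assumes \<delta>: "coch_family g 1 M M \<delta>"
  shows dtot_coch: "\<tau> \<in> coch g M \<Longrightarrow> dtot g M \<delta> \<tau> \<in> coch g M"
    and dtot_coch_deg: "\<tau> \<in> coch_deg g M n \<Longrightarrow> dtot g M \<delta> \<tau> \<in> coch_deg g M (n + 1)"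
    and dtot_add: "\<sigma> \<in> coch g M \<Longrightarrow> \<tau> \<in> coch g M \<Longrightarrow> dtot g M \<delta> (\<sigma> + \<tau>) = dtot g M \<delta> \<sigma> + dtot g M \<delta> \<tau>"
    and dtot_cprod: "a \<in> coch_deg g ground p \<Longrightarrow> \<tau> \<in> coch g M \<Longrightarrow>
      dtot g M \<delta> (cprod M a \<tau>) = cprod M (dCE g ground a) \<tau> + cprod M (\<lambda>w. ksgn p * a w) (dtot g M \<delta> \<tau>)"
    and dtot_cst: "m \<in> gsp M \<Longrightarrow> dtot g M \<delta> (cst m) = fam_sum \<delta> m"
proof -
  note h = cochain_map_fam_sum[OF fd M M \<delta>]
  show "dtot g M \<delta> \<tau> \<in> coch g M" if "\<tau> \<in> coch g M"
    unfolding dtot_def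
    by (intro add_subgroup_add[OF add_subgroup_coch[OF fd M]] dCE_coch[OF L M that] cext_coch[OF fd M M h that])
  show "dtot g M \<delta> \<tau> \<in> coch_deg g M (n + 1)" if "\<tau> \<in> coch_deg g M n"
    unfolding dtot_def
    by (intro add_subgroup_add[OF add_subgroup_coch_deg[OF fd M]] dCE_coch_deg[OF L M that] cext_coch_deg[OF fd M M h that])
  show "dtot g M \<delta> (\<sigma> + \<tau>) = dtot g M \<delta> \<sigma> + dtot g M \<delta> \<tau>" if "\<sigma> \<in> coch g M" "\<tau> \<in> coch g M"
    unfolding dtot_def dCE_add[OF L M] cext_add[OF fd M M h that] by (rule add.assoc[THEN trans]) (simp only: add_ac)
  show "dtot g M \<delta> (cprod M a \<tau>) = cprod M (dCE g ground a) \<tau> + cprod M (\<lambda>w. ksgn p * a w) (dtot g M \<delta> \<tau>)"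
    if a: "a \<in> coch_deg g ground p" and t: "\<tau> \<in> coch g M"
  proof -
    have "(\<lambda>w. ksgn p * a w) = (\<lambda>w. ksig (1 * wdeg w) (a w))"
      using ksgn_degree[OF a, of 1] by (simp only: mult_1_left)
    then show ?thesis
      unfolding dtot_def dCE_cprod[OF fd_graded_vs[OF M] a t] cext_cprod[OF fd M M h t] cprod_add_right[OF fd M]
      by (simp only: add.assoc)
  qed
  show "dtot g M \<delta> (cst m) = fam_sum \<delta> m" if "m \<in> gsp M"
    unfolding dtot_def dCE_cst[OF L M] cext_cst[OF fd M M h that] by (rule add_0)
qed

text \<open>Applying the square of the total differential to a constant and evaluating at the empty
  word gives the square of \<open>\<delta> 0\<close>: the codifferential of the empty word is an
  empty sum, and its only unshuffle is trivial.\<close>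

lemma inf_module_iff:
  assumes \<delta>: "coch_family g 1 M M \<delta>"
  shows "inf_module g M \<delta> \<longleftrightarrow> (\<forall>\<tau>\<in>coch g M. dtot g M \<delta> (dtot g M \<delta> \<tau>) = 0)"
proof -
  have "\<delta> 0 (\<delta> 0 m []) [] = 0" if m: "m \<in> gsp M" and sq: "dtot g M \<delta> (dtot g M \<delta> (cst m)) = 0" for m
  proof -
    define \<sigma> where "\<sigma> = fam_sum \<delta> m"
    have \<sigma>: "\<sigma> \<in> coch g M"
      unfolding \<sigma>_def by (rule cochain_map_coch[OF cochain_map_fam_sum[OF fd M M \<delta>] m])
    have s0: "\<sigma> [] = \<delta> 0 m []" by (simp add: \<sigma>_def fam_sum_apply[OF fd M M \<delta> m])
    have "dtot g M \<delta> \<sigma> [] = fam_sum \<delta> (\<sigma> []) []"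
      by (simp add: dtot_def dCE_CS[OF fd_graded_vs[OF M]] cext_eq[OF fd_graded_vs[OF M]] codiff_sum_Nil unsh_sum_Nil
          ksig_def wdeg_simps)
    also have "\<dots> = \<delta> 0 (\<delta> 0 m []) []"
      using fam_sum_apply[OF fd M M \<delta> coch_gsp[OF fd M \<sigma>], of "[]" "[]"] by (simp add: s0)
    finally show ?thesis using sq by (simp add: dtot_cst[OF \<delta> m] flip: \<sigma>_def)
  qed
  then show ?thesis
    unfolding inf_module_def using M \<delta> cst_coch(1)[OF fd M] by blast
qed

text \<open>For a locally finite family of degree 1 the graded, free and Leibniz parts hold
  automatically; what remains on both sides is that the total differential squares to zero.\<close>

lemma dg_bundle_tot_bundle_iff:
  assumes \<delta>: "coch_family g 1 M M \<delta>"
  shows "dg_bundle g (tot_bundle g (M, \<delta>)) \<longleftrightarrow> inf_module g M \<delta>"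
proof -
  let ?D = "restrict (dtot g M \<delta>) (coch g M)"
  have S: "x + y \<in> coch g M" if "x \<in> coch g M" "y \<in> coch g M" for x y
    using that by (rule add_subgroup_add[OF add_subgroup_coch[OF fd M]])
  have add: "?D (x + y) = ?D x + ?D y" if "x \<in> coch g M" "y \<in> coch g M" for x y
    unfolding restrict_apply'[OF that(1)] restrict_apply'[OF that(2)] restrict_apply'[OF S[OF that]]
    by (rule dtot_add[OF \<delta> that])
  have leib: "?D (cprod M a x) = cprod M (dCE g ground a) x + cprod M (\<lambda>w. ksgn p * a w) (?D x)"
    if "a \<in> coch_deg g ground p" "x \<in> coch g M" for a p x
    unfolding restrict_apply'[OF that(2)] restrict_apply'[OF cprod_coch[OF fd M coch_degD[OF that(1)] that(2)]]
    by (rule dtot_cprod[OF \<delta> that])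
  have deg: "?D x \<in> coch_deg g M (q + 1)" if "x \<in> coch_deg g M q" for x q
    unfolding restrict_apply'[OF coch_degD[OF that]] by (rule dtot_coch_deg[OF \<delta> that])
  have sq: "?D (?D x) = dtot g M \<delta> (dtot g M \<delta> x)" if "x \<in> coch g M" for x
    unfolding restrict_apply'[OF that] restrict_apply'[OF dtot_coch[OF \<delta> that]] ..
  show ?thesis
    unfolding inf_module_iff[OF \<delta>]
  proof
    assume "dg_bundle g (tot_bundle g (M, \<delta>))"
    then have "\<forall>x\<in>coch g M. ?D (?D x) = 0"
      unfolding dg_bundle_def tot_bundle_eq cbundle_simps dsum_coch_deg[OF fd M] by (elim conjE)
    then show "\<forall>x\<in>coch g M. dtot g M \<delta> (dtot g M \<delta> x) = 0" using sq by metis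
  next
    assume *: "\<forall>x\<in>coch g M. dtot g M \<delta> (dtot g M \<delta> x) = 0"
    have "?D (?D x) = 0" if "x \<in> coch g M" for x using sq[OF that] * that by metis
    then show "dg_bundle g (tot_bundle g (M, \<delta>))"
      unfolding dg_bundle_def tot_bundle_eq cbundle_simps dsum_coch_deg[OF fd M]
      by (intro conjI allI ballI)
        (rule graded_module_cbundle[OF fd M] fg_free_cbundle[OF fd M] restrict_extensional deg add leib; assumption)+
  qed
qed

lemma dg_bundle_is_tot_bundle:
  assumes "dg_bundle g (cbundle g M D)"
  shows "\<exists>\<delta>. coch_family g 1 M M \<delta> \<and> cbundle g M D = tot_bundle g (M, \<delta>)"
proof -
  have ext: "D \<in> extensional (coch g M)"
    and deg: "\<And>q x. x \<in> coch_deg g M q \<Longrightarrow> D x \<in> coch_deg g M (q + 1)"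
    and add: "\<And>x y. x \<in> coch g M \<Longrightarrow> y \<in> coch g M \<Longrightarrow> D (x + y) = D x + D y"
    and leib: "\<And>p a x. a \<in> coch_deg g ground p \<Longrightarrow> x \<in> coch g M \<Longrightarrow>
      D (cprod M a x) = cprod M (dCE g ground a) x + cprod M (\<lambda>w. ksgn p * a w) (D x)"
    using assms unfolding dg_bundle_def cbundle_simps dsum_coch_deg[OF fd M] by blast+
  define T where "T \<tau> = D \<tau> + - dCE g M \<tau>" for \<tau>
  have T: "additive_on (coch g M) T"
    unfolding additive_on_def T_def by (simp add: add dCE_add[OF L M] del: plus_fun_apply)
  have T_deg: "T \<tau> \<in> coch_deg g M (n + 1)" if "\<tau> \<in> coch_deg g M n" for n \<tau>
    unfolding T_def using deg[OF that] dCE_coch_deg[OF L M that]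
    by (intro add_subgroup_add[OF add_subgroup_coch_deg[OF fd M]] add_subgroup_minus[OF add_subgroup_coch_deg[OF fd M]])
  have T_lin: "T (cprod M a \<tau>) = cprod M (\<lambda>w. ksgn (1 * p) * a w) (T \<tau>)"
    if "a \<in> coch_deg g ground p" "\<tau> \<in> coch g M" for p a \<tau>
  proof -
    \<comment> \<open>Writing \<open>D \<tau>\<close> as \<open>T \<tau> + dCE g M \<tau>\<close>
      exhibits both terms of the Leibniz rule of \<open>dCE\<close>, which then cancel and leave the
      term with \<open>T \<tau>\<close>.\<close>
    have "cprod M (\<lambda>w. ksgn p * a w) (D \<tau>) = cprod M (\<lambda>w. ksgn p * a w) (T \<tau> + dCE g M \<tau>)"
      unfolding T_def by (simp only: add.assoc add.left_inverse add_0_right)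
    then show ?thesis
      unfolding T_def[of "cprod M a \<tau>"] leib[OF that] dCE_cprod[OF fd_graded_vs[OF M] that] cprod_add_right[OF fd M] mult_1_left
      by (simp only: fun_eq_iff plus_fun_apply uminus_apply) simp
  qed
  have op: "cochain_map g 1 M M (\<lambda>m. T (cst m))"
    "\<tau> \<in> coch g M \<Longrightarrow> cext 1 M (\<lambda>m. T (cst m)) \<tau> = T \<tau>" for \<tau>
    by (rule operator_is_cext[OF fd M M T]; (rule T_deg T_lin)?; assumption)+
  define \<delta> where "\<delta> = components M (\<lambda>m. T (cst m))"
  have \<delta>: "coch_family g 1 M M \<delta>" unfolding \<delta>_def by (rule coch_family_components[OF fd M M op(1)])
  have "dtot g M \<delta> \<tau> = D \<tau>" if t: "\<tau> \<in> coch g M" for \<tau>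
  proof -
    have "cext 1 M (fam_sum \<delta>) \<tau> = T \<tau>"
      unfolding op(2)[OF t, symmetric] \<delta>_def
      by (rule cext_cong[OF fd M M t]) (rule fam_sum_components[OF fd M M op(1)])
    then show ?thesis by (simp add: dtot_def T_def fun_eq_iff)
  qed
  then have "D = restrict (dtot g M \<delta>) (coch g M)"
    using ext by (intro extensionalityI[of _ "coch g M"]) simp_all
  then show ?thesis using \<delta> by (auto simp: tot_bundle_eq)
qed

text \<open>\<open>dCE\<close> kills constants, so the differential of \<open>cst m\<close> is the
  sum of the family at \<open>m\<close>.\<close>

lemma tot_bundle_inj:
  assumes \<delta>: "coch_family g 1 M M \<delta>" "coch_family g 1 M M \<delta>'"
    and eq: "tot_bundle g (M, \<delta>) = tot_bundle g (M, \<delta>')"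
  shows "\<delta> = \<delta>'"
proof (rule coch_family_eqI[OF fd M M \<delta>])
  fix m assume m: "m \<in> gsp M"
  have "restrict (dtot g M \<delta>) (coch g M) = restrict (dtot g M \<delta>') (coch g M)"
    using arg_cong[OF eq, of bdiff] by (simp only: tot_bundle_eq cbundle_simps)
  then have "dtot g M \<delta> (cst m) = dtot g M \<delta>' (cst m)"
    using cst_coch(1)[OF fd M m] by (metis restrict_apply')
  then show "fam_sum \<delta> m = fam_sum \<delta>' m"
    by (simp add: dtot_cst[OF _ m] \<delta>)
qed

end

lemma inf_moduleD: "inf_module g M \<delta> \<Longrightarrow> fd_graded M" "inf_module g M \<delta> \<Longrightarrow> coch_family g 1 M M \<delta>"
  by (simp_all add: inf_module_def)

lemma inf_morphism_iff:
  "inf_morphism g (M, \<delta>) (N, \<epsilon>) f \<longleftrightarrow> inf_module g M \<delta> \<and> inf_module g N \<epsilon> \<and> coch_family g 0 M N f \<and>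
    (\<forall>\<tau>\<in>coch g M. inf_ext N f (dtot g M \<delta> \<tau>) = dtot g N \<epsilon> (inf_ext N f \<tau>))"
  by (simp only: inf_morphism_def prod.case)

section \<open>Infinity-morphisms and bundle morphisms\<close>

lemma bundle_morphism_inf_ext:
  assumes "inf_morphism g (M, \<delta>) (N, \<epsilon>) h"
  shows "bundle_morphism g (tot_bundle g (M, \<delta>)) (tot_bundle g (N, \<epsilon>)) (restrict (inf_ext N h) (coch g M))"
proof -
  have \<delta>: "inf_module g M \<delta>" and \<epsilon>: "inf_module g N \<epsilon>" and f: "coch_family g 0 M N h"
    and comm: "\<And>\<tau>. \<tau> \<in> coch g M \<Longrightarrow> inf_ext N h (dtot g M \<delta> \<tau>) = dtot g N \<epsilon> (inf_ext N h \<tau>)"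
    using assms unfolding inf_morphism_iff by blast+
  note M = inf_moduleD[OF \<delta>] and N = inf_moduleD[OF \<epsilon>]
  note h = cochain_map_fam_sum[OF fd M(1) N(1) f]
  note r = restrict_apply'[of _ "coch g M" "inf_ext N h"]
  have "restrict (inf_ext N h) (coch g M) x \<in> coch_deg g N q" if "x \<in> coch_deg g M q" for x q
    using cext_coch_deg[OF fd M(1) N(1) h that] unfolding r[OF coch_degD[OF that]] by simp
  moreover have "restrict (inf_ext N h) (coch g M) (x + y) =
      restrict (inf_ext N h) (coch g M) x + restrict (inf_ext N h) (coch g M) y"
    if "x \<in> coch g M" "y \<in> coch g M" for x y
    unfolding r[OF that(1)] r[OF that(2)] r[OF add_subgroup_add[OF add_subgroup_coch[OF fd M(1)] that]]
    by (rule cext_add[OF fd M(1) N(1) h that])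
  moreover have "restrict (inf_ext N h) (coch g M) (cprod M a x) = cprod N a (restrict (inf_ext N h) (coch g M) x)"
    if "a \<in> coch g ground" "x \<in> coch g M" for a x
    unfolding r[OF that(2)] r[OF cprod_coch[OF fd M(1) that]] cext_cprod[OF fd M(1) N(1) h that(2)]
    by (simp add: ksig_def)
  moreover have "restrict (inf_ext N h) (coch g M) (restrict (dtot g M \<delta>) (coch g M) x) =
      restrict (dtot g N \<epsilon>) (coch g N) (restrict (inf_ext N h) (coch g M) x)" if "x \<in> coch g M" for x
    unfolding restrict_apply'[OF that] r[OF dtot_coch[OF M that]] restrict_apply'[OF cext_coch[OF fd M(1) N(1) h that]]
    by (rule comm[OF that])
  ultimately show ?thesis
    unfolding bundle_morphism_def dg_bundle_tot_bundle_iff[OF M] dg_bundle_tot_bundle_iff[OF N]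
    unfolding tot_bundle_eq cbundle_simps dsum_coch_deg[OF fd M(1)]
    using \<delta> \<epsilon> restrict_extensional by (intro conjI ballI allI)
qed

text \<open>The case \<open>e = 0\<close> of \<open>operator_is_cext\<close>. Compatibility with the
  differentials carries over because the restricted differentials agree with \<open>dtot\<close> on
  cochains.\<close>

lemma bundle_morphism_is_inf_ext:
  assumes \<delta>: "inf_module g M \<delta>" and \<epsilon>: "inf_module g N \<epsilon>"
    and \<Phi>: "bundle_morphism g (tot_bundle g (M, \<delta>)) (tot_bundle g (N, \<epsilon>)) \<Phi>"
  shows "\<exists>h. inf_morphism g (M, \<delta>) (N, \<epsilon>) h \<and> (\<forall>\<tau>\<in>coch g M. inf_ext N h \<tau> = \<Phi> \<tau>)"
proof -
  note M = inf_moduleD[OF \<delta>] and N = inf_moduleD[OF \<epsilon>]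
  have deg: "\<And>q x. x \<in> coch_deg g M q \<Longrightarrow> \<Phi> x \<in> coch_deg g N q"
    and add: "\<And>x y. x \<in> coch g M \<Longrightarrow> y \<in> coch g M \<Longrightarrow> \<Phi> (x + y) = \<Phi> x + \<Phi> y"
    and lin: "\<And>a x. a \<in> coch g ground \<Longrightarrow> x \<in> coch g M \<Longrightarrow> \<Phi> (cprod M a x) = cprod N a (\<Phi> x)"
    and comm: "\<And>x. x \<in> coch g M \<Longrightarrow> \<Phi> (restrict (dtot g M \<delta>) (coch g M) x) = restrict (dtot g N \<epsilon>) (coch g N) (\<Phi> x)"
    using \<Phi> unfolding bundle_morphism_def tot_bundle_eq cbundle_simps dsum_coch_deg[OF fd M(1)] by blast+
  have A: "additive_on (coch g M) \<Phi>" unfolding additive_on_def by (intro ballI add)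
  have D: "\<Phi> \<tau> \<in> coch_deg g N (n + 0)" if "\<tau> \<in> coch_deg g M n" for n \<tau>
    using deg[OF that] by simp
  have Li: "\<Phi> (cprod M a \<tau>) = cprod N (\<lambda>w. ksgn (0 * p) * a w) (\<Phi> \<tau>)"
    if "a \<in> coch_deg g ground p" "\<tau> \<in> coch g M" for p a \<tau>
    using lin[OF coch_degD[OF that(1)] that(2)] by (simp add: ksgn_def)
  have op: "cochain_map g 0 M N (\<lambda>m. \<Phi> (cst m))"
    "\<tau> \<in> coch g M \<Longrightarrow> cext 0 N (\<lambda>m. \<Phi> (cst m)) \<tau> = \<Phi> \<tau>" for \<tau>
    by (rule operator_is_cext[OF fd M(1) N(1) A]; (rule D Li)?; assumption)+
  define h where "h = components M (\<lambda>m. \<Phi> (cst m))"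
  have h: "coch_family g 0 M N h" unfolding h_def by (rule coch_family_components[OF fd M(1) N(1) op(1)])
  have ext: "inf_ext N h \<tau> = \<Phi> \<tau>" if t: "\<tau> \<in> coch g M" for \<tau>
    unfolding op(2)[OF t, symmetric] h_def
    by (rule cext_cong[OF fd M(1) N(1) t]) (rule fam_sum_components[OF fd M(1) N(1) op(1)])
  have "inf_ext N h (dtot g M \<delta> \<tau>) = dtot g N \<epsilon> (inf_ext N h \<tau>)" if t: "\<tau> \<in> coch g M" for \<tau>
  proof -
    have "\<Phi> \<tau> \<in> coch g N"
      unfolding ext[OF t, symmetric] by (rule cext_coch[OF fd M(1) N(1) cochain_map_fam_sum[OF fd M(1) N(1) h] t])
    then show ?thesis
      using comm[OF t] unfolding ext[OF t] ext[OF dtot_coch[OF M t]] restrict_apply'[OF t] by (simp only: restrict_apply')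
  qed
  then have "inf_morphism g (M, \<delta>) (N, \<epsilon>) h"
    unfolding inf_morphism_iff using \<delta> \<epsilon> h by blast
  then show ?thesis using ext by blast
qed

end

section \<open>The adjoint module\<close>

lemma under_simps: "scl (under g) = scl g" "hc (under g) = hc g"
  by (simp_all add: gvect.truncate_def)

context
  fixes g :: "('k::field_char_0, 'g::ab_group_add) dgla"
  assumes L: "dg_lie_algebra g"
begin

lemma fd_graded_under: "fd_graded (under g)"
  using dgla_fd[OF L] by (simp add: fd_graded_def under_simps)

text \<open>The degree axioms of a dg Lie algebra concern homogeneous elements, while a family of
  cochain maps must take cochain values on every element of the underlying space.\<close>

lemma gsp_map:
  assumes "\<And>i y. y \<in> hc g i \<Longrightarrow> f y \<in> gsp g" "lin_on g (scl g) f" "y \<in> gsp g"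
  shows "f y \<in> gsp g"
proof -
  note S = add_subgroup_gsp[OF dgla_fd[OF L]]
  have f: "additive_on (gsp g) f" using assms(2) by (simp add: lin_on_def additive_on_def)
  have "add_subgroup {y \<in> gsp g. f y \<in> gsp g}"
    unfolding add_subgroup_def
  proof (intro conjI ballI)
    show "0 \<in> {y \<in> gsp g. f y \<in> gsp g}"
      using additive_on_zero[OF S f] add_subgroup_zero[OF S] by simp
    show "x + y \<in> {y \<in> gsp g. f y \<in> gsp g}" "- x \<in> {y \<in> gsp g. f y \<in> gsp g}"
      if "x \<in> {y \<in> gsp g. f y \<in> gsp g}" "y \<in> {y \<in> gsp g. f y \<in> gsp g}" for x y
      using that f add_subgroup_add[OF S] add_subgroup_minus[OF S] additive_on_minus[OF S f]
      by (simp_all add: additive_on_def)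
  qed
  moreover have "hc g i \<subseteq> {y \<in> gsp g. f y \<in> gsp g}" for i
    using assms(1) in_dsum[of _ "hc g"] by blast
  ultimately show ?thesis using dsum_in[of _ "hc g" y] assms(3) by blast
qed

text \<open>This is what \<open>dg_bundle_tot_bundle_iff\<close> asks of the adjoint module before
  it translates the square-zero condition.\<close>

lemma coch_family_adj_diff: "coch_family g 1 (under g) (under g) (adj_diff g)"
proof -
  note fd = dgla_fd[OF L]
  note S = add_subgroup_gsp[OF fd]
  interpret vector_space "scl g" using fd by (rule fd_graded_vs)
  have lin: "lin_on g (scl g) (df g)" "\<And>x. x \<in> gsp g \<Longrightarrow> lin_on g (scl g) (br g x)"
    using L unfolding dg_lie_algebra_def by blast+
  have df_gsp: "df g y \<in> gsp g" if "y \<in> gsp g" for y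
    using gsp_map[OF _ lin(1) that] in_dsum[of _ "hc g", OF df_hc[OF L]] by blast
  have br_gsp: "br g x y \<in> gsp g" if "x \<in> hc g i" "y \<in> gsp g" for x y i
    using gsp_map[OF _ lin(2)[OF in_dsum[of _ "hc g", OF that(1)]] that(2)] in_dsum[of _ "hc g", OF br_hc[OF L that(1)]] by blast
  define A where "A k y w = (if hword g w \<and> length w = k
    then (case w of [] \<Rightarrow> df g y | [x] \<Rightarrow> scl g (ksgn (sdeg x)) (br g (snd x) y) | _ \<Rightarrow> 0) else 0)" for k y w
  have adj: "adj_diff g k = restrict (A k) (gsp g)" for k
    unfolding adj_diff_def A_def ..
  have A0: "A k y w = 0" if "length w \<noteq> k" for k y w
    using that by (simp add: A_def)
  have A2: "A k y w = 0" if "length w \<ge> 2" for k y w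
    using that by (auto simp: A_def split: list.splits)
  have A_Nil: "A k y [] = (if k = 0 then df g y else 0)" for k y by (simp add: A_def hword_Nil)
  have A_sing: "A k y [(i, x)] = (if x \<in> hc g i \<and> k = 1 then ksig (i - 1) (br g x y) else 0)" for k y i x
    using scl_ksgn[OF fd_graded_vs[OF fd]] by (auto simp: A_def hword_simps sdeg_def)
  \<comment> \<open>Three cases suffice because the adjoint family lives on words of length at most
    one.\<close>
  have cases: "P w" if "P []" "\<And>i x. P [(i, x)]" "\<And>w. length w \<ge> 2 \<Longrightarrow> P w" for P and w :: "'g word"
    using that by (cases w rule: remdups_adj.cases) auto
  have coch: "A k y \<in> coch g (under g)" if y: "y \<in> gsp g" for k y
    unfolding coch_iff[OF fd fd_graded_under] under_simps
  proof (intro conjI allI impI)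
    show "A k y w \<in> gsp g" for w
      by (rule cases[of _ w])
        (auto simp: A_Nil A_sing A2 df_gsp[OF y] add_subgroup_zero[OF S] intro!: ksig_in[OF S] intro: br_gsp y)
    show "A k y w = 0" if "\<not> hword g w" for w using that by (simp add: A_def)
    show "slot_linear g (scl g) (A k y)"
      unfolding slot_linear_def
    proof (intro allI ballI impI)
      fix u v i c x x' assume x: "x \<in> hc g i" "x' \<in> hc g i"
      have "br g (scl g c x + x') y = scl g c (br g x y) + br g x' y"
        using br_linear_left[OF L y] in_dsum[of _ "hc g"] x by blast
      then show "A k y (u @ (i, scl g c x + x') # v) = scl g c (A k y (u @ (i, x) # v)) + A k y (u @ (i, x') # v)"
        using x hc_add[OF fd hc_scl[OF fd x(1)] x(2)]
        by (cases "u = [] \<and> v = []")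
          (auto simp: A_sing A2 ksig_add scl_ksig[OF fd_graded_vs[OF fd]] Suc_le_eq)
    qed
    show "swap_symmetric g (A k y)"
      by (simp add: swap_symmetric_def A2 ksig_0)
    show "\<exists>N. \<forall>w. length w > N \<longrightarrow> A k y w = 0"
      by (intro exI[of _ 1]) (simp add: A2)
  qed
  show ?thesis
    unfolding coch_family_def under_simps adj
  proof (intro conjI allI ballI)
    show "restrict (A k) (gsp g) \<in> gsp g \<rightarrow>\<^sub>E coch_p g (under g) k" for k
      by (rule PiE_I) (simp_all add: coch_p_iff coch A0)
    show "lin_on (under g) (\<lambda>c \<tau> w. scl g c (\<tau> w)) (restrict (A k) (gsp g))" for k
    proof -
      have "A k (scl g c x + y) w = scl g c (A k x w) + A k y w" if "x \<in> gsp g" "y \<in> gsp g" for c x y w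
      proof (rule cases[of _ w])
        show "A k (scl g c x + y) [] = scl g c (A k x []) + A k y []"
          using df_linear[OF L that] by (simp add: A_Nil)
        show "A k (scl g c x + y) [(i, z)] = scl g c (A k x [(i, z)]) + A k y [(i, z)]" for i z
          using br_linear_right[OF L in_dsum[of _ "hc g"] that, of z i c]
          by (auto simp: A_sing ksig_add scl_ksig[OF fd_graded_vs[OF fd]])
      qed (simp add: A2)
      note comb = this
      show ?thesis
        unfolding lin_on_def under_simps
      proof (intro conjI ballI allI)
        fix x y assume xy: "x \<in> gsp g" "y \<in> gsp g"
        show "restrict (A k) (gsp g) (x + y) = restrict (A k) (gsp g) x + restrict (A k) (gsp g) y"
          using comb[OF xy, of 1] xy add_subgroup_add[OF S xy] by (simp add: fun_eq_iff)
      next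
        fix c x assume x: "x \<in> gsp g"
        have "A k 0 w = 0" for w
          using comb[OF add_subgroup_zero[OF S] add_subgroup_zero[OF S], of 1 w] by simp
        then show "restrict (A k) (gsp g) (scl g c x) = (\<lambda>w. scl g c (restrict (A k) (gsp g) x w))"
          using comb[OF x add_subgroup_zero[OF S], of c] x gsp_scl[OF fd x, of c] by (simp add: fun_eq_iff)
      qed
    qed
    show "restrict (A k) (gsp g) y \<in> coch_deg g (under g) (i + 1)" if y: "y \<in> hc g i" for k i y
    proof -
      have yg: "y \<in> gsp g" using y by (rule in_dsum)
      have "A k y w \<in> hc g (i + 1 + wdeg w)" for w
      proof (rule cases[of _ w])
        show "A k y [(j, x)] \<in> hc g (i + 1 + wdeg [(j, x)])" for j x
          using br_hc[OF L _ y, of x j] hc_zero[OF fd] ksig_in[OF add_subgroup_hc[OF fd]]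
          by (simp add: A_sing wdeg_simps add.commute)
      qed (simp_all add: A_Nil A2 hc_zero[OF fd] df_hc[OF L y] wdeg_simps)
      then show ?thesis using coch[OF yg] yg by (simp add: coch_deg_def under_simps)
    qed
    show "\<exists>n. \<forall>k\<ge>n. restrict (A k) (gsp g) y = 0" if "y \<in> gsp g" for y
    proof -
      have "A k y w = 0" if "k \<ge> 2" for k w
        by (cases "length w = k") (use that in \<open>simp_all add: A0 A2\<close>)
      then show ?thesis using that by (intro exI[of _ 2]) (simp add: fun_eq_iff)
    qed
  qed
qed


section \<open>The correspondence\<close>

lemma associated_eq: "associated g ((M, \<delta>), f) = (tot_bundle g (M, \<delta>), restrict (inf_ext (under g) f) (coch g M))"
  by (simp add: associated_def)

lemma wlp_modules_iff: "((M, \<delta>), f) \<in> wlp_modules g \<longleftrightarrow> inf_morphism g (M, \<delta>) (under g, adj_diff g) f"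
  by (simp add: wlp_modules_def)

lemma wlp_modulesD:
  assumes "((M, \<delta>), f) \<in> wlp_modules g"
  shows "inf_module g M \<delta>" "coch_family g 0 M (under g) f"
  using assms unfolding wlp_modules_iff inf_morphism_iff[OF L] by blast+

lemma associated_morphism:
  assumes "((M, \<delta>), f) \<in> wlp_modules g"
  shows "associated g ((M, \<delta>), f) \<in> morphisms_to_tangent g"
  using bundle_morphism_inf_ext[OF L assms[unfolded wlp_modules_iff]]
  by (simp add: associated_eq morphisms_to_tangent_def shifted_tangent_def)

text \<open>Everything is recovered from constants: the differential gives the sum of
  \<open>\<delta>\<close> there, the extension gives the sum of \<open>f\<close>, and a locally
  finite family is determined by its sum.\<close>

lemma associated_inj:
  assumes A: "((M, \<delta>), f) \<in> wlp_modules g" "((M, \<delta>'), f') \<in> wlp_modules g"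
    and eq: "associated g ((M, \<delta>), f) = associated g ((M, \<delta>'), f')"
  shows "\<delta> = \<delta>'" "f = f'"
proof -
  note fd = dgla_fd[OF L] and M = inf_moduleD(1)[OF L wlp_modulesD(1)[OF A(1)]]
  note f = wlp_modulesD(2)[OF A(1)] wlp_modulesD(2)[OF A(2)]
  show "\<delta> = \<delta>'"
    using tot_bundle_inj[OF L M inf_moduleD(2)[OF L wlp_modulesD(1)[OF A(1)]] inf_moduleD(2)[OF L wlp_modulesD(1)[OF A(2)]]]
      eq by (simp add: associated_eq)
  show "f = f'"
  proof (rule coch_family_eqI[OF fd M fd_graded_under f])
    fix m assume m: "m \<in> gsp M"
    have "restrict (inf_ext (under g) f) (coch g M) (cst m) = restrict (inf_ext (under g) f') (coch g M) (cst m)"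
      using eq by (simp only: associated_eq prod.inject)
    then show "fam_sum f m = fam_sum f' m"
      using cst_coch(1)[OF fd M m]
      by (simp only: restrict_apply' cext_cst[OF fd M fd_graded_under cochain_map_fam_sum[OF fd M fd_graded_under f(1)] m]
          cext_cst[OF fd M fd_graded_under cochain_map_fam_sum[OF fd M fd_graded_under f(2)] m])
  qed
qed

lemma associated_surj:
  assumes M: "fd_graded M" and F: "(cbundle g M D, F) \<in> morphisms_to_tangent g"
  shows "\<exists>\<delta> f. ((M, \<delta>), f) \<in> wlp_modules g \<and> associated g ((M, \<delta>), f) = (cbundle g M D, F)"
proof -
  note fd = dgla_fd[OF L]
  have F: "bundle_morphism g (cbundle g M D) (tot_bundle g (under g, adj_diff g)) F"
    using F by (simp add: morphisms_to_tangent_def shifted_tangent_def)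
  then have dg: "dg_bundle g (cbundle g M D)" "dg_bundle g (tot_bundle g (under g, adj_diff g))"
    and ext: "F \<in> extensional (coch g M)"
    unfolding bundle_morphism_def cbundle_simps dsum_coch_deg[OF fd M] by blast+
  obtain \<delta> where \<delta>: "coch_family g 1 M M \<delta>" and eq: "cbundle g M D = tot_bundle g (M, \<delta>)"
    using dg_bundle_is_tot_bundle[OF L M dg(1)] by blast
  \<comment> \<open>Both square-zero conditions, including that of the adjoint module, are read off
    from the dg axioms contained in \<open>bundle_morphism\<close>.\<close>
  have mods: "inf_module g M \<delta>" "inf_module g (under g) (adj_diff g)"
    using dg unfolding eq dg_bundle_tot_bundle_iff[OF L M \<delta>] dg_bundle_tot_bundle_iff[OF L fd_graded_under coch_family_adj_diff] .
  obtain f where f: "inf_morphism g (M, \<delta>) (under g, adj_diff g) f" "\<And>\<tau>. \<tau> \<in> coch g M \<Longrightarrow> inf_ext (under g) f \<tau> = F \<tau>"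
    using bundle_morphism_is_inf_ext[OF L mods F[unfolded eq]] by blast
  have "restrict (inf_ext (under g) f) (coch g M) = F"
    using ext by (intro extensionalityI[of _ "coch g M"]) (simp_all add: f(2))
  then show ?thesis using f(1) by (auto simp: wlp_modules_iff associated_eq eq)
qed

lemma sections_tot_bundle: "inf_module g M \<delta> \<Longrightarrow> sections (tot_bundle g (M, \<delta>)) = coch g M"
  unfolding tot_bundle_eq cbundle_simps by (rule dsum_coch_deg[OF dgla_fd[OF L] inf_moduleD(1)[OF L]])

text \<open>Invertibility and compatibility with the structure maps are equations between maps of
  cochains on both sides. It remains to pass between \<open>inf_ext\<close> and its restriction, for
  which composites must stay inside the cochain spaces.\<close>

lemma wlp_iso_iff:
  assumes A: "((M, \<delta>), f) \<in> wlp_modules g" and A': "((N, \<epsilon>), f') \<in> wlp_modules g"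
  shows "wlp_iso g ((M, \<delta>), f) ((N, \<epsilon>), f') \<longleftrightarrow>
    bundle_iso_over g (associated g ((M, \<delta>), f)) (associated g ((N, \<epsilon>), f'))"
proof -
  note \<delta> = wlp_modulesD(1)[OF A] and \<epsilon> = wlp_modulesD(1)[OF A'] and fd = dgla_fd[OF L]
  note M = inf_moduleD(1)[OF L \<delta>] and N = inf_moduleD(1)[OF L \<epsilon>]
  have in_N: "inf_ext N h \<tau> \<in> coch g N" if "inf_morphism g (M, \<delta>) (N, \<epsilon>) h" "\<tau> \<in> coch g M" for h \<tau>
    using that unfolding inf_morphism_iff[OF L]
    by (blast intro: cext_coch[OF fd M N cochain_map_fam_sum[OF fd M N]])
  have in_M: "inf_ext M h \<tau> \<in> coch g M" if "inf_morphism g (N, \<epsilon>) (M, \<delta>) h" "\<tau> \<in> coch g N" for h \<tau>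
    using that unfolding inf_morphism_iff[OF L]
    by (blast intro: cext_coch[OF fd N M cochain_map_fam_sum[OF fd N M]])
  show ?thesis
  proof
    assume "wlp_iso g ((M, \<delta>), f) ((N, \<epsilon>), f')"
    then obtain h h' where h: "inf_morphism g (M, \<delta>) (N, \<epsilon>) h" "inf_morphism g (N, \<epsilon>) (M, \<delta>) h'"
      and inv: "\<And>\<tau>. \<tau> \<in> coch g M \<Longrightarrow> inf_ext M h' (inf_ext N h \<tau>) = \<tau>"
        "\<And>\<tau>. \<tau> \<in> coch g N \<Longrightarrow> inf_ext N h (inf_ext M h' \<tau>) = \<tau>"
        "\<And>\<tau>. \<tau> \<in> coch g M \<Longrightarrow> inf_ext (under g) f' (inf_ext N h \<tau>) = inf_ext (under g) f \<tau>"
      unfolding wlp_iso_def prod.case by blast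
    show "bundle_iso_over g (associated g ((M, \<delta>), f)) (associated g ((N, \<epsilon>), f'))"
      unfolding bundle_iso_over_def associated_eq prod.case sections_tot_bundle[OF \<delta>] sections_tot_bundle[OF \<epsilon>]
      using bundle_morphism_inf_ext[OF L h(1)] bundle_morphism_inf_ext[OF L h(2)]
      by (intro exI[of _ "restrict (inf_ext N h) (coch g M)"] exI[of _ "restrict (inf_ext M h') (coch g N)"])
        (simp add: in_N[OF h(1)] in_M[OF h(2)] inv)
  next
    assume "bundle_iso_over g (associated g ((M, \<delta>), f)) (associated g ((N, \<epsilon>), f'))"
    then obtain \<Phi> \<Psi> where \<Phi>: "bundle_morphism g (tot_bundle g (M, \<delta>)) (tot_bundle g (N, \<epsilon>)) \<Phi>"
        "bundle_morphism g (tot_bundle g (N, \<epsilon>)) (tot_bundle g (M, \<delta>)) \<Psi>"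
      and inv: "\<And>\<tau>. \<tau> \<in> coch g M \<Longrightarrow> \<Psi> (\<Phi> \<tau>) = \<tau>" "\<And>\<tau>. \<tau> \<in> coch g N \<Longrightarrow> \<Phi> (\<Psi> \<tau>) = \<tau>"
        "\<And>\<tau>. \<tau> \<in> coch g M \<Longrightarrow> restrict (inf_ext (under g) f') (coch g N) (\<Phi> \<tau>) = restrict (inf_ext (under g) f) (coch g M) \<tau>"
      unfolding bundle_iso_over_def associated_eq prod.case sections_tot_bundle[OF \<delta>] sections_tot_bundle[OF \<epsilon>] by blast
    obtain h where h: "inf_morphism g (M, \<delta>) (N, \<epsilon>) h" "\<And>\<tau>. \<tau> \<in> coch g M \<Longrightarrow> inf_ext N h \<tau> = \<Phi> \<tau>"
      using bundle_morphism_is_inf_ext[OF L \<delta> \<epsilon> \<Phi>(1)] by blast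
    obtain h' where h': "inf_morphism g (N, \<epsilon>) (M, \<delta>) h'" "\<And>\<tau>. \<tau> \<in> coch g N \<Longrightarrow> inf_ext M h' \<tau> = \<Psi> \<tau>"
      using bundle_morphism_is_inf_ext[OF L \<epsilon> \<delta> \<Phi>(2)] by blast
    have cl: "\<Phi> \<tau> \<in> coch g N" if "\<tau> \<in> coch g M" for \<tau> using in_N[OF h(1) that] by (simp add: h(2) that)
    have cl': "\<Psi> \<tau> \<in> coch g M" if "\<tau> \<in> coch g N" for \<tau> using in_M[OF h'(1) that] by (simp add: h'(2) that)
    have "inf_ext (under g) f' (\<Phi> \<tau>) = inf_ext (under g) f \<tau>" if "\<tau> \<in> coch g M" for \<tau>
      using inv(3)[OF that] by (simp add: cl that)
    then show "wlp_iso g ((M, \<delta>), f) ((N, \<epsilon>), f')"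
      unfolding wlp_iso_def prod.case using h(1) h'(1)
      by (intro exI[of _ h] exI[of _ h']) (simp add: h(2) h'(2) cl cl' inv)
  qed
qed

end

section \<open>Trivialising a dg bundle\<close>

lemma graded_moduleD:
  assumes "graded_module g E"
  shows graded_module_subgroup: "add_subgroup (hsec E q)"
    and graded_module_direct: "direct (hsec E)"
    and graded_module_deg: "a \<in> coch_deg g ground p \<Longrightarrow> x \<in> hsec E q \<Longrightarrow> bact E a x \<in> hsec E (p + q)"
    and graded_module_add_left: "a \<in> coch g ground \<Longrightarrow> b \<in> coch g ground \<Longrightarrow> x \<in> sections E \<Longrightarrow>
      bact E (a + b) x = bact E a x + bact E b x"
    and graded_module_add_right: "a \<in> coch g ground \<Longrightarrow> additive_on (sections E) (bact E a)"
    and graded_module_assoc: "a \<in> coch g ground \<Longrightarrow> b \<in> coch g ground \<Longrightarrow> x \<in> sections E \<Longrightarrow>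
      bact E (cprod ground a b) x = bact E a (bact E b x)"
proof -
  have *: "\<forall>q. 0 \<in> hsec E q \<and> (\<forall>x\<in>hsec E q. \<forall>y\<in>hsec E q. x + y \<in> hsec E q \<and> - x \<in> hsec E q)"
    "direct (hsec E)"
    "\<forall>p q. \<forall>a\<in>coch_deg g ground p. \<forall>x\<in>hsec E q. bact E a x \<in> hsec E (p + q)"
    "\<forall>a\<in>coch g ground. \<forall>b\<in>coch g ground. \<forall>x\<in>sections E. \<forall>y\<in>sections E.
      bact E (a + b) x = bact E a x + bact E b x \<and>
      bact E a (x + y) = bact E a x + bact E a y \<and>
      bact E (cprod ground a b) x = bact E a (bact E b x)"
    using assms unfolding graded_module_def by - (elim conjE, assumption)+
  show "add_subgroup (hsec E q)" using *(1) unfolding add_subgroup_def by blast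
  show "direct (hsec E)" by (rule *(2))
  show "a \<in> coch_deg g ground p \<Longrightarrow> x \<in> hsec E q \<Longrightarrow> bact E a x \<in> hsec E (p + q)" using *(3) by blast
  show "bact E (a + b) x = bact E a x + bact E b x" "bact E (cprod ground a b) x = bact E a (bact E b x)"
    if "a \<in> coch g ground" "b \<in> coch g ground" "x \<in> sections E"
    using *(4) that by blast+
  show "additive_on (sections E) (bact E a)" if "a \<in> coch g ground"
    using *(4) that unfolding additive_on_def by blast
qed

lemma graded_module_sections: "graded_module g E \<Longrightarrow> add_subgroup (sections E)"
  by (intro add_subgroup_dsum graded_module_subgroup)

text \<open>The module axioms locate products of homogeneous factors only; the form is split into
  its degrees first, then the section.\<close>

lemma bact_sections:
  assumes g: "fd_graded g" and E: "graded_module g E" and a: "a \<in> coch g ground" and x: "x \<in> sections E"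
  shows "bact E a x \<in> sections E"
proof -
  note S = graded_module_sections[OF E]
  note A = graded_module_add_right[OF E a]
  have hom: "bact E a x \<in> sections E" if x: "x \<in> hsec E q" for x q
  proof -
    obtain K where K: "a = (\<Sum>p\<in>{- K..K}. form_part p a)" using coch_ground_decompose[OF g a] .
    have "additive_on (coch g ground) (\<lambda>a. bact E a x)"
      unfolding additive_on_def using graded_module_add_left[OF E] in_dsum[of _ "hsec E", OF x] by blast
    then have "bact E (\<Sum>p\<in>{- K..K}. form_part p a) x = (\<Sum>p\<in>{- K..K}. bact E (form_part p a) x)"
      by (rule additive_on_sum[OF add_subgroup_coch[OF g fd_graded_ground]])
        (rule coch_degD[OF form_part_coch_deg[OF g a]])
    also have "\<dots> \<in> sections E"
      by (intro sum_in[OF S]) (rule in_dsum[of _ "hsec E", OF graded_module_deg[OF E form_part_coch_deg[OF g a] x]])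
    finally show ?thesis unfolding K[symmetric] .
  qed
  have "add_subgroup {x \<in> sections E. bact E a x \<in> sections E}"
    unfolding add_subgroup_def
  proof (intro conjI ballI)
    show "0 \<in> {x \<in> sections E. bact E a x \<in> sections E}"
      using additive_on_zero[OF S A] add_subgroup_zero[OF S] by simp
    show "x + y \<in> {x \<in> sections E. bact E a x \<in> sections E}" "- x \<in> {x \<in> sections E. bact E a x \<in> sections E}"
      if "x \<in> {x \<in> sections E. bact E a x \<in> sections E}" "y \<in> {x \<in> sections E. bact E a x \<in> sections E}" for x y
      using that A add_subgroup_add[OF S] add_subgroup_minus[OF S] additive_on_minus[OF S A]
      by (simp_all add: additive_on_def)
  qed
  moreover have "hsec E q \<subseteq> {x \<in> sections E. bact E a x \<in> sections E}" for q
    using hom in_dsum[of _ "hsec E"] by blast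
  ultimately show ?thesis using dsum_in[of _ "hsec E" x] x by blast
qed

lemma graded_additive_sections:
  assumes E: "graded_module g E" and E': "graded_module g E'"
    and add: "additive_on (sections E) f" and deg: "\<And>q x. x \<in> hsec E q \<Longrightarrow> f x \<in> hsec E' (q + e)"
    and x: "x \<in> sections E"
  shows "f x \<in> sections E'"
proof -
  obtain I y where I: "\<forall>i\<in>I. y i \<in> hsec E i" "x = (\<Sum>i\<in>I. y i)" using x by (auto simp: dsum_def)
  have "f (\<Sum>i\<in>I. y i) = (\<Sum>i\<in>I. f (y i))"
    by (rule additive_on_sum[OF graded_module_sections[OF E] add]) (use I in_dsum[of _ "hsec E"] in blast)
  also have "\<dots> \<in> sections E'"
    by (intro sum_in[OF graded_module_sections[OF E']]) (use I deg in_dsum[of _ "hsec E'"] in blast)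
  finally show ?thesis by (simp only: I(2))
qed

text \<open>Unit vector \<open>i\<close> has degree \<open>q i\<close>. The space sits inside
  \<open>nat \<Rightarrow> 'k\<close> so that its type does not depend on the rank, which varies
  with the bundle.\<close>

definition coordinate_space :: "nat \<Rightarrow> (nat \<Rightarrow> int) \<Rightarrow> ('k::field, nat \<Rightarrow> 'k) gvect"
  where "coordinate_space n q =
    \<lparr>scl = (\<lambda>c v i. c * v i), hc = (\<lambda>p. {v. \<forall>i. v i \<noteq> 0 \<longrightarrow> i < n \<and> q i = p})\<rparr>"

lemma coordinate_space_simps:
  "scl (coordinate_space n q) = (\<lambda>c v i. c * v i)"
  "v \<in> hc (coordinate_space n q) p \<longleftrightarrow> (\<forall>i. v i \<noteq> 0 \<longrightarrow> i < n \<and> q i = p)"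
  by (simp_all add: coordinate_space_def)

lemma gsp_coordinate_space:
  assumes "v \<in> gsp (coordinate_space n q)" "i \<ge> n"
  shows "v i = 0"
proof -
  have "hc (coordinate_space n q) p \<subseteq> {v. v i = 0}" for p
  proof (rule subsetI, rule ccontr)
    fix v assume v: "v \<in> hc (coordinate_space n q) p" "v \<notin> {v. v i = 0}"
    then have "i < n" using coordinate_space_simps(2)[of v n q p] by blast
    then show False using assms(2) by simp
  qed
  then have "v \<in> {v. v i = 0}"
    by (intro dsum_in[OF _ _ assms(1)]) (simp_all add: add_subgroup_def)
  then show ?thesis by simp
qed

lemma fd_graded_coordinate_space: "fd_graded (coordinate_space n q :: ('k::field, nat \<Rightarrow> 'k) gvect)"
proof -
  let ?M = "coordinate_space n q :: ('k, nat \<Rightarrow> 'k) gvect"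
  have vs: "vector_space (scl ?M)"
    by unfold_locales (simp_all add: coordinate_space_simps fun_eq_iff algebra_simps)
  interpret vector_space "scl ?M" by (rule vs)
  have "subspace (hc ?M p)" for p
    unfolding subspace_def
  proof (intro conjI ballI allI)
    fix x y assume xy: "x \<in> hc ?M p" "y \<in> hc ?M p"
    have "x i \<noteq> 0 \<or> y i \<noteq> 0" if "(x + y) i \<noteq> 0" for i
      using that by auto
    then show "x + y \<in> hc ?M p" using xy unfolding coordinate_space_simps by blast
  qed (simp_all add: coordinate_space_simps)
  moreover have "direct (hc ?M)"
    unfolding direct_def
  proof (intro allI impI ballI)
    fix I :: "int set" and x :: "int \<Rightarrow> nat \<Rightarrow> 'k" and p
    assume *: "finite I \<and> (\<forall>p\<in>I. x p \<in> hc ?M p) \<and> (\<Sum>p\<in>I. x p) = 0" and p: "p \<in> I"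
    have z: "x k j = 0" if "k \<in> I" "k \<noteq> q j" for k j
      using * that by (auto simp: coordinate_space_simps)
    show "x p = 0"
    proof
      fix j
      show "x p j = 0 j"
      proof (cases "p = q j")
        case True
        have "(\<Sum>k\<in>I. x k j) = (\<Sum>k\<in>{p}. x k j)"
          using * p z True by (intro sum.mono_neutral_right) auto
        moreover have "(\<Sum>k\<in>I. x k j) = 0"
          using * unfolding sum_fun_apply[symmetric] by simp
        ultimately show ?thesis by simp
      qed (simp add: z[OF p])
    qed
  qed
  moreover have "v \<in> span ((\<lambda>i j. if j = i then 1 else 0) ` {..<n})" if v: "v \<in> gsp ?M" for v
  proof -
    have "v = (\<Sum>i<n. scl ?M (v i) (\<lambda>j. if j = i then 1 else 0))"
    proof
      fix j
      have "(\<Sum>i<n. scl ?M (v i) (\<lambda>j. if j = i then 1 else 0)) j = (\<Sum>i<n. if i = j then v j else 0)"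
        unfolding sum_fun_apply coordinate_space_simps by (intro sum.cong) auto
      then show "v j = (\<Sum>i<n. scl ?M (v i) (\<lambda>j. if j = i then 1 else 0)) j"
        using gsp_coordinate_space[OF v, of j] by (cases "j < n") (auto simp: not_less)
    qed
    also have "\<dots> \<in> span ((\<lambda>i j. if j = i then 1 else 0) ` {..<n})"
      by (intro span_sum span_scale span_base) blast
    finally show ?thesis .
  qed
  ultimately show ?thesis
    unfolding fd_graded_def using vs by (intro conjI allI exI[of _ "(\<lambda>i j. if j = i then 1 else 0) ` {..<n}"]) auto
qed

text \<open>A homogeneous module basis turns the coordinates of a cochain into coefficient forms;
  existence and uniqueness of the expansion of a section are surjectivity and injectivity of this
  map.\<close>

lemma trivialisation:
  fixes g :: "('k::field_char_0, 'g::ab_group_add) dgla" and E :: "('k, 'g, 'e::ab_group_add) dgvb"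
  assumes g: "fd_graded g" and E: "graded_module g E" "fg_free g E"
  obtains M :: "('k, nat \<Rightarrow> 'k) gvect" and \<Phi>
  where "fd_graded M" "bij_betw \<Phi> (coch g M) (sections E)" "additive_on (coch g M) \<Phi>"
    "\<And>p \<tau>. \<tau> \<in> coch_deg g M p \<Longrightarrow> \<Phi> \<tau> \<in> hsec E p"
    "\<And>a \<tau>. a \<in> coch g ground \<Longrightarrow> \<tau> \<in> coch g M \<Longrightarrow> \<Phi> (cprod M a \<tau>) = bact E a (\<Phi> \<tau>)"
proof -
  obtain n :: nat and e where e: "\<forall>i<n. \<exists>q. e i \<in> hsec E q"
    and free: "\<forall>x\<in>sections E. \<exists>!c. c \<in> {..<n} \<rightarrow>\<^sub>E coch g ground \<and> x = (\<Sum>i<n. bact E (c i) (e i))"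
    using E(2) unfolding fg_free_def by blast
  obtain q where q: "\<And>i. i < n \<Longrightarrow> e i \<in> hsec E (q i)" using e by metis
  have es: "e i \<in> sections E" if "i < n" for i using q[OF that] by (rule in_dsum)
  define M :: "('k, nat \<Rightarrow> 'k) gvect" where "M = coordinate_space n q"
  have M: "fd_graded M" unfolding M_def by (rule fd_graded_coordinate_space)
  interpret vector_space "scl M" using M by (rule fd_graded_vs)
  note S = graded_module_sections[OF E(1)]
  define \<Phi> where "\<Phi> \<tau> = (\<Sum>i<n. bact E (\<lambda>w. \<tau> w i) (e i))" for \<tau> :: "'g word \<Rightarrow> nat \<Rightarrow> 'k"
  have coord: "(\<lambda>w. \<tau> w i) \<in> coch g ground" if "\<tau> \<in> coch g M" for \<tau> i
    by (rule coch_compose[OF g M fd_graded_ground _ _ _ that])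
      (simp_all add: additive_on_def scl_ground gsp_ground M_def coordinate_space_simps)
  have zero: "\<tau> w i = 0" if "\<tau> \<in> coch g M" "i \<ge> n" for \<tau> w i
    using gsp_coordinate_space[of "\<tau> w" n q i] coch_gsp[OF g M that(1)] that(2) by (simp add: M_def)
  have sec: "\<Phi> \<tau> \<in> sections E" if "\<tau> \<in> coch g M" for \<tau>
    unfolding \<Phi>_def by (intro sum_in[OF S] bact_sections[OF g E(1) coord[OF that]] es) simp
  have "inj_on \<Phi> (coch g M)"
  proof (rule inj_onI)
    fix \<sigma> \<tau> assume s: "\<sigma> \<in> coch g M" and t: "\<tau> \<in> coch g M" and eq: "\<Phi> \<sigma> = \<Phi> \<tau>"
    \<comment> \<open>Coefficient families are restricted to \<open>{..<n}\<close>, since the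
      uniqueness in \<open>fg_free\<close> is among extensional families.\<close>
    define c where "c \<tau> = restrict (\<lambda>i w. \<tau> w i) {..<n}" for \<tau> :: "'g word \<Rightarrow> nat \<Rightarrow> 'k"
    have c: "c \<tau> \<in> {..<n} \<rightarrow>\<^sub>E coch g ground \<and> \<Phi> \<tau> = (\<Sum>i<n. bact E (c \<tau> i) (e i))" if "\<tau> \<in> coch g M" for \<tau>
      unfolding \<Phi>_def c_def using coord[OF that] by (auto intro: sum.cong)
    have "c \<sigma> = c \<tau>" using c[OF s] c[OF t] free sec[OF t] unfolding eq by blast
    then have "c \<sigma> i w = c \<tau> i w" for i w by simp
    then have "\<sigma> w i = \<tau> w i" if "i < n" for w i
      unfolding c_def using that by (metis lessThan_iff restrict_apply')
    then show "\<sigma> = \<tau>"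
      using zero[OF s] zero[OF t] by (intro ext) (metis not_le)
  qed
  moreover have "x \<in> \<Phi> ` coch g M" if x: "x \<in> sections E" for x
  proof -
    obtain c where c: "c \<in> {..<n} \<rightarrow>\<^sub>E coch g ground" "x = (\<Sum>i<n. bact E (c i) (e i))" using free x by blast
    define u :: "nat \<Rightarrow> nat \<Rightarrow> 'k" where "u i = (\<lambda>j. if j = i then 1 else 0)" for i
    \<comment> \<open>Summing products with unit vectors makes the preimage a cochain by closure,
      with coordinate forms \<open>c i\<close>.\<close>
    define \<tau> where "\<tau> = (\<Sum>i<n. cprod M (c i) (cst (u i)))"
    have u: "u i \<in> gsp M" if "i < n" for i
      by (rule in_dsum[of _ _ "q i"]) (simp add: M_def coordinate_space_simps u_def that)
    have "\<tau> \<in> coch g M"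
      unfolding \<tau>_def using c(1) u
      by (intro sum_in[OF add_subgroup_coch[OF g M]] cprod_coch[OF g M] cst_coch(1)[OF g M]) auto
    moreover have "\<tau> w j = c j w" if "j < n" for w j
    proof -
      have "\<tau> w j = (\<Sum>i<n. if i = j then c j w else 0)"
        unfolding \<tau>_def sum_fun_apply cprod_cst[OF g M]
        unfolding M_def coordinate_space_simps u_def by (intro sum.cong) auto
      then show ?thesis using that by simp
    qed
    ultimately show ?thesis
      unfolding c(2) by (intro image_eqI[of _ _ \<tau>]) (simp_all add: \<Phi>_def)
  qed
  ultimately have "bij_betw \<Phi> (coch g M) (sections E)"
    using sec by (auto simp: bij_betw_def)
  moreover have "additive_on (coch g M) \<Phi>"
    unfolding additive_on_def
  proof (intro ballI)
    fix \<sigma> \<tau> assume s: "\<sigma> \<in> coch g M" and t: "\<tau> \<in> coch g M"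
    have "bact E (\<lambda>w. (\<sigma> + \<tau>) w i) (e i) = bact E (\<lambda>w. \<sigma> w i) (e i) + bact E (\<lambda>w. \<tau> w i) (e i)" if "i < n" for i
      using graded_module_add_left[OF E(1) coord[OF s] coord[OF t] es[OF that], of i i] by (simp add: plus_fun_def)
    then show "\<Phi> (\<sigma> + \<tau>) = \<Phi> \<sigma> + \<Phi> \<tau>"
      unfolding \<Phi>_def sum.distrib[symmetric] by (intro sum.cong) simp_all
  qed
  moreover have "\<Phi> \<tau> \<in> hsec E p" if t: "\<tau> \<in> coch_deg g M p" for p \<tau>
    unfolding \<Phi>_def
  proof (rule sum_in[OF graded_module_subgroup[OF E(1)]])
    fix i assume i: "i \<in> {..<n}"
    \<comment> \<open>A nonzero coordinate \<open>i\<close> means degree \<open>q i\<close>, while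
      the value at \<open>w\<close> has degree \<open>p + wdeg w\<close>. So the coefficient of
      \<open>e i\<close> has degree \<open>p - q i\<close>, complementary to
      \<open>e i\<close>.\<close>
    have "wdeg w = - (p - q i)" if "\<tau> w i \<noteq> 0" for w
    proof -
      have "\<tau> w \<in> hc M (p + wdeg w)" using t by (simp add: coch_deg_def)
      then show ?thesis using that by (auto simp: M_def coordinate_space_simps)
    qed
    then have "(\<lambda>w. \<tau> w i) \<in> coch_deg g ground (p - q i)"
      using coord[OF coch_degD[OF t]] by (simp add: coch_deg_ground_iff)
    then have "bact E (\<lambda>w. \<tau> w i) (e i) \<in> hsec E (p - q i + q i)"
      using q i by (intro graded_module_deg[OF E(1)]) simp_all
    then show "bact E (\<lambda>w. \<tau> w i) (e i) \<in> hsec E p" by simp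
  qed
  moreover have "\<Phi> (cprod M a \<tau>) = bact E a (\<Phi> \<tau>)" if a: "a \<in> coch g ground" and t: "\<tau> \<in> coch g M" for a \<tau>
  proof -
    have c: "(\<lambda>w. cprod M a \<tau> w i) = cprod ground a (\<lambda>w. \<tau> w i)" for i
    proof
      fix w
      have "ksig k (v :: nat \<Rightarrow> 'k) i = ksig k (v i)" for k v by (simp add: ksig_def)
      then show "cprod M a \<tau> w i = cprod ground a (\<lambda>w. \<tau> w i) w"
        unfolding cprod_eq[OF fd_graded_vs[OF M]] cprod_eq[OF vector_space_ground]
          unsh_sum_hom[where f = "\<lambda>v. v i", OF plus_fun_apply, symmetric]
        by (simp add: M_def coordinate_space_simps scl_ground)
    qed
    have "\<Phi> (cprod M a \<tau>) = (\<Sum>i<n. bact E a (bact E (\<lambda>w. \<tau> w i) (e i)))"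
      unfolding \<Phi>_def c by (intro sum.cong refl graded_module_assoc[OF E(1) a coord[OF t]] es) simp
    also have "\<dots> = bact E a (\<Phi> \<tau>)"
      unfolding \<Phi>_def
      by (intro additive_on_sum[OF S graded_module_add_right[OF E(1) a], symmetric]
          bact_sections[OF g E(1) coord[OF t]] es) simp
    finally show ?thesis .
  qed
  ultimately show ?thesis using M that by blast
qed

section \<open>Transport of the differential along a trivialisation\<close>

lemma dg_bundleD:
  assumes "dg_bundle g E"
  shows dg_bundle_graded: "graded_module g E" and dg_bundle_free: "fg_free g E"
    and bdiff_deg: "x \<in> hsec E q \<Longrightarrow> bdiff E x \<in> hsec E (q + 1)"
    and bdiff_add: "additive_on (sections E) (bdiff E)"
    and bdiff_leibniz: "a \<in> coch_deg g ground p \<Longrightarrow> x \<in> sections E \<Longrightarrow>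
      bdiff E (bact E a x) = bact E (dCE g ground a) x + bact E (\<lambda>w. ksgn p * a w) (bdiff E x)"
    and bdiff_sq: "x \<in> sections E \<Longrightarrow> bdiff E (bdiff E x) = 0"
proof -
  have *: "graded_module g E" "fg_free g E" "\<forall>q. \<forall>x\<in>hsec E q. bdiff E x \<in> hsec E (q + 1)"
    "\<forall>x\<in>sections E. \<forall>y\<in>sections E. bdiff E (x + y) = bdiff E x + bdiff E y"
    "\<forall>p. \<forall>a\<in>coch_deg g ground p. \<forall>x\<in>sections E.
      bdiff E (bact E a x) = bact E (dCE g ground a) x + bact E (\<lambda>w. ksgn p * a w) (bdiff E x)"
    "\<forall>x\<in>sections E. bdiff E (bdiff E x) = 0"
    using assms unfolding dg_bundle_def by - (elim conjE, assumption)+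
  show "graded_module g E" "fg_free g E" "x \<in> hsec E q \<Longrightarrow> bdiff E x \<in> hsec E (q + 1)"
    "additive_on (sections E) (bdiff E)"
    using *(1-4) unfolding additive_on_def by simp_all
  show "bdiff E (bact E a x) = bact E (dCE g ground a) x + bact E (\<lambda>w. ksgn p * a w) (bdiff E x)"
    if "a \<in> coch_deg g ground p" "x \<in> sections E"
    by (rule *(5)[rule_format, OF that])
  show "bdiff E (bdiff E x) = 0" if "x \<in> sections E"
    by (rule *(6)[rule_format, OF that])
qed

lemma dg_bundle_bdiff_sections:
  assumes "dg_bundle g E" "x \<in> sections E"
  shows "bdiff E x \<in> sections E"
proof (rule graded_additive_sections[OF _ _ bdiff_add[OF assms(1)] _ assms(2), where e = 1])
  show "graded_module g E" "graded_module g E" by (rule dg_bundle_graded[OF assms(1)])+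
qed (rule bdiff_deg[OF assms(1)])

context
  fixes g :: "('k::field_char_0, 'g::ab_group_add) dgla" and E :: "('k, 'g, 'e::ab_group_add) dgvb"
    and M :: "('k, 'm::ab_group_add) gvect" and \<Phi> :: "('g word \<Rightarrow> 'm) \<Rightarrow> 'e"
  assumes L: "dg_lie_algebra g" and E: "dg_bundle g E" and M: "fd_graded M"
    and bij: "bij_betw \<Phi> (coch g M) (sections E)" and add: "additive_on (coch g M) \<Phi>"
    and deg: "\<And>p \<tau>. \<tau> \<in> coch_deg g M p \<Longrightarrow> \<Phi> \<tau> \<in> hsec E p"
    and lin: "\<And>a \<tau>. a \<in> coch g ground \<Longrightarrow> \<tau> \<in> coch g M \<Longrightarrow> \<Phi> (cprod M a \<tau>) = bact E a (\<Phi> \<tau>)"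
begin

lemmas fdg = dgla_fd[OF L]
lemmas cochS = add_subgroup_coch[OF fdg M]

text \<open>The inverse of \<open>\<Phi>\<close>, made extensional because bundle morphisms have to
  be.\<close>

definition coordinates where "coordinates = restrict (inv_into (coch g M) \<Phi>) (sections E)"

lemma coordinates_coch: "x \<in> sections E \<Longrightarrow> coordinates x \<in> coch g M"
  using bij_betwE[OF bij_betw_inv_into[OF bij]] by (simp add: coordinates_def)

lemma \<Phi>_sections: "\<tau> \<in> coch g M \<Longrightarrow> \<Phi> \<tau> \<in> sections E"
  using bij_betwE[OF bij] by blast

lemma \<Phi>_coordinates: "x \<in> sections E \<Longrightarrow> \<Phi> (coordinates x) = x"
  using bij_betw_inv_into_right[OF bij] by (simp add: coordinates_def)

lemma coordinates_eqI: "x \<in> sections E \<Longrightarrow> \<tau> \<in> coch g M \<Longrightarrow> \<Phi> \<tau> = x \<Longrightarrow> coordinates x = \<tau>"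
  using bij_betw_inv_into_left[OF bij] by (auto simp add: coordinates_def)

lemma coordinates_add:
  assumes "x \<in> sections E" "y \<in> sections E"
  shows "coordinates (x + y) = coordinates x + coordinates y"
proof (rule coordinates_eqI)
  show "x + y \<in> sections E"
    by (rule add_subgroup_add[OF graded_module_sections[OF dg_bundle_graded[OF E]] assms])
  show "coordinates x + coordinates y \<in> coch g M" by (intro add_subgroup_add[OF cochS] coordinates_coch assms)
  show "\<Phi> (coordinates x + coordinates y) = x + y"
    using add[unfolded additive_on_def, rule_format, OF coordinates_coch coordinates_coch, OF assms] by (simp only: \<Phi>_coordinates assms)
qed

lemma coordinates_lin:
  assumes "a \<in> coch g ground" "x \<in> sections E"
  shows "coordinates (bact E a x) = cprod M a (coordinates x)"
proof (rule coordinates_eqI)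
  show "bact E a x \<in> sections E" by (rule bact_sections[OF fdg dg_bundle_graded[OF E] assms])
  show "cprod M a (coordinates x) \<in> coch g M" by (intro cprod_coch[OF fdg M] assms coordinates_coch)
  show "\<Phi> (cprod M a (coordinates x)) = bact E a x" by (simp only: lin[OF assms(1) coordinates_coch[OF assms(2)]] \<Phi>_coordinates[OF assms(2)])
qed

text \<open>The premises give degrees for \<open>\<Phi>\<close> only. For its inverse, the images of
  the homogeneous parts of the preimage sum to \<open>x\<close>, and directness in \<open>E\<close>
  leaves only the part of degree \<open>p\<close>.\<close>

lemma coordinates_deg:
  assumes x: "x \<in> hsec E p"
  shows "coordinates x \<in> coch_deg g M p"
proof -
  note G = dg_bundle_graded[OF E]
  note S = graded_module_subgroup[OF G] and SM = add_subgroup_coch_deg[OF fdg M]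
  have xs: "x \<in> sections E" using x by (rule in_dsum)
  have "coordinates x \<in> dsum (coch_deg g M)" using coordinates_coch[OF xs] by (simp only: dsum_coch_deg[OF fdg M])
  then obtain I y where I: "finite I" "\<forall>i\<in>I. y i \<in> coch_deg g M i" "coordinates x = (\<Sum>i\<in>I. y i)"
    by (auto simp: dsum_def)
  \<comment> \<open>Extended by zero, because \<open>p\<close> need not occur in
    \<open>I\<close>.\<close>
  define y' where "y' i = (if i \<in> I then y i else 0)" for i
  have y': "y' i \<in> coch_deg g M i" for i
    using I(2) add_subgroup_zero[OF SM] by (simp add: y'_def)
  define z where "z i = \<Phi> (y' i) + - (if i = p then x else 0)" for i
  have "z i \<in> hsec E i" for i
    unfolding z_def using deg[OF y'] x add_subgroup_zero[OF S]
    by (intro add_subgroup_add[OF S] add_subgroup_minus[OF S]) simp_all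
  moreover have "(\<Sum>i\<in>insert p I. z i) = 0"
  proof -
    have "(\<Sum>i\<in>insert p I. \<Phi> (y' i)) = \<Phi> (\<Sum>i\<in>insert p I. y' i)"
      by (rule additive_on_sum[OF cochS add coch_degD[OF y'], symmetric])
    also have "(\<Sum>i\<in>insert p I. y' i) = (\<Sum>i\<in>I. y' i)"
      by (rule sum.mono_neutral_right) (use I(1) in \<open>auto simp: y'_def\<close>)
    also have "\<dots> = coordinates x" unfolding I(3) by (intro sum.cong) (simp_all add: y'_def)
    also have "\<Phi> (coordinates x) = x" by (rule \<Phi>_coordinates[OF xs])
    finally have 1: "(\<Sum>i\<in>insert p I. \<Phi> (y' i)) = x" .
    have 2: "(\<Sum>i\<in>insert p I. - (if i = p then x else 0)) = - x"
      unfolding sum_negf using I(1) by (subst sum.delta) simp_all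
    show ?thesis unfolding z_def sum.distrib 1 2 by simp
  qed
  ultimately have "z p = 0"
    using graded_module_direct[OF G, unfolded direct_def, rule_format, of "insert p I" z p] I(1) by blast
  then have "\<Phi> (y' p) = x" by (simp add: z_def)
  then have "coordinates x = y' p" by (rule coordinates_eqI[OF xs coch_degD[OF y']])
  then show ?thesis using y' by simp
qed

text \<open>Chosen so that \<open>\<Phi>\<close> intertwines the differentials; the dg axioms are
  then transported from \<open>E\<close>.\<close>

definition pulled_diff :: "('g word \<Rightarrow> 'm) \<Rightarrow> 'g word \<Rightarrow> 'm"
  where "pulled_diff = restrict (\<lambda>\<tau>. coordinates (bdiff E (\<Phi> \<tau>))) (coch g M)"

lemma pulled_diff_apply: "\<tau> \<in> coch g M \<Longrightarrow> pulled_diff \<tau> = coordinates (bdiff E (\<Phi> \<tau>))"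
  by (simp add: pulled_diff_def)

lemma \<Phi>_pulled_diff: "\<tau> \<in> coch g M \<Longrightarrow> \<Phi> (pulled_diff \<tau>) = bdiff E (\<Phi> \<tau>)"
  by (simp only: pulled_diff_apply \<Phi>_coordinates dg_bundle_bdiff_sections[OF E] \<Phi>_sections)

lemma dg_bundle_pulled: "dg_bundle g (cbundle g M pulled_diff)"
  unfolding dg_bundle_def cbundle_simps dsum_coch_deg[OF fdg M]
proof (intro conjI allI ballI)
  note G = dg_bundle_graded[OF E]
  show "graded_module g (cbundle g M pulled_diff)" by (rule graded_module_cbundle[OF fdg M])
  show "fg_free g (cbundle g M pulled_diff)" by (rule fg_free_cbundle[OF fdg M])
  show "pulled_diff \<in> extensional (coch g M)" by (simp add: pulled_diff_def)
  show "pulled_diff \<tau> \<in> coch_deg g M (q + 1)" if "\<tau> \<in> coch_deg g M q" for \<tau> q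
    unfolding pulled_diff_apply[OF coch_degD[OF that]] by (intro coordinates_deg bdiff_deg[OF E] deg that)
  show "pulled_diff (\<sigma> + \<tau>) = pulled_diff \<sigma> + pulled_diff \<tau>" if s: "\<sigma> \<in> coch g M" and t: "\<tau> \<in> coch g M" for \<sigma> \<tau>
  proof -
    have "bdiff E (\<Phi> (\<sigma> + \<tau>)) = bdiff E (\<Phi> \<sigma>) + bdiff E (\<Phi> \<tau>)"
      using bdiff_add[OF E] add \<Phi>_sections s t unfolding additive_on_def by simp
    then show ?thesis
      unfolding pulled_diff_apply[OF s] pulled_diff_apply[OF t] pulled_diff_apply[OF add_subgroup_add[OF cochS s t]]
      by (simp only: coordinates_add dg_bundle_bdiff_sections[OF E] \<Phi>_sections s t)
  qed
  show "pulled_diff (cprod M a \<tau>) =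
      cprod M (dCE g ground a) \<tau> + cprod M (\<lambda>w. ksgn p * a w) (pulled_diff \<tau>)"
    if a: "a \<in> coch_deg g ground p" and t: "\<tau> \<in> coch g M" for a p \<tau>
  proof -
    note ac = coch_degD[OF a]
    have da: "dCE g ground a \<in> coch g ground" by (rule dCE_coch[OF L fd_graded_ground ac])
    have "(\<lambda>w. ksgn p * a w) = (if even p then a else - a)" by (simp add: ksgn_def fun_eq_iff)
    then have ka: "(\<lambda>w. ksgn p * a w) \<in> coch g ground"
      using ac add_subgroup_minus[OF add_subgroup_coch[OF fdg fd_graded_ground] ac] by simp
    note P = \<Phi>_sections[OF t] and dP = dg_bundle_bdiff_sections[OF E \<Phi>_sections[OF t]]
    have "coordinates (\<Phi> \<tau>) = \<tau>" by (rule coordinates_eqI[OF P t refl])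
    then show ?thesis
      unfolding pulled_diff_apply[OF cprod_coch[OF fdg M ac t]] pulled_diff_apply[OF t] lin[OF ac t]
        bdiff_leibniz[OF E a P] coordinates_add[OF bact_sections[OF fdg G da P] bact_sections[OF fdg G ka dP]]
        coordinates_lin[OF da P] coordinates_lin[OF ka dP] by simp
  qed
  show "pulled_diff (pulled_diff \<tau>) = 0" if t: "\<tau> \<in> coch g M" for \<tau>
  proof -
    have c: "pulled_diff \<tau> \<in> coch g M"
      unfolding pulled_diff_apply[OF t] by (intro coordinates_coch dg_bundle_bdiff_sections[OF E] \<Phi>_sections t)
    have "coordinates 0 = 0"
      using additive_on_zero[OF cochS add] add_subgroup_zero[OF cochS]
      by (intro coordinates_eqI add_subgroup_zero[OF graded_module_sections[OF G]])
    then show ?thesis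
      unfolding pulled_diff_apply[OF c] \<Phi>_pulled_diff[OF t] bdiff_sq[OF E \<Phi>_sections[OF t]] .
  qed
qed

lemma \<Phi>_morphism: "bundle_morphism g (cbundle g M pulled_diff) E (restrict \<Phi> (coch g M))"
  unfolding bundle_morphism_def cbundle_simps dsum_coch_deg[OF fdg M]
proof (intro conjI allI ballI)
  note r = restrict_apply'[of _ "coch g M" \<Phi>]
  show "dg_bundle g (cbundle g M pulled_diff)" by (rule dg_bundle_pulled)
  show "dg_bundle g E" by (rule E)
  show "restrict \<Phi> (coch g M) \<in> extensional (coch g M)" by simp
  show "restrict \<Phi> (coch g M) \<tau> \<in> hsec E q" if "\<tau> \<in> coch_deg g M q" for \<tau> q
    unfolding r[OF coch_degD[OF that]] by (rule deg[OF that])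
  show "restrict \<Phi> (coch g M) (\<sigma> + \<tau>) = restrict \<Phi> (coch g M) \<sigma> + restrict \<Phi> (coch g M) \<tau>"
    if "\<sigma> \<in> coch g M" "\<tau> \<in> coch g M" for \<sigma> \<tau>
    unfolding r[OF that(1)] r[OF that(2)] r[OF add_subgroup_add[OF cochS that]]
    using add that unfolding additive_on_def by blast
  show "restrict \<Phi> (coch g M) (cprod M a \<tau>) = bact E a (restrict \<Phi> (coch g M) \<tau>)"
    if "a \<in> coch g ground" "\<tau> \<in> coch g M" for a \<tau>
    unfolding r[OF that(2)] r[OF cprod_coch[OF fdg M that]] by (rule lin[OF that])
  show "restrict \<Phi> (coch g M) (pulled_diff \<tau>) = bdiff E (restrict \<Phi> (coch g M) \<tau>)" if t: "\<tau> \<in> coch g M" for \<tau>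
  proof -
    have "pulled_diff \<tau> \<in> coch g M"
      unfolding pulled_diff_apply[OF t] by (intro coordinates_coch dg_bundle_bdiff_sections[OF E] \<Phi>_sections t)
    then show ?thesis unfolding r[OF t] by (simp only: r \<Phi>_pulled_diff[OF t])
  qed
qed

lemma coordinates_morphism: "bundle_morphism g E (cbundle g M pulled_diff) coordinates"
  unfolding bundle_morphism_def cbundle_simps
proof (intro conjI allI ballI)
  show "dg_bundle g (cbundle g M pulled_diff)" by (rule dg_bundle_pulled)
  show "dg_bundle g E" by (rule E)
  show "coordinates \<in> extensional (sections E)" by (simp add: coordinates_def)
  show "coordinates (bdiff E x) = pulled_diff (coordinates x)" if "x \<in> sections E" for x
    by (simp only: pulled_diff_apply[OF coordinates_coch[OF that]] \<Phi>_coordinates[OF that])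
qed (intro coordinates_deg coordinates_add coordinates_lin; assumption)+

lemma cbundle_isomorphic:
  "\<exists>D \<Phi>' \<Psi>. bundle_morphism g (cbundle g M D) E \<Phi>' \<and> bundle_morphism g E (cbundle g M D) \<Psi> \<and>
    (\<forall>\<tau>\<in>coch g M. \<Psi> (\<Phi>' \<tau>) = \<tau>) \<and> (\<forall>x\<in>sections E. \<Phi>' (\<Psi> x) = x)"
proof -
  have "coordinates (restrict \<Phi> (coch g M) \<tau>) = \<tau>" if "\<tau> \<in> coch g M" for \<tau>
    using coordinates_eqI[OF \<Phi>_sections[OF that] that refl] that by simp
  moreover have "restrict \<Phi> (coch g M) (coordinates x) = x" if "x \<in> sections E" for x
    using \<Phi>_coordinates[OF that] coordinates_coch[OF that] by simp
  ultimately show ?thesis using \<Phi>_morphism coordinates_morphism by blast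
qed

end

lemma dg_bundle_trivialisation:
  fixes g :: "('k::field_char_0, 'g::ab_group_add) dgla" and E :: "('k, 'g, 'e::ab_group_add) dgvb"
  assumes L: "dg_lie_algebra g" and E: "dg_bundle g E"
  obtains M :: "('k, nat \<Rightarrow> 'k) gvect" and D \<Phi> \<Psi>
  where "fd_graded M" "bundle_morphism g (cbundle g M D) E \<Phi>" "bundle_morphism g E (cbundle g M D) \<Psi>"
    "\<forall>\<tau>\<in>coch g M. \<Psi> (\<Phi> \<tau>) = \<tau>" "\<forall>x\<in>sections E. \<Phi> (\<Psi> x) = x"
proof -
  note fd = dgla_fd[OF L]
  obtain M :: "('k, nat \<Rightarrow> 'k) gvect" and \<Phi> where M: "fd_graded M" and T: "bij_betw \<Phi> (coch g M) (sections E)" "additive_on (coch g M) \<Phi>"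
    "\<And>p \<tau>. \<tau> \<in> coch_deg g M p \<Longrightarrow> \<Phi> \<tau> \<in> hsec E p"
    "\<And>a \<tau>. a \<in> coch g ground \<Longrightarrow> \<tau> \<in> coch g M \<Longrightarrow> \<Phi> (cprod M a \<tau>) = bact E a (\<Phi> \<tau>)"
    using trivialisation[OF fd dg_bundle_graded[OF E] dg_bundle_free[OF E]] by blast
  have "\<exists>D \<Phi>' \<Psi>. bundle_morphism g (cbundle g M D) E \<Phi>' \<and> bundle_morphism g E (cbundle g M D) \<Psi> \<and>
    (\<forall>\<tau>\<in>coch g M. \<Psi> (\<Phi>' \<tau>) = \<tau>) \<and> (\<forall>x\<in>sections E. \<Phi>' (\<Psi> x) = x)"
    by (rule cbundle_isomorphic[OF L E M T(1,2)]; (rule T(3,4))?; assumption)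
  then show ?thesis using that[OF M] by blast
qed

section \<open>Composition of bundle morphisms and essential surjectivity\<close>

lemma bundle_morphismD:
  assumes "bundle_morphism g E E' F"
  shows "dg_bundle g E" "dg_bundle g E'" "x \<in> hsec E q \<Longrightarrow> F x \<in> hsec E' q" "additive_on (sections E) F"
    "a \<in> coch g ground \<Longrightarrow> x \<in> sections E \<Longrightarrow> F (bact E a x) = bact E' a (F x)"
    "x \<in> sections E \<Longrightarrow> F (bdiff E x) = bdiff E' (F x)"
proof -
  have *: "dg_bundle g E" "dg_bundle g E'" "\<forall>q. \<forall>x\<in>hsec E q. F x \<in> hsec E' q"
    "\<forall>x\<in>sections E. \<forall>y\<in>sections E. F (x + y) = F x + F y"
    "\<forall>a\<in>coch g ground. \<forall>x\<in>sections E. F (bact E a x) = bact E' a (F x)"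
    "\<forall>x\<in>sections E. F (bdiff E x) = bdiff E' (F x)"
    using assms unfolding bundle_morphism_def by - (elim conjE, assumption)+
  show "dg_bundle g E" "dg_bundle g E'" "x \<in> hsec E q \<Longrightarrow> F x \<in> hsec E' q" "additive_on (sections E) F"
    using *(1-4) unfolding additive_on_def by simp_all
  show "F (bact E a x) = bact E' a (F x)" if "a \<in> coch g ground" "x \<in> sections E"
    by (rule *(5)[rule_format, OF that])
  show "F (bdiff E x) = bdiff E' (F x)" if "x \<in> sections E"
    by (rule *(6)[rule_format, OF that])
qed

lemma bundle_morphism_sections:
  assumes "bundle_morphism g E E' F" "x \<in> sections E"
  shows "F x \<in> sections E'"
proof (rule graded_additive_sections[OF _ _ bundle_morphismD(4)[OF assms(1)] _ assms(2), where e = 0])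
  show "graded_module g E" "graded_module g E'"
    by (rule dg_bundle_graded[OF bundle_morphismD(1)[OF assms(1)]], rule dg_bundle_graded[OF bundle_morphismD(2)[OF assms(1)]])
qed (simp add: bundle_morphismD(3)[OF assms(1)])

lemma bundle_morphism_comp:
  assumes L: "dg_lie_algebra g" and F: "bundle_morphism g E E' F" and F': "bundle_morphism g E' E'' F'"
  shows "bundle_morphism g E E'' (restrict (F' \<circ> F) (sections E))"
  unfolding bundle_morphism_def
proof (intro conjI allI ballI)
  note D = bundle_morphismD[OF F] and D' = bundle_morphismD[OF F'] and FS = bundle_morphism_sections[OF F]
  note G = dg_bundle_graded[OF D(1)]
  show "dg_bundle g E" "dg_bundle g E''" by (rule D(1)) (rule D'(2))
  show "restrict (F' \<circ> F) (sections E) \<in> extensional (sections E)" by simp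
  show "restrict (F' \<circ> F) (sections E) x \<in> hsec E'' q" if "x \<in> hsec E q" for x q
    using in_dsum[of x "hsec E", OF that] D'(3)[OF D(3)[OF that]] by simp
  show "restrict (F' \<circ> F) (sections E) (x + y) = restrict (F' \<circ> F) (sections E) x + restrict (F' \<circ> F) (sections E) y"
    if "x \<in> sections E" "y \<in> sections E" for x y
    using that add_subgroup_add[OF graded_module_sections[OF G] that] D(4) D'(4) FS by (simp add: additive_on_def)
  show "restrict (F' \<circ> F) (sections E) (bact E a x) = bact E'' a (restrict (F' \<circ> F) (sections E) x)"
    if "a \<in> coch g ground" "x \<in> sections E" for a x
    using that bact_sections[OF dgla_fd[OF L] G that] FS by (simp add: D(5) D'(5))
  show "restrict (F' \<circ> F) (sections E) (bdiff E x) = bdiff E'' (restrict (F' \<circ> F) (sections E) x)"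
    if x: "x \<in> sections E" for x
  proof -
    have "bdiff E x \<in> sections E"
      by (rule dg_bundle_bdiff_sections[OF D(1) x])
    then show ?thesis using x FS by (simp add: D(6) D'(6))
  qed
qed

text \<open>Composing \<open>F\<close> with a trivialisation gives a morphism out of some
  \<open>C(g, M)\<close>, which \<open>associated_surj\<close> hits exactly; the trivialisation is
  then the isomorphism over the tangent bundle.\<close>

lemma associated_essentially_surj:
  fixes g :: "('k::field_char_0, 'g::ab_group_add) dgla" and E :: "('k, 'g, 'e::ab_group_add) dgvb"
  assumes L: "dg_lie_algebra g" and F: "(E, F) \<in> morphisms_to_tangent g"
  shows "\<exists>A \<in> (wlp_modules g :: ('k, 'g, nat \<Rightarrow> 'k) wlp set). bundle_iso_over g (associated g A) (E, F)"
proof -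
  note fd = dgla_fd[OF L]
  have F: "bundle_morphism g E (shifted_tangent g) F" using F by (simp add: morphisms_to_tangent_def)
  obtain M :: "('k, nat \<Rightarrow> 'k) gvect" and D \<Phi> \<Psi>
    where M: "fd_graded M" and \<Phi>: "bundle_morphism g (cbundle g M D) E \<Phi>" and \<Psi>: "bundle_morphism g E (cbundle g M D) \<Psi>"
      and inv: "\<forall>\<tau>\<in>coch g M. \<Psi> (\<Phi> \<tau>) = \<tau>" "\<forall>x\<in>sections E. \<Phi> (\<Psi> x) = x"
    by (rule dg_bundle_trivialisation[OF L bundle_morphismD(1)[OF F]])
  have sec: "sections (cbundle g M D) = coch g M" unfolding cbundle_simps by (rule dsum_coch_deg[OF fd M])
  have "(cbundle g M D, restrict (F \<circ> \<Phi>) (coch g M)) \<in> morphisms_to_tangent g"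
    using bundle_morphism_comp[OF L \<Phi> F] unfolding sec by (simp add: morphisms_to_tangent_def)
  then obtain \<delta> f where A: "((M, \<delta>), f) \<in> wlp_modules g"
    "associated g ((M, \<delta>), f) = (cbundle g M D, restrict (F \<circ> \<Phi>) (coch g M))"
    using associated_surj[OF L M] by blast
  have "bundle_iso_over g (cbundle g M D, restrict (F \<circ> \<Phi>) (coch g M)) (E, F)"
    unfolding bundle_iso_over_def prod.case sec
    using \<Phi> \<Psi> inv by (intro exI[of _ \<Phi>] exI[of _ \<Psi>]) simp
  then show ?thesis using A by metis
qed

text \<open>The first part is a literal bijection for each fixed \<open>M\<close>. The other two
  make the correspondence one of isomorphism classes: every morphism to the tangent bundle is
  isomorphic to an associated one, and \<open>associated\<close> both preserves and reflects
  isomorphism.\<close>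

theorem proposition3p16:
  fixes g :: "('k::real_or_complex, 'g::ab_group_add) dgla"
  assumes "dg_lie_algebra g"
  shows
    "(\<forall>M :: ('k, 'm::ab_group_add) gvect. fd_graded M \<longrightarrow>
       bij_betw (associated g)
         {((M', \<delta>), f). ((M', \<delta>), f) \<in> wlp_modules g \<and> M' = M}
         {(E, F). (E, F) \<in> morphisms_to_tangent g \<and> (\<exists>D. E = cbundle g M D)}) \<and>
     (\<forall>X \<in> (morphisms_to_tangent g :: (('k, 'g, 'e::ab_group_add) dgvb \<times> ('e \<Rightarrow> 'g word \<Rightarrow> 'g)) set).
       \<exists>A \<in> (wlp_modules g :: ('k, 'g, nat \<Rightarrow> 'k) wlp set). bundle_iso_over g (associated g A) X) \<and>
     (\<forall>A \<in> (wlp_modules g :: ('k, 'g, 'm) wlp set). \<forall>A' \<in> (wlp_modules g :: ('k, 'g, 'n::ab_group_add) wlp set).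
       wlp_iso g A A' \<longleftrightarrow> bundle_iso_over g (associated g A) (associated g A'))"
proof (intro conjI allI impI ballI)
  fix M :: "('k, 'm) gvect" assume M: "fd_graded M"
  show "bij_betw (associated g) {((M', \<delta>), f). ((M', \<delta>), f) \<in> wlp_modules g \<and> M' = M}
    {(E, F). (E, F) \<in> morphisms_to_tangent g \<and> (\<exists>D. E = cbundle g M D)}"
    (is "bij_betw _ ?A ?B")
  proof (rule bij_betw_imageI)
    show "inj_on (associated g) ?A"
    proof (rule inj_onI)
      fix X Y assume "X \<in> ?A" "Y \<in> ?A" and eq: "associated g X = associated g Y"
      then obtain \<delta> f \<delta>' f' where "X = ((M, \<delta>), f)" "((M, \<delta>), f) \<in> wlp_modules g"
        "Y = ((M, \<delta>'), f')" "((M, \<delta>'), f') \<in> wlp_modules g"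
        by blast
      then show "X = Y" using associated_inj[OF assms, of M \<delta> f \<delta>' f'] eq by simp
    qed
    show "associated g ` ?A = ?B"
    proof
      show "associated g ` ?A \<subseteq> ?B"
      proof
        fix X assume "X \<in> associated g ` ?A"
        then obtain \<delta> f where A: "((M, \<delta>), f) \<in> wlp_modules g" "X = associated g ((M, \<delta>), f)" by blast
        then show "X \<in> ?B"
          using associated_morphism[OF assms A(1)] by (auto simp: associated_eq[OF assms] tot_bundle_eq)
      qed
      show "?B \<subseteq> associated g ` ?A"
      proof
        fix X assume "X \<in> ?B"
        then obtain D F where "X = (cbundle g M D, F)" "(cbundle g M D, F) \<in> morphisms_to_tangent g" by blast
        then obtain \<delta> f where "((M, \<delta>), f) \<in> wlp_modules g" "associated g ((M, \<delta>), f) = X"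
          using associated_surj[OF assms M] by metis
        then show "X \<in> associated g ` ?A" by (intro image_eqI[of _ _ "((M, \<delta>), f)"]) simp_all
      qed
    qed
  qed
next
  fix X :: "('k, 'g, 'e) dgvb \<times> ('e \<Rightarrow> 'g word \<Rightarrow> 'g)"
  assume "X \<in> morphisms_to_tangent g"
  then show "\<exists>A \<in> (wlp_modules g :: ('k, 'g, nat \<Rightarrow> 'k) wlp set). bundle_iso_over g (associated g A) X"
    using associated_essentially_surj[OF assms] by (cases X) blast
next
  fix A :: "('k, 'g, 'm) wlp" and A' :: "('k, 'g, 'n) wlp"
  assume "A \<in> wlp_modules g" "A' \<in> wlp_modules g"
  then show "wlp_iso g A A' \<longleftrightarrow> bundle_iso_over g (associated g A) (associated g A')"
    using wlp_iso_iff[OF assms] by (cases A rule: prod.exhaust, cases "fst A", cases A', cases "fst A'") simp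
qed

end
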